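(* Let $K\ge 2$ and consider the $K$ user real compound interference channel with a finite number $J_j\ge 1$ of possible states at each user $j=1,\dots,K$. Then, almost surely (with respect to the draw of the channel states), the total number of degrees of freedom is $d=\frac{K}{2}$.
   Context: Real compound $K$ user interference channel. There are $K$ single-antenna transmitter–receiver pairs. Transmitter $j$ sends an independent message $W^{[j]}$ of rate $R^{[j]}$ to receiver $j$, $j=1,\dots,K$; each transmitter encodes only its own message. For each receiver $j$ there is a finite set of $J_j$ possible channel vectors (states) $(h^{[j1]}_{k_j},\dots,h^{[jK]}_{k_j})\in\mathbb{R}^K$, $k_j=1,\dots,J_j$. If receiver $j$ is in state $k_j$, its received signal (at each time) is $$y^{[j]}_{k_j}=\sum_{i=1}^{K}h^{[ji]}_{k_j}x^{[i]}+z^{[j]}_{k_j},$$ where $x^{[i]}\in\mathbb{R}$ is the signal of transmitter $i$, subject to the average power constraint $E((x^{[i]})^2)\le P$ (averaged over the codeword), and $z^{[j]}_{k_j}$ is white real Gaussian noise with zero mean and unit variance. The states are fixed throughout the duration of communication. The sets of possible states are known to all nodes and do not depend on $P$; the transmitters do not know which states are realized, while the receivers have perfect channel knowledge. Almost surely. All the coefficients of all possible states are drawn from a continuous distribution (absolutely continuous with respect to Lebesgue measure), so that almost surely they are algebraically independent over the rationals; "almost surely" refers to this draw. Achievable rates. A rate tuple $(R^{[1]},\dots,R^{[K]})$ is achievable at power $P$ if there are codes (encoders not depending on the realized states) of growing block length such that every receiver $j$ decodes $W^{[j]}$ with arbitrarily small error probability, regardless of which state is realized. Degrees of freedom. The total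 number of degrees of freedom is $$d=\lim_{P\to\infty}\frac{C_\Sigma(P)}{\frac12\log P},$$ where $C_\Sigma(P)$ is the supremum of $R^{[1]}+\cdots+R^{[K]}$ over all rate tuples achievable at power $P$. *)

theory Defs
  imports "HOL-Probability.Probability"
begin

text \<open>
  Users are \<open>0..<K\<close>, and receiver \<open>j\<close> has the possible states \<open>0..<J j\<close>. A draw of all channel
  coefficients is a point \<open>H\<close> of the product space over \<open>channel_coords K J\<close>, where \<open>H (j, k, i)\<close>
  is the gain from transmitter \<open>i\<close> to receiver \<open>j\<close> when the latter is in state \<open>k\<close>.
\<close>

definition channel_coords :: "nat \<Rightarrow> (nat \<Rightarrow> nat) \<Rightarrow> (nat \<times> nat \<times> nat) set" where
  "channel_coords K J = {(j, k, i). j < K \<and> k < J j \<and> i < K}"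

definition awgn :: "nat \<Rightarrow> (nat \<Rightarrow> real) measure" where
  "awgn n = (\<Pi>\<^sub>M t\<in>{..<n}. density lborel (\<lambda>x. ennreal (std_normal_density x)))"

text \<open>
  A code of block length \<open>n\<close> consists of message set sizes \<open>M\<close> (transmitter \<open>i\<close> draws its message
  from \<open>{..<M i}\<close>), encoders \<open>enc\<close> (\<open>enc i w t\<close> is the \<open>t\<close>-th symbol sent for message \<open>w\<close>) and
  decoders \<open>dec\<close>. Only \<open>dec j k\<close>, the decoder of receiver \<open>j\<close> in state \<open>k\<close>, knows the state.
\<close>

definition messages :: "nat \<Rightarrow> (nat \<Rightarrow> nat) \<Rightarrow> (nat \<Rightarrow> nat) set" where
  "messages K M = (\<Pi>\<^sub>E i\<in>{..<K}. {..<M i})"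

definition received ::
  "nat \<Rightarrow> (nat \<times> nat \<times> nat \<Rightarrow> real) \<Rightarrow> nat \<Rightarrow> (nat \<Rightarrow> nat \<Rightarrow> nat \<Rightarrow> real) \<Rightarrow> nat \<Rightarrow> nat
    \<Rightarrow> (nat \<Rightarrow> nat) \<Rightarrow> (nat \<Rightarrow> real) \<Rightarrow> nat \<Rightarrow> real" where
  "received K H n enc j k w z = (\<lambda>t\<in>{..<n}. (\<Sum>i<K. H (j, k, i) * enc i (w i) t) + z t)"

text \<open>
  Independent, uniformly distributed messages are the same as a message tuple that is uniform on
  \<open>messages K M\<close>. The expectation in both the error probability and the power is over this draw.
\<close>

definition error_prob ::
  "nat \<Rightarrow> (nat \<times> nat \<times> nat \<Rightarrow> real) \<Rightarrow> nat \<Rightarrow> (nat \<Rightarrow> nat) \<Rightarrow> (nat \<Rightarrow> nat \<Rightarrow> nat \<Rightarrow> real)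
    \<Rightarrow> (nat \<Rightarrow> nat \<Rightarrow> (nat \<Rightarrow> real) \<Rightarrow> nat) \<Rightarrow> nat \<Rightarrow> nat \<Rightarrow> real" where
  "error_prob K H n M enc dec j k =
     (\<Sum>w\<in>messages K M.
        measure (awgn n) {z \<in> space (awgn n). dec j k (received K H n enc j k w z) \<noteq> w j})
     / real (card (messages K M))"

definition avg_power :: "nat \<Rightarrow> (nat \<Rightarrow> nat) \<Rightarrow> (nat \<Rightarrow> nat \<Rightarrow> nat \<Rightarrow> real) \<Rightarrow> nat \<Rightarrow> real" where
  "avg_power n M enc i =
     (\<Sum>w<M i. (\<Sum>t<n. (enc i w t)\<^sup>2) / real n) / real (M i)"

text \<open>Rates are in bits per channel use.\<close>

definition achievable ::
  "nat \<Rightarrow> (nat \<Rightarrow> nat) \<Rightarrow> (nat \<times> nat \<times> nat \<Rightarrow> real) \<Rightarrow> real \<Rightarrow> (nat \<Rightarrow> real) \<Rightarrow> bool" where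
  "achievable K J H P R \<longleftrightarrow>
     (\<forall>j<K. 0 \<le> R j) \<and>
     (\<forall>\<epsilon>>0. \<forall>N. \<exists>n>N. \<exists>M enc dec.
        (\<forall>j<K. 2 powr (real n * R j) \<le> real (M j)) \<and>
        (\<forall>j<K. avg_power n M enc j \<le> P) \<and>
        (\<forall>j<K. \<forall>k<J j.
           dec j k \<in> (\<Pi>\<^sub>M t\<in>{..<n}. borel) \<rightarrow>\<^sub>M count_space UNIV \<and>
           error_prob K H n M enc dec j k \<le> \<epsilon>))"

text \<open>
  The supremum is taken in \<open>ereal\<close>, so that it is meaningful even for degenerate channels in which
  the sum rates are unbounded.
\<close>

definition sum_capacity ::
  "nat \<Rightarrow> (nat \<Rightarrow> nat) \<Rightarrow> (nat \<times> nat \<times> nat \<Rightarrow> real) \<Rightarrow> real \<Rightarrow> ereal" where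
  "sum_capacity K J H P = (SUP R\<in>{R. achievable K J H P R}. ereal (\<Sum>j<K. R j))"

definition has_dof ::
  "nat \<Rightarrow> (nat \<Rightarrow> nat) \<Rightarrow> (nat \<times> nat \<times> nat \<Rightarrow> real) \<Rightarrow> real \<Rightarrow> bool" where
  "has_dof K J H d \<longleftrightarrow>
     ((\<lambda>P. sum_capacity K J H P / ereal (1 / 2 * log 2 P)) \<longlongrightarrow> ereal d) at_top"

end

theory Submission
  imports Defs "HOL-Computational_Algebra.Fundamental_Theorem_Algebra" "HOL-Real_Asymp.Real_Asymp"
begin

text \<open>The half comes from a count of directions. With \<open>m\<close> cross gains, a user
  occupies \<open>L = N ^ m\<close> directions and a receiver sees
  \<open>n = N ^ m + (N + 1) ^ m\<close>; using \<open>T\<close> weights multiplies both by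
  \<open>T\<close>. For integers of size \<open>Q\<close>, received points at power \<open>P\<close>
  are then about \<open>sqrt P / Q ^ (n * T + 1)\<close> apart, so \<open>Q\<close> can grow almost
  like \<open>P powr (1 / (2 * (n * T + 1)))\<close>, and the rate \<open>T * L * log 2 Q\<close> is
  close to \<open>L / n\<close> times \<open>1/2 log P\<close>. The obstacle is the exponent:
  removing bad gains one variable at a time gives some \<open>\<kappa>\<close> far from optimal. It
  depends on \<open>H\<close> and \<open>N\<close> but not on \<open>T\<close>, so \<open>T\<close>
  can be chosen afterwards. Several states do no harm: the cross gains of all states generate the
  monomials, so \<open>J\<close> only affects \<open>m\<close>, and \<open>L / n\<close> tends to
  one half for every fixed \<open>m\<close>. Decoding relies on a distance \<open>2 ^ k\<close> that
  stays fixed as the block length grows, so symbol errors do not vanish by themselves. Removing them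
  costs one bit and the fraction \<open>2 / k\<close> of the rate, negligible for large
  \<open>P\<close> and \<open>k\<close>.\<close>

text \<open>
  Converse: receiver \<open>i\<close> with sufficiently reduced noise could decode the messages of both \<open>i\<close> and
  \<open>i + 1\<close>, so a volume bound gives \<open>R i + R (i + 1) \<le> 1/2 log P + O(1)\<close>; summing around the cycle of
  users yields \<open>K / 2\<close>.

  Achievability is by real interference alignment. Each transmitter sends integers along the
  directions \<open>\<omega> s * e(H)\<close>, where \<open>e\<close> ranges over the monomials of degree less than \<open>N\<close> in each cross gain.
  Multiplication by a cross gain maps these directions into those for \<open>N + 1\<close>, so that all
  interference, in every state, occupies hardly more directions than one user, whereas the
  direct gain moves the desired signal to new directions. Almost every \<open>H\<close> has a finite (possibly large)
  Diophantine exponent with respect to these monomials. Using sufficiently many generic weights \<open>\<omega> s\<close>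
  improves this to the essentially optimal minimum distance, and a Gilbert--Varshamov outer code
  removes the remaining symbol errors.
\<close>

section \<open>Gaussian noise\<close>

abbreviation gauss :: "real measure" where
  "gauss \<equiv> density lborel (\<lambda>x. ennreal (std_normal_density x))"

lemma prob_space_gauss: "prob_space gauss"
  by (rule prob_space_normal_density) simp

lemma product_prob_space_gauss: "product_prob_space (\<lambda>_. gauss)"
  by (simp add: prob_space_gauss prob_space_imp_sigma_finite product_prob_space_axioms.intro
      product_prob_space_def product_sigma_finite_def)

lemma sets_awgn[measurable_cong]: "sets (awgn n) = sets (\<Pi>\<^sub>M t\<in>{..<n}. borel)"
  unfolding awgn_def by (intro sets_PiM_cong) auto

lemma space_awgn: "space (awgn n) = (\<Pi>\<^sub>E t\<in>{..<n}. UNIV)"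
  unfolding awgn_def by (simp add: space_PiM)

lemma prob_space_awgn: "prob_space (awgn n)"
proof -
  interpret product_prob_space "\<lambda>_. gauss" "{..<n}" by (rule product_prob_space_gauss)
  show ?thesis unfolding awgn_def by (rule prob_space_PiM) (rule prob_space_gauss)
qed

lemma nn_integral_gauss:
  assumes [measurable]: "f \<in> borel_measurable borel"
  shows "(\<integral>\<^sup>+x. f x \<partial>gauss) = (\<integral>\<^sup>+x. ennreal (std_normal_density x) * f x \<partial>lborel)"
  by (simp add: nn_integral_density)

lemma nn_integral_gauss_scaled:
  fixes a c :: real and f :: "real \<Rightarrow> ennreal"
  assumes [measurable]: "f \<in> borel_measurable borel" and a: "a \<noteq> 0"
  shows "(\<integral>\<^sup>+x. f (c + a * x) \<partial>gauss) = (\<integral>\<^sup>+y. ennreal (normal_density 0 \<bar>a\<bar> (y - c)) * f y \<partial>lborel)"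
proof -
  have "(\<integral>\<^sup>+y. ennreal (normal_density 0 \<bar>a\<bar> (y - c)) * f y \<partial>lborel)
    = \<bar>a\<bar> * (\<integral>\<^sup>+x. ennreal (normal_density 0 \<bar>a\<bar> (c + a * x - c)) * f (c + a * x) \<partial>lborel)"
    by (rule nn_integral_real_affine) (use a in auto)
  also have "\<dots> = (\<integral>\<^sup>+x. \<bar>a\<bar> * (ennreal (normal_density 0 \<bar>a\<bar> (a * x)) * f (c + a * x)) \<partial>lborel)"
    by (subst nn_integral_cmult) auto
  also have "\<dots> = (\<integral>\<^sup>+x. ennreal (std_normal_density x) * f (c + a * x) \<partial>lborel)"
  proof (rule nn_integral_cong)
    fix x
    have "\<bar>a\<bar> * normal_density 0 \<bar>a\<bar> (a * x) = std_normal_density x"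
      using a by (simp add: normal_density_def power_mult_distrib real_sqrt_mult field_simps)
    then have "ennreal \<bar>a\<bar> * ennreal (normal_density 0 \<bar>a\<bar> (a * x)) = ennreal (std_normal_density x)"
      by (metis abs_ge_zero ennreal_mult' )
    then show "\<bar>a\<bar> * (ennreal (normal_density 0 \<bar>a\<bar> (a * x)) * f (c + a * x))
        = ennreal (std_normal_density x) * f (c + a * x)"
      by (simp add: mult.assoc[symmetric])
  qed
  finally show ?thesis by (simp add: nn_integral_gauss)
qed

text \<open>Sum of independent centred Gaussians: unit noise may be generated in two stages, of
  amplitudes \<open>a\<close> and \<open>b\<close>.\<close>

lemma gauss_convolution:
  fixes a b :: real and f :: "real \<Rightarrow> ennreal"
  assumes [measurable]: "f \<in> borel_measurable borel" and a: "a \<noteq> 0" and b: "b \<noteq> 0"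
    and ab: "a\<^sup>2 + b\<^sup>2 = 1"
  shows "(\<integral>\<^sup>+x. (\<integral>\<^sup>+y. f (a * x + b * y) \<partial>gauss) \<partial>gauss) = (\<integral>\<^sup>+x. f x \<partial>gauss)"
proof -
  let ?A = "\<lambda>x. ennreal (normal_density 0 \<bar>a\<bar> x)" and ?B = "\<lambda>x. ennreal (normal_density 0 \<bar>b\<bar> x)"
  have "(\<integral>\<^sup>+x. (\<integral>\<^sup>+y. f (a * x + b * y) \<partial>gauss) \<partial>gauss)
    = (\<integral>\<^sup>+x. (\<integral>\<^sup>+u. ?B (u - a * x) * f u \<partial>lborel) \<partial>gauss)"
    by (intro nn_integral_cong nn_integral_gauss_scaled b) auto
  also have "\<dots> = (\<integral>\<^sup>+v. ?A v * (\<integral>\<^sup>+u. ?B (u - v) * f u \<partial>lborel) \<partial>lborel)"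
    using nn_integral_gauss_scaled[of "\<lambda>v. \<integral>\<^sup>+u. ?B (u - v) * f u \<partial>lborel" a 0] a by simp
  also have "\<dots> = (\<integral>\<^sup>+v. (\<integral>\<^sup>+u. ?A v * (?B (u - v) * f u) \<partial>lborel) \<partial>lborel)"
    by (intro nn_integral_cong nn_integral_cmult[symmetric]) auto
  also have "\<dots> = (\<integral>\<^sup>+u. (\<integral>\<^sup>+v. ?A v * (?B (u - v) * f u) \<partial>lborel) \<partial>lborel)"
    by (rule lborel_pair.Fubini') auto
  also have "\<dots> = (\<integral>\<^sup>+u. (\<integral>\<^sup>+v. ennreal (normal_density 0 \<bar>b\<bar> (u - v) * normal_density 0 \<bar>a\<bar> v) \<partial>lborel) * f u \<partial>lborel)"
    by (subst nn_integral_multc[symmetric]) (auto intro!: nn_integral_cong simp: ennreal_mult' mult_ac)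
  also have "\<dots> = (\<integral>\<^sup>+u. ennreal (std_normal_density u) * f u \<partial>lborel)"
  proof -
    have "(\<lambda>x. \<integral>\<^sup>+y. ennreal (normal_density 0 \<bar>b\<bar> (x - y) * normal_density 0 \<bar>a\<bar> y) \<partial>lborel)
      = (\<lambda>x. ennreal (normal_density 0 1 x))"
      using conv_normal_density_zero_mean[of "\<bar>b\<bar>" "\<bar>a\<bar>"] a b ab by (simp add: add.commute)
    then show ?thesis by (metis (no_types, lifting))
  qed
  finally show ?thesis by (simp add: nn_integral_gauss)
qed

text \<open>Lets a virtual receiver with weaker noise regenerate the noise of a real one. A product
  measure is determined by its values on boxes, where the integrals factor into scalar
  convolutions.\<close>

lemma awgn_convolution:
  fixes a b :: real and F :: "(nat \<Rightarrow> real) \<Rightarrow> ennreal"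
  assumes F[measurable]: "F \<in> borel_measurable (\<Pi>\<^sub>M t\<in>{..<n}. borel)" and a: "a \<noteq> 0" and b: "b \<noteq> 0"
    and ab: "a\<^sup>2 + b\<^sup>2 = 1"
  shows "(\<integral>\<^sup>+x. (\<integral>\<^sup>+y. F (\<lambda>t\<in>{..<n}. a * x t + b * y t) \<partial>awgn n) \<partial>awgn n) = (\<integral>\<^sup>+x. F x \<partial>awgn n)"
proof -
  interpret product_prob_space "\<lambda>_. gauss" "{..<n}" by (rule product_prob_space_gauss)
  interpret A: prob_space "awgn n" by (rule prob_space_awgn)
  interpret AA: pair_prob_space "awgn n" "awgn n" ..
  define T where "T = (\<lambda>(x, y). \<lambda>t\<in>{..<n}. a * x t + b * y t :: real)"
  have T[measurable]: "T \<in> measurable (awgn n \<Otimes>\<^sub>M awgn n) (\<Pi>\<^sub>M t\<in>{..<n}. borel)"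
    unfolding T_def by measurable
  let ?M = "distr (awgn n \<Otimes>\<^sub>M awgn n) (\<Pi>\<^sub>M t\<in>{..<n}. borel) T"
  have "?M = PiM {..<n} (\<lambda>_. gauss)"
  proof (rule PiM_eqI)
    show "finite {..<n}" by simp
    show "sets ?M = sets (PiM {..<n} (\<lambda>_. gauss))"
      using sets_awgn[of n] by (simp add: awgn_def)
    fix A :: "nat \<Rightarrow> real set" assume "\<And>i. i \<in> {..<n} \<Longrightarrow> A i \<in> sets gauss"
    then have A[measurable]: "\<And>i. i \<in> {..<n} \<Longrightarrow> A i \<in> sets borel" by simp
    have PA[measurable]: "Pi\<^sub>E {..<n} A \<in> sets (\<Pi>\<^sub>M t\<in>{..<n}. borel)"
      by (rule sets_PiM_I_finite) (use A in auto)
    have "emeasure ?M (Pi\<^sub>E {..<n} A) = (\<integral>\<^sup>+w. indicator (Pi\<^sub>E {..<n} A) w \<partial>?M)"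
      by simp
    also have "\<dots> = (\<integral>\<^sup>+w. indicator (Pi\<^sub>E {..<n} A) (T w) \<partial>(awgn n \<Otimes>\<^sub>M awgn n))"
      by (rule nn_integral_distr) auto
    also have "\<dots> = (\<integral>\<^sup>+x. (\<integral>\<^sup>+y. indicator (Pi\<^sub>E {..<n} A) (T (x, y)) \<partial>awgn n) \<partial>awgn n)"
      by (subst A.nn_integral_fst[symmetric]) auto
    also have "\<dots> = (\<integral>\<^sup>+x. (\<integral>\<^sup>+y. (\<Prod>t<n. indicator (A t) (a * x t + b * y t)) \<partial>awgn n) \<partial>awgn n)"
    proof (intro nn_integral_cong)
      fix x y :: "nat \<Rightarrow> real"
      show "indicator (Pi\<^sub>E {..<n} A) (T (x, y)) = (\<Prod>t<n. indicator (A t) (a * x t + b * y t) :: ennreal)"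
        unfolding T_def by (auto simp: indicator_def PiE_iff prod_zero_iff)
    qed
    also have "\<dots> = (\<integral>\<^sup>+x. (\<Prod>t<n. \<integral>\<^sup>+y. indicator (A t) (a * x t + b * y) \<partial>gauss) \<partial>awgn n)"
    proof (intro nn_integral_cong)
      fix x :: "nat \<Rightarrow> real"
      show "(\<integral>\<^sup>+y. (\<Prod>t<n. indicator (A t) (a * x t + b * y t)) \<partial>awgn n)
          = (\<Prod>t<n. \<integral>\<^sup>+y. indicator (A t) (a * x t + b * y) \<partial>gauss)"
        unfolding awgn_def
        by (subst product_nn_integral_prod[where f="\<lambda>t y. indicator (A t) (a * x t + b * y)"]) auto
    qed
    also have "\<dots> = (\<Prod>t<n. \<integral>\<^sup>+x. \<integral>\<^sup>+y. indicator (A t) (a * x + b * y) \<partial>gauss \<partial>gauss)"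
      unfolding awgn_def
      by (subst product_nn_integral_prod[where f="\<lambda>t x. \<integral>\<^sup>+y. indicator (A t) (a * x + b * y) \<partial>gauss"]) auto
    also have "\<dots> = (\<Prod>t<n. \<integral>\<^sup>+x. indicator (A t) x \<partial>gauss)"
      using a b ab by (intro prod.cong refl gauss_convolution) auto
    also have "\<dots> = (\<Prod>t<n. emeasure gauss (A t))"
      by (intro prod.cong refl) auto
    finally show "emeasure ?M (Pi\<^sub>E {..<n} A) = (\<Prod>t<n. emeasure gauss (A t))" .
  qed
  then have "(\<integral>\<^sup>+x. F x \<partial>awgn n) = (\<integral>\<^sup>+x. F x \<partial>?M)" by (simp add: awgn_def)
  also have "\<dots> = (\<integral>\<^sup>+w. F (T w) \<partial>(awgn n \<Otimes>\<^sub>M awgn n))"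
    by (rule nn_integral_distr) auto
  also have "\<dots> = (\<integral>\<^sup>+x. (\<integral>\<^sup>+y. F (T (x, y)) \<partial>awgn n) \<partial>awgn n)"
    by (subst A.nn_integral_fst[symmetric]) auto
  finally show ?thesis by (simp add: T_def)
qed


section \<open>Comparison with Lebesgue measure, and the norm of the noise\<close>

lemma sets_PiM_lborel[measurable_cong]:
  "sets (\<Pi>\<^sub>M t\<in>I. lborel) = sets (\<Pi>\<^sub>M t\<in>I. borel :: real measure)"
  by (intro sets_PiM_cong) auto

lemma sets_PiM_gauss[measurable_cong]: "sets (\<Pi>\<^sub>M t\<in>I. gauss) = sets (\<Pi>\<^sub>M t\<in>I. borel)"
  by (intro sets_PiM_cong) auto

text \<open>Noise of amplitude \<open>\<delta>\<close> has density at most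
  \<open>1 / \<delta>\<close> per coordinate, so its law is dominated by a multiple of Lebesgue
  measure that does not depend on the centre \<open>c\<close>. This turns success probabilities into
  volumes.\<close>

lemma awgn_le_lborel:
  fixes F :: "(nat \<Rightarrow> real) \<Rightarrow> ennreal"
  assumes "F \<in> borel_measurable (\<Pi>\<^sub>M t\<in>{..<n}. borel)" and d: "\<delta> > 0"
  shows "(\<integral>\<^sup>+z. F (\<lambda>t\<in>{..<n}. c t + \<delta> * z t) \<partial>awgn n)
    \<le> ennreal ((1 / \<delta>) ^ n) * (\<integral>\<^sup>+y. F y \<partial>(\<Pi>\<^sub>M t\<in>{..<n}. lborel))"
  using assms(1)
proof (induction n arbitrary: F)
  case 0
  then show ?case
    by (simp add: awgn_def nn_integral_empty PiM_empty nn_integral_count_space_finite)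
next
  case (Suc n)
  interpret g: product_prob_space "\<lambda>_. gauss" "{..<n}" by (rule product_prob_space_gauss)
  interpret l: product_sigma_finite "\<lambda>_::nat. lborel :: real measure" ..
  have S: "{..<Suc n} = insert n {..<n}" by auto
  note F[measurable] = Suc.prems[unfolded S]
  have eq: "(\<lambda>t\<in>insert n {..<n}. c t + \<delta> * (x(n := y)) t) = (\<lambda>t\<in>{..<n}. c t + \<delta> * x t)(n := c n + \<delta> * y)" for x y
    by (auto simp: fun_eq_iff)
  define h where "h u = (\<integral>\<^sup>+x. F (x(n := u)) \<partial>(\<Pi>\<^sub>M t\<in>{..<n}. lborel))" for u
  interpret pl: sigma_finite_measure "\<Pi>\<^sub>M t\<in>{..<n}. lborel :: real measure"
    by (rule l.sigma_finite) simp
  have h[measurable]: "h \<in> borel_measurable borel"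
    unfolding h_def by measurable
  have m1: "(\<lambda>z. F (\<lambda>t\<in>insert n {..<n}. c t + \<delta> * z t)) \<in> borel_measurable (PiM (insert n {..<n}) (\<lambda>_. gauss))"
    by measurable
  have "(\<integral>\<^sup>+z. F (\<lambda>t\<in>{..<Suc n}. c t + \<delta> * z t) \<partial>awgn (Suc n))
    = (\<integral>\<^sup>+y. \<integral>\<^sup>+x. F ((\<lambda>t\<in>{..<n}. c t + \<delta> * x t)(n := c n + \<delta> * y)) \<partial>awgn n \<partial>gauss)"
    unfolding awgn_def S eq[symmetric]
    by (rule g.product_nn_integral_insert_rev[OF _ _ m1]) auto
  also have "\<dots> \<le> (\<integral>\<^sup>+y. ennreal ((1 / \<delta>) ^ n) * h (c n + \<delta> * y) \<partial>gauss)"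
  proof (intro nn_integral_mono)
    fix y
    have "(\<lambda>x. F (x(n := c n + \<delta> * y))) \<in> borel_measurable (\<Pi>\<^sub>M t\<in>{..<n}. borel)" by measurable
    from Suc.IH[OF this] show "(\<integral>\<^sup>+x. F ((\<lambda>t\<in>{..<n}. c t + \<delta> * x t)(n := c n + \<delta> * y)) \<partial>awgn n)
        \<le> ennreal ((1 / \<delta>) ^ n) * h (c n + \<delta> * y)"
      unfolding h_def .
  qed
  also have "\<dots> = ennreal ((1 / \<delta>) ^ n) * (\<integral>\<^sup>+y. ennreal (normal_density 0 \<bar>\<delta>\<bar> (y - c n)) * h y \<partial>lborel)"
    using d by (subst nn_integral_cmult) (auto simp: nn_integral_gauss_scaled)
  also have "\<dots> \<le> ennreal ((1 / \<delta>) ^ n) * (\<integral>\<^sup>+y. ennreal (1 / \<delta>) * h y \<partial>lborel)"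
  proof (intro mult_left_mono nn_integral_mono mult_right_mono ennreal_leI)
    fix y
    have "sqrt (2 * pi * \<delta>\<^sup>2) \<ge> \<delta>"
      using d pi_ge_two by (intro real_le_rsqrt) (auto intro!: mult_mono[of 1 _ "\<delta>\<^sup>2" "\<delta>\<^sup>2", simplified])
    then have "1 / sqrt (2 * pi * \<delta>\<^sup>2) * exp (- (y - c n)\<^sup>2 / (2 * \<delta>\<^sup>2)) \<le> 1 / \<delta> * 1"
      using d by (intro mult_mono divide_left_mono) auto
    then show "normal_density 0 \<bar>\<delta>\<bar> (y - c n) \<le> 1 / \<delta>"
      by (simp add: normal_density_def)
  qed auto
  also have "\<dots> = ennreal ((1 / \<delta>) ^ Suc n) * (\<integral>\<^sup>+y. h y \<partial>lborel)"
    using d by (subst nn_integral_cmult)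
      (auto simp: ennreal_mult'[symmetric] mult.assoc[symmetric] simp del: power_Suc simp add: power_Suc2)
  also have "(\<integral>\<^sup>+y. h y \<partial>lborel) = (\<integral>\<^sup>+y. F y \<partial>(\<Pi>\<^sub>M t\<in>{..<Suc n}. lborel))"
    unfolding S h_def
    by (rule l.product_nn_integral_insert_rev[symmetric]) auto
  finally show ?case .
qed

lemma gauss_second_moment: "(\<integral>\<^sup>+x. ennreal (x\<^sup>2) \<partial>gauss) = 1"
proof -
  have "has_bochner_integral lborel (\<lambda>x. std_normal_density x * x ^ 2) 1"
    using std_normal_moment_even[of 1] by simp
  then have "(\<integral>\<^sup>+x. ennreal (std_normal_density x * x ^ 2) \<partial>lborel) = 1"
    by (subst nn_integral_eq_integral) (auto simp: has_bochner_integral_iff)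
  then show ?thesis by (simp add: nn_integral_gauss ennreal_mult')
qed

lemma awgn_second_moment: "(\<integral>\<^sup>+z. ennreal (\<Sum>t<n. (z t)\<^sup>2) \<partial>awgn n) = ennreal (real n)"
proof -
  interpret g: product_prob_space "\<lambda>_. gauss" "{..<n}" by (rule product_prob_space_gauss)
  have "(\<integral>\<^sup>+z. ennreal (\<Sum>t<n. (z t)\<^sup>2) \<partial>awgn n) = (\<integral>\<^sup>+z. (\<Sum>t<n. ennreal ((z t)\<^sup>2)) \<partial>awgn n)"
    by (intro nn_integral_cong) (simp add: sum_ennreal)
  also have "\<dots> = (\<Sum>t<n. \<integral>\<^sup>+z. ennreal ((z t)\<^sup>2) \<partial>awgn n)"
    by (rule nn_integral_sum) auto
  also have "\<dots> = (\<Sum>t<n. 1)"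
  proof (intro sum.cong refl)
    fix t assume t: "t \<in> {..<n}"
    have "(\<integral>\<^sup>+z. ennreal ((z t)\<^sup>2) \<partial>awgn n) = (\<integral>\<^sup>+x. ennreal (x\<^sup>2) \<partial>(distr (PiM {..<n} (\<lambda>_. gauss)) gauss (\<lambda>z. z t)))"
      unfolding awgn_def using t by (subst nn_integral_distr) auto
    also have "distr (PiM {..<n} (\<lambda>_. gauss)) gauss (\<lambda>z. z t) = gauss"
      using t by (rule g.PiM_component)
    finally show "(\<integral>\<^sup>+z. ennreal ((z t)\<^sup>2) \<partial>awgn n) = 1" using gauss_second_moment by simp
  qed
  finally show ?thesis by (simp add: ennreal_of_nat_eq_real_of_nat)
qed

text \<open>Markov's inequality for the second moment \<open>n\<close>. The \<open>1/4\<close> is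
  one of the two losses charged in \<open>card_decodable_pairs_le\<close>.\<close>

lemma awgn_norm_tail:
  "emeasure (awgn n) {z \<in> space (awgn n). (\<Sum>t<n. (z t)\<^sup>2) > 4 * real n} \<le> ennreal (1/4)"
proof (cases "n = 0")
  case False
  let ?S = "{z \<in> space (awgn n). (\<Sum>t<n. (z t)\<^sup>2) > 4 * real n}"
  have [measurable]: "?S \<in> sets (awgn n)" by measurable
  have "ennreal (4 * real n) * emeasure (awgn n) ?S = (\<integral>\<^sup>+z. ennreal (4 * real n) * indicator ?S z \<partial>awgn n)"
    by (rule nn_integral_cmult_indicator[symmetric]) simp
  also have "\<dots> \<le> (\<integral>\<^sup>+z. ennreal (\<Sum>t<n. (z t)\<^sup>2) \<partial>awgn n)"
    by (intro nn_integral_mono) (auto simp: indicator_def intro!: ennreal_leI)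
  also have "\<dots> = ennreal (4 * real n) * ennreal (1 / 4)"
    by (simp add: awgn_second_moment ennreal_mult'[symmetric])
  finally show ?thesis
    using False by (subst (asm) ennreal_mult_le_mult_iff) auto
qed (simp add: space_awgn)

section \<open>The converse\<close>

lemma borel_measurable_indicator_count_space[measurable]:
  assumes "h \<in> M \<rightarrow>\<^sub>M count_space UNIV"
  shows "(\<lambda>z. indicator W (h z) :: ennreal) \<in> borel_measurable M"
  using assms by (rule measurable_compose) simp

lemma sum_gauss_indicator_le_1:
  assumes "finite A" and [measurable]: "h \<in> awgn n \<rightarrow>\<^sub>M count_space UNIV"
  shows "(\<Sum>w\<in>A. \<integral>\<^sup>+z. indicator {w} (h z) \<partial>awgn n) \<le> 1"
proof -
  interpret prob_space "awgn n" by (rule prob_space_awgn)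
  have "(\<Sum>w\<in>A. \<integral>\<^sup>+z. indicator {w} (h z) \<partial>awgn n) = (\<integral>\<^sup>+z. (\<Sum>w\<in>A. indicator {w} (h z)) \<partial>awgn n)"
    by (rule nn_integral_sum[symmetric]) measurable
  also have "\<dots> \<le> (\<integral>\<^sup>+z. 1 \<partial>awgn n)"
  proof (rule nn_integral_mono)
    fix z
    have "(\<Sum>w\<in>A. indicator {w} (h z) :: ennreal) = (\<Sum>w\<in>A. if h z = w then 1 else 0)"
      by (intro sum.cong) (auto simp: indicator_def)
    also have "\<dots> \<le> 1" using assms(1) by simp
    finally show "(\<Sum>w\<in>A. indicator {w} (h z) :: ennreal) \<le> 1" .
  qed
  finally show ?thesis by (simp add: emeasure_space_1)
qed

text \<open>Replaces the indicator of a ball by a Gaussian weight, whose integral factors over the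
  coordinates. The exponent comes from \<open>(2 * n * B + 8 * n) / (2 * B) \<le> 5 * n\<close> for
  \<open>B \<ge> 1\<close>.\<close>

lemma gaussian_weight_bound:
  assumes B: "B \<ge> 1" and d: "0 < \<delta>" "\<delta> \<le> 1"
    and c: "(\<Sum>t<n. (c t)\<^sup>2) \<le> real n * B" and z: "(\<Sum>t<n. (z t)\<^sup>2) \<le> 4 * real n"
  shows "1 \<le> exp (5 * real n) * (\<Prod>t<n. exp (- (c t + \<delta> * z t)\<^sup>2 / (2 * B)))"
proof -
  have "(\<Sum>t<n. (c t + \<delta> * z t)\<^sup>2) \<le> (\<Sum>t<n. 2 * (c t)\<^sup>2 + 2 * (z t)\<^sup>2)"
  proof (rule sum_mono)
    fix t
    have "(\<delta> * z t)\<^sup>2 \<le> (z t)\<^sup>2"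
      using d by (auto simp: power_mult_distrib intro!: mult_left_le_one_le power_le_one)
    moreover have "(c t + \<delta> * z t)\<^sup>2 \<le> 2 * (c t)\<^sup>2 + 2 * (\<delta> * z t)\<^sup>2"
      using sum_squares_bound[of "c t" "\<delta> * z t"] by (simp add: power2_sum)
    ultimately show "(c t + \<delta> * z t)\<^sup>2 \<le> 2 * (c t)\<^sup>2 + 2 * (z t)\<^sup>2" by simp
  qed
  also have "\<dots> \<le> 2 * (real n * B) + 2 * (4 * real n)"
    using c z by (simp add: sum.distrib sum_distrib_left[symmetric])
  also have "\<dots> \<le> 10 * real n * B"
    using mult_left_mono[OF B, of "8 * real n"] by (simp add: mult.commute)
  finally have "(\<Sum>t<n. (c t + \<delta> * z t)\<^sup>2) / (2 * B) \<le> 5 * real n"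
    using B by (simp add: field_simps)
  then have "1 \<le> exp (5 * real n - (\<Sum>t<n. (c t + \<delta> * z t)\<^sup>2) / (2 * B))" by simp
  also have "\<dots> = exp (5 * real n) * (\<Prod>t<n. exp (- (c t + \<delta> * z t)\<^sup>2 / (2 * B)))"
    by (simp add: exp_sum[symmetric] exp_add[symmetric] sum_divide_distrib sum_negf)
  finally show ?thesis .
qed

lemma lborel_gaussian_weight:
  assumes B: "B > 0"
  shows "(\<integral>\<^sup>+y. (\<Prod>t<n. ennreal (exp (- (y t)\<^sup>2 / (2 * B)))) \<partial>(\<Pi>\<^sub>M t\<in>{..<n}. lborel)) = ennreal (sqrt (2 * pi * B) ^ n)"
proof -
  interpret l: product_sigma_finite "\<lambda>_::nat. lborel :: real measure" ..
  interpret N: prob_space "density lborel (\<lambda>x. ennreal (normal_density 0 (sqrt B) x))"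
    by (rule prob_space_normal_density) (use B in simp)
  have "(\<integral>\<^sup>+x. ennreal (exp (- x\<^sup>2 / (2 * B))) \<partial>lborel)
    = (\<integral>\<^sup>+x. ennreal (sqrt (2 * pi * B)) * ennreal (normal_density 0 (sqrt B) x) \<partial>lborel)"
    using B by (intro nn_integral_cong) (simp add: normal_density_def ennreal_mult'[symmetric])
  also have "\<dots> = ennreal (sqrt (2 * pi * B)) * (\<integral>\<^sup>+x. ennreal (normal_density 0 (sqrt B) x) \<partial>lborel)"
    by (rule nn_integral_cmult) simp
  also have "(\<integral>\<^sup>+x. ennreal (normal_density 0 (sqrt B) x) \<partial>lborel) = 1"
    using N.emeasure_space_1 by (simp add: emeasure_density)
  finally have 1: "(\<integral>\<^sup>+x. ennreal (exp (- x\<^sup>2 / (2 * B))) \<partial>lborel) = ennreal (sqrt (2 * pi * B))" by simp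
  have "(\<integral>\<^sup>+y. (\<Prod>t<n. ennreal (exp (- (y t)\<^sup>2 / (2 * B)))) \<partial>(\<Pi>\<^sub>M t\<in>{..<n}. lborel))
    = (\<Prod>t<n. \<integral>\<^sup>+x. ennreal (exp (- x\<^sup>2 / (2 * B))) \<partial>lborel)"
    by (rule l.product_nn_integral_prod) auto
  then show ?thesis using B unfolding 1 by (simp add: ennreal_power)
qed

text \<open>
  If the first receiver saw only noise of amplitude \<open>\<delta>\<close>, it could decode both messages: adding noise
  restores its own channel, and after subtracting the decoded \<open>X\<^sub>1\<close> and rescaling by \<open>\<rho>\<close> it can
  simulate the second receiver. The functions \<open>\<alpha>\<close> and \<open>\<beta>\<close> are the success probabilities of these
  two simulations, and \<open>\<Sum> \<alpha> \<beta> \<le> 1\<close> bounds the number of decodable pairs by a volume.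
\<close>

lemma card_decodable_pairs_le:
  fixes X1 X2 :: "nat \<Rightarrow> nat \<Rightarrow> real" and f :: "(nat \<Rightarrow> real) \<Rightarrow> nat" and g :: "nat \<Rightarrow> (nat \<Rightarrow> real) \<Rightarrow> nat"
  assumes f[measurable]: "f \<in> (\<Pi>\<^sub>M t\<in>{..<n}. borel) \<rightarrow>\<^sub>M count_space UNIV"
    and g[measurable]: "\<And>w. g w \<in> (\<Pi>\<^sub>M t\<in>{..<n}. borel) \<rightarrow>\<^sub>M count_space UNIV"
    and fin: "finite G"
    and d: "0 < \<delta>" "\<delta> < 1" and r: "\<rho> \<noteq> 0" "\<bar>\<rho>\<bar> * \<delta> < 1" and B: "B \<ge> 1"
    and err: "\<And>w v. (w, v) \<in> G \<Longrightarrow>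
      measure (awgn n) {z \<in> space (awgn n). f (\<lambda>t\<in>{..<n}. X1 w t + X2 v t + z t) \<noteq> w}
      + measure (awgn n) {z \<in> space (awgn n). g w (\<lambda>t\<in>{..<n}. \<rho> * X2 v t + z t) \<noteq> v} \<le> 1/4"
    and pow: "\<And>w v. (w, v) \<in> G \<Longrightarrow> (\<Sum>t<n. (X1 w t + X2 v t)\<^sup>2) \<le> real n * B"
  shows "real (card G) \<le> 2 * (exp 5 / \<delta> * sqrt (2 * pi * B)) ^ n"
proof -
  interpret prob_space "awgn n" by (rule prob_space_awgn)
  \<comment> \<open>Amplitudes of the fresh noise that tops \<open>\<delta>\<close>, respectively
    \<open>\<rho> * \<delta>\<close>, up to unit variance.\<close>
  define b where "b = sqrt (1 - \<delta>\<^sup>2)"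
  define b' where "b' = sqrt (1 - (\<rho> * \<delta>)\<^sup>2)"
  have d2: "\<delta>\<^sup>2 < 1" using d by (simp add: power_less_one_iff)
  have rd2: "(\<rho> * \<delta>)\<^sup>2 < 1" using r d by (auto simp: abs_mult abs_square_less_1)
  have b: "b \<noteq> 0" "\<delta>\<^sup>2 + b\<^sup>2 = 1" and b': "b' \<noteq> 0" "(\<rho> * \<delta>)\<^sup>2 + b'\<^sup>2 = 1"
    using d2 rd2 by (auto simp: b_def b'_def)
  define \<alpha> where "\<alpha> W y = (\<integral>\<^sup>+z. indicator W (f (\<lambda>t\<in>{..<n}. y t + b * z t)) \<partial>awgn n)" for W :: "nat set" and y
  define \<beta> where "\<beta> w V y = (\<integral>\<^sup>+z. indicator V (g w (\<lambda>t\<in>{..<n}. \<rho> * (y t - X1 w t) + b' * z t)) \<partial>awgn n)" for w :: nat and V :: "nat set" and y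
  define N where "N = (\<Pi>\<^sub>M t\<in>{..<n}. borel :: real measure)"
  have \<alpha>m[measurable]: "\<alpha> W \<in> borel_measurable (\<Pi>\<^sub>M t\<in>{..<n}. borel)" for W
    unfolding \<alpha>_def by measurable
  have \<beta>m[measurable]: "\<beta> w V \<in> borel_measurable (\<Pi>\<^sub>M t\<in>{..<n}. borel)" for w V
    unfolding \<beta>_def by measurable
  have \<alpha>1: "\<alpha> {w} y + \<alpha> (- {w}) y = 1" for w y
  proof -
    have "\<alpha> {w} y + \<alpha> (- {w}) y = (\<integral>\<^sup>+z. indicator {w} (f (\<lambda>t\<in>{..<n}. y t + b * z t)) + indicator (- {w}) (f (\<lambda>t\<in>{..<n}. y t + b * z t)) \<partial>awgn n)"
      unfolding \<alpha>_def by (rule nn_integral_add[symmetric]) measurable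
    also have "\<dots> = (\<integral>\<^sup>+z. 1 \<partial>awgn n)" by (rule nn_integral_cong) (auto simp: indicator_def)
    finally show ?thesis by (simp add: emeasure_space_1)
  qed
  have \<beta>1: "\<beta> w {v} y + \<beta> w (- {v}) y = 1" for w v y
  proof -
    have "\<beta> w {v} y + \<beta> w (- {v}) y = (\<integral>\<^sup>+z. indicator {v} (g w (\<lambda>t\<in>{..<n}. \<rho> * (y t - X1 w t) + b' * z t)) + indicator (- {v}) (g w (\<lambda>t\<in>{..<n}. \<rho> * (y t - X1 w t) + b' * z t)) \<partial>awgn n)"
      unfolding \<beta>_def by (rule nn_integral_add[symmetric]) measurable
    also have "\<dots> = (\<integral>\<^sup>+z. 1 \<partial>awgn n)" by (rule nn_integral_cong) (auto simp: indicator_def)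
    finally show ?thesis by (simp add: emeasure_space_1)
  qed
  \<comment> \<open>A union bound at a fixed output: joint success is at least one minus both
    failure probabilities, stated without subtraction because the values are
    \<open>ennreal\<close>.\<close>
  have le1: "1 \<le> \<alpha> {w} y * \<beta> w {v} y + \<alpha> (- {w}) y + \<beta> w (- {v}) y" for w v y
  proof -
    have "\<alpha> {w} y \<le> 1" using \<alpha>1[of w y] by (metis le_iff_add)
    have "\<alpha> {w} y = \<alpha> {w} y * (\<beta> w {v} y + \<beta> w (- {v}) y)" by (simp add: \<beta>1)
    also have "\<dots> \<le> \<alpha> {w} y * \<beta> w {v} y + 1 * \<beta> w (- {v}) y"
      unfolding distrib_left using \<open>\<alpha> {w} y \<le> 1\<close> by (intro add_mono mult_right_mono) auto
    finally have "\<alpha> {w} y + \<alpha> (- {w}) y \<le> \<alpha> {w} y * \<beta> w {v} y + 1 * \<beta> w (- {v}) y + \<alpha> (- {w}) y"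
      by (intro add_mono) auto
    then show ?thesis by (simp add: \<alpha>1 add_ac)
  qed
  \<comment> \<open>At a fixed output \<open>\<alpha>\<close> sums to at most one over
    \<open>w\<close>, and for each \<open>w\<close> so does \<open>\<beta>\<close> over
    \<open>v\<close>; enlarging \<open>G\<close> to a rectangle only increases the sum.\<close>
  have sum_le: "(\<Sum>(w, v)\<in>G. \<alpha> {w} y * \<beta> w {v} y) \<le> 1" for y
  proof -
    have "(\<Sum>(w, v)\<in>G. \<alpha> {w} y * \<beta> w {v} y) \<le> (\<Sum>(w, v)\<in>fst ` G \<times> snd ` G. \<alpha> {w} y * \<beta> w {v} y)"
      using fin by (intro sum_mono2) (auto intro: rev_image_eqI)
    also have "\<dots> = (\<Sum>w\<in>fst ` G. \<alpha> {w} y * (\<Sum>v\<in>snd ` G. \<beta> w {v} y))"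
      by (simp add: sum.cartesian_product[symmetric] sum_distrib_left)
    also have "\<dots> \<le> (\<Sum>w\<in>fst ` G. \<alpha> {w} y * 1)"
      unfolding \<beta>_def using fin
      by (intro sum_mono mult_left_mono sum_gauss_indicator_le_1) auto
    also have "\<dots> \<le> 1"
      unfolding \<alpha>_def mult_1_right using fin by (intro sum_gauss_indicator_le_1) auto
    finally show ?thesis .
  qed
  define W where "W y = (\<Prod>t<n. ennreal (exp (- (y t)\<^sup>2 / (2 * B))))" for y :: "nat \<Rightarrow> real"
  have W[measurable]: "W \<in> borel_measurable (\<Pi>\<^sub>M t\<in>{..<n}. borel)" unfolding W_def by measurable
  define E where "E = ennreal (exp (5 * real n) * (1 / \<delta>) ^ n)"
  define L where "L = (\<Pi>\<^sub>M t\<in>{..<n}. lborel :: real measure)"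
  have L[measurable_cong]: "sets L = sets (\<Pi>\<^sub>M t\<in>{..<n}. borel)" unfolding L_def by (rule sets_PiM_lborel)
  \<comment> \<open>Every pair of \<open>G\<close> captures at least half a unit of success: the two
    decoders together lose at most \<open>1/4\<close>, noise of large norm another
    \<open>1/4\<close>.\<close>
  have good: "ennreal (1/2) \<le> E * (\<integral>\<^sup>+y. \<alpha> {w} y * \<beta> w {v} y * W y \<partial>L)" if G: "(w, v) \<in> G" for w v
  proof -
    define c where "c t = X1 w t + X2 v t" for t
    define Y where "Y z = (\<lambda>t\<in>{..<n}. c t + \<delta> * z t)" for z
    have Ym[measurable]: "Y \<in> (\<Pi>\<^sub>M t\<in>{..<n}. borel) \<rightarrow>\<^sub>M (\<Pi>\<^sub>M t\<in>{..<n}. borel)" unfolding Y_def by measurable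
    let ?A = "{z \<in> space (awgn n). (\<Sum>t<n. (z t)\<^sup>2) > 4 * real n}"
    let ?e1 = "{z \<in> space (awgn n). f (\<lambda>t\<in>{..<n}. c t + z t) \<noteq> w}"
    let ?e2 = "{z \<in> space (awgn n). g w (\<lambda>t\<in>{..<n}. \<rho> * X2 v t + z t) \<noteq> v}"
    have "(\<integral>\<^sup>+z. \<alpha> (- {w}) (Y z) \<partial>awgn n)
      = (\<integral>\<^sup>+z. \<integral>\<^sup>+z'. indicator (- {w}) (f (\<lambda>t\<in>{..<n}. c t + (\<lambda>t\<in>{..<n}. \<delta> * z t + b * z' t) t)) \<partial>awgn n \<partial>awgn n)"
      unfolding \<alpha>_def Y_def by (intro nn_integral_cong arg_cong[where f="indicator _"] arg_cong[where f=f]) auto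
    also have "\<dots> = (\<integral>\<^sup>+z. indicator (- {w}) (f (\<lambda>t\<in>{..<n}. c t + z t)) \<partial>awgn n)"
      using d b by (intro awgn_convolution) auto
    also have "\<dots> = (\<integral>\<^sup>+z. indicator ?e1 z \<partial>awgn n)"
      by (intro nn_integral_cong) (auto simp: indicator_def)
    finally have e1: "(\<integral>\<^sup>+z. \<alpha> (- {w}) (Y z) \<partial>awgn n) = ennreal (measure (awgn n) ?e1)"
      by (simp add: emeasure_eq_measure)
    have "(\<integral>\<^sup>+z. \<beta> w (- {v}) (Y z) \<partial>awgn n)
      = (\<integral>\<^sup>+z. \<integral>\<^sup>+z'. indicator (- {v}) (g w (\<lambda>t\<in>{..<n}. \<rho> * X2 v t + (\<lambda>t\<in>{..<n}. (\<rho> * \<delta>) * z t + b' * z' t) t)) \<partial>awgn n \<partial>awgn n)"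
      unfolding \<beta>_def Y_def c_def
      by (intro nn_integral_cong arg_cong[where f="indicator _"] arg_cong[where f="g w"]) (auto simp: algebra_simps)
    also have "\<dots> = (\<integral>\<^sup>+z. indicator (- {v}) (g w (\<lambda>t\<in>{..<n}. \<rho> * X2 v t + z t)) \<partial>awgn n)"
      using d r b' by (intro awgn_convolution) auto
    also have "\<dots> = (\<integral>\<^sup>+z. indicator ?e2 z \<partial>awgn n)"
      by (intro nn_integral_cong) (auto simp: indicator_def)
    finally have e2: "(\<integral>\<^sup>+z. \<beta> w (- {v}) (Y z) \<partial>awgn n) = ennreal (measure (awgn n) ?e2)"
      by (simp add: emeasure_eq_measure)
    have e12: "ennreal (measure (awgn n) ?e1) + ennreal (measure (awgn n) ?e2) \<le> ennreal (1/4)"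
      using err[OF G] unfolding c_def by (simp add: ennreal_plus[symmetric] ennreal_leI del: ennreal_plus)
    define I where "I = (\<integral>\<^sup>+z. \<alpha> {w} (Y z) * \<beta> w {v} (Y z) * indicator (- ?A) z \<partial>awgn n)"
    have "1 = (\<integral>\<^sup>+z. 1 \<partial>awgn n)" by (simp add: emeasure_space_1)
    also have "\<dots> \<le> (\<integral>\<^sup>+z. \<alpha> {w} (Y z) * \<beta> w {v} (Y z) * indicator (- ?A) z + (\<alpha> (- {w}) (Y z) + \<beta> w (- {v}) (Y z)) + indicator ?A z \<partial>awgn n)"
    proof (intro nn_integral_mono)
      fix z
      show "1 \<le> \<alpha> {w} (Y z) * \<beta> w {v} (Y z) * indicator (- ?A) z + (\<alpha> (- {w}) (Y z) + \<beta> w (- {v}) (Y z)) + indicator ?A z"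
        using le1[of w "Y z" v] by (cases "z \<in> ?A") (auto simp: add_ac)
    qed
    also have "\<dots> = I + (ennreal (measure (awgn n) ?e1) + ennreal (measure (awgn n) ?e2)) + emeasure (awgn n) ?A"
      unfolding I_def by (simp add: nn_integral_add e1 e2)
    also have "\<dots> \<le> I + ennreal (1/4) + ennreal (1/4)"
      by (intro add_mono e12 awgn_norm_tail order.refl)
    finally have "1 \<le> I + ennreal (1/2)"
      by (simp add: add.assoc ennreal_plus[symmetric] del: ennreal_plus)
    then have "ennreal (1/2) \<le> I"
    proof (cases I)
      case (real r)
      have "ennreal 1 \<le> ennreal (r + 1/2)"
        using \<open>1 \<le> I + ennreal (1/2)\<close> ennreal_plus[of r "1/2"] real by simp
      then have "1 \<le> r + 1/2" using real by (subst (asm) ennreal_le_iff) auto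
      then show ?thesis unfolding real by (intro ennreal_leI) simp
    qed simp
    \<comment> \<open>On noise of moderate norm the weight times \<open>exp (5 * n)\<close> is at
      least one; elsewhere the left side vanishes.\<close>
    also have "I \<le> (\<integral>\<^sup>+z. ennreal (exp (5 * real n)) * (\<alpha> {w} (Y z) * \<beta> w {v} (Y z) * W (Y z)) \<partial>awgn n)"
      unfolding I_def
    proof (intro nn_integral_mono)
      fix z assume z: "z \<in> space (awgn n)"
      show "\<alpha> {w} (Y z) * \<beta> w {v} (Y z) * indicator (- ?A) z \<le> ennreal (exp (5 * real n)) * (\<alpha> {w} (Y z) * \<beta> w {v} (Y z) * W (Y z))"
      proof (cases "z \<in> ?A")
        case False
        then have z4: "(\<Sum>t<n. (z t)\<^sup>2) \<le> 4 * real n" using z by auto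
        have "1 \<le> exp (5 * real n) * (\<Prod>t<n. exp (- (c t + \<delta> * z t)\<^sup>2 / (2 * B)))"
          using d B z4 pow[OF G] by (intro gaussian_weight_bound) (auto simp: c_def)
        then have "ennreal 1 \<le> ennreal (exp (5 * real n) * (\<Prod>t<n. exp (- (c t + \<delta> * z t)\<^sup>2 / (2 * B))))"
          by (rule ennreal_leI)
        also have "\<dots> = ennreal (exp (5 * real n)) * W (Y z)"
          unfolding W_def Y_def by (simp add: ennreal_mult' prod_ennreal prod_nonneg)
        finally have "1 \<le> ennreal (exp (5 * real n)) * W (Y z)" by simp
        then have "\<alpha> {w} (Y z) * \<beta> w {v} (Y z) * 1 \<le> \<alpha> {w} (Y z) * \<beta> w {v} (Y z) * (ennreal (exp (5 * real n)) * W (Y z))"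
          by (intro mult_left_mono) auto
        then show ?thesis using False z by (simp add: mult_ac)
      qed auto
    qed
    also have "\<dots> = ennreal (exp (5 * real n)) * (\<integral>\<^sup>+z. \<alpha> {w} (Y z) * \<beta> w {v} (Y z) * W (Y z) \<partial>awgn n)"
      by (rule nn_integral_cmult) measurable
    also have "\<dots> \<le> ennreal (exp (5 * real n)) * (ennreal ((1 / \<delta>) ^ n) * (\<integral>\<^sup>+y. \<alpha> {w} y * \<beta> w {v} y * W y \<partial>L))"
      unfolding Y_def L_def
      by (intro mult_left_mono awgn_le_lborel[where F="\<lambda>y. \<alpha> {w} y * \<beta> w {v} y * W y"] d) auto
    finally show ?thesis using d by (simp add: E_def ennreal_mult' mult.assoc)
  qed
  have "ennreal (real (card G) / 2) = (\<Sum>(w, v)\<in>G. ennreal (1/2))"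
    using ennreal_mult'[of "real (card G)" "1/2"]
    by (simp add: ennreal_of_nat_eq_real_of_nat split_beta del: ennreal_half)
  also have "\<dots> \<le> (\<Sum>(w, v)\<in>G. E * (\<integral>\<^sup>+y. \<alpha> {w} y * \<beta> w {v} y * W y \<partial>L))"
    using good by (intro sum_mono) auto
  also have "\<dots> = E * (\<integral>\<^sup>+y. (\<Sum>(w, v)\<in>G. \<alpha> {w} y * \<beta> w {v} y * W y) \<partial>L)"
    by (subst nn_integral_sum) (auto simp: sum_distrib_left split_beta)
  also have "\<dots> \<le> E * (\<integral>\<^sup>+y. W y \<partial>L)"
  proof (intro mult_left_mono nn_integral_mono)
    fix y
    have "(\<Sum>(w, v)\<in>G. \<alpha> {w} y * \<beta> w {v} y * W y) = (\<Sum>(w, v)\<in>G. \<alpha> {w} y * \<beta> w {v} y) * W y"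
      by (simp add: sum_distrib_right split_beta)
    also have "\<dots> \<le> 1 * W y" by (intro mult_right_mono sum_le) auto
    finally show "(\<Sum>(w, v)\<in>G. \<alpha> {w} y * \<beta> w {v} y * W y) \<le> W y" by simp
  qed auto
  also have "\<dots> = ennreal (exp (5 * real n) * (1 / \<delta>) ^ n * sqrt (2 * pi * B) ^ n)"
    unfolding W_def L_def E_def using B d by (subst lborel_gaussian_weight) (auto simp: ennreal_mult'[symmetric])
  also have "exp (5 * real n) * (1 / \<delta>) ^ n * sqrt (2 * pi * B) ^ n = (exp 5 / \<delta> * sqrt (2 * pi * B)) ^ n"
    by (simp add: power_mult_distrib power_divide exp_of_nat_mult[symmetric] mult_ac)
  finally show ?thesis
    using d B by (subst (asm) ennreal_le_iff) auto
qed

section \<open>From averages over all users to individual pairs of messages\<close>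

lemma card_markov:
  fixes F :: "'a \<Rightarrow> real"
  assumes "finite A" "\<And>x. x \<in> A \<Longrightarrow> 0 \<le> F x" "(\<Sum>x\<in>A. F x) \<le> c * s" "c > 0"
  shows "real (card {x \<in> A. F x > c}) \<le> s"
proof -
  have "real (card {x \<in> A. F x > c}) * c = (\<Sum>x\<in>{x \<in> A. F x > c}. c)" by simp
  also have "\<dots> \<le> (\<Sum>x\<in>{x \<in> A. F x > c}. F x)" by (intro sum_mono) auto
  also have "\<dots> \<le> (\<Sum>x\<in>A. F x)" using assms by (intro sum_mono2) auto
  finally have "c * real (card {x \<in> A. F x > c}) \<le> c * s" using assms(3) by (simp add: mult.commute)
  then show ?thesis using assms(4) by simp
qed

text \<open>Markov's inequality three times: at most a quarter of the pairs have large error, and at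
  most an eighth each involve an over-powered codeword of either user. Codes are constrained only on
  average, whereas the volume bound needs control of every pair.\<close>

lemma card_decodable_ge_half:
  fixes E :: "nat \<times> nat \<Rightarrow> real" and p q :: "nat \<Rightarrow> real"
  assumes m: "\<And>x. E x \<ge> 0" "\<And>a. p a \<ge> 0" "\<And>a. q a \<ge> 0" and c: "c > 0"
    and E: "(\<Sum>x\<in>{..<M}\<times>{..<M'}. E x) \<le> real (M * M') / 16"
    and p: "(\<Sum>a<M. p a) \<le> c * real M" and q: "(\<Sum>a<M'. q a) \<le> c * real M'"
  shows "real (M * M') / 2 \<le> real (card {(a, b) \<in> {..<M}\<times>{..<M'}. E (a, b) \<le> 1/4 \<and> p a \<le> 8 * c \<and> q b \<le> 8 * c})"
proof -
  let ?A = "{..<M}\<times>{..<M'}"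
  let ?G = "{(a, b) \<in> ?A. E (a, b) \<le> 1/4 \<and> p a \<le> 8 * c \<and> q b \<le> 8 * c}"
  let ?B1 = "{x \<in> ?A. E x > 1/4}" and ?B2 = "{x \<in> ?A. p (fst x) > 8 * c}" and ?B3 = "{x \<in> ?A. q (snd x) > 8 * c}"
  have 1: "real (card ?B1) \<le> real (M * M') / 4"
    using m E by (intro card_markov) auto
  have "(\<Sum>x\<in>?A. p (fst x)) = (\<Sum>a<M. \<Sum>b<M'. p a)"
    by (simp add: sum.cartesian_product case_prod_unfold del: sum_constant)
  also have "\<dots> = (\<Sum>a<M. p a) * real M'"
    by (simp add: sum_distrib_left mult.commute)
  also have "\<dots> \<le> c * real M * real M'" using p by (intro mult_right_mono) auto
  finally have 2: "real (card ?B2) \<le> real (M * M') / 8"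
    using m c by (intro card_markov) (auto simp: mult_ac)
  have "(\<Sum>x\<in>?A. q (snd x)) = (\<Sum>a<M. \<Sum>b<M'. q b)"
    by (simp add: sum.cartesian_product case_prod_unfold del: sum_constant)
  also have "\<dots> = (\<Sum>a<M'. q a) * real M"
    by (simp add: mult.commute)
  also have "\<dots> \<le> c * real M' * real M" using q by (intro mult_right_mono) auto
  finally have 3: "real (card ?B3) \<le> real (M * M') / 8"
    using m c by (intro card_markov) (auto simp: mult_ac)
  have "?A \<subseteq> ?G \<union> ?B1 \<union> ?B2 \<union> ?B3" by auto
  then have "card ?A \<le> card (?G \<union> ?B1 \<union> ?B2 \<union> ?B3)"
    by (intro card_mono) (auto intro: finite_subset[of _ ?A])
  also have "\<dots> \<le> card ?G + card ?B1 + card ?B2 + card ?B3"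
    by (meson add_le_mono1 card_Un_le order_trans)
  finally have "real (M * M') \<le> real (card ?G) + real (card ?B1) + real (card ?B2) + real (card ?B3)"
    by (simp only: of_nat_add[symmetric] of_nat_le_iff card_cartesian_product card_lessThan)
  then show ?thesis using 1 2 3 by linarith
qed

lemma ex_le_average:
  fixes F :: "'a \<Rightarrow> real"
  assumes "finite A" "A \<noteq> {}" "(\<Sum>x\<in>A. F x) \<le> real (card A) * c"
  shows "\<exists>x\<in>A. F x \<le> c"
proof (rule ccontr)
  assume "\<not> ?thesis"
  then have "(\<Sum>x\<in>A. c) < (\<Sum>x\<in>A. F x)" using assms by (intro sum_strict_mono) auto
  then show False using assms by simp
qed

text \<open>Splits off the two users of the converse, so that the messages of the others can be
  frozen at a tuple \<open>v\<close> of at most average error.\<close>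

lemma bij_betw_messages_split:
  assumes ij: "i < K" "j < K" "i \<noteq> j"
  shows "bij_betw (\<lambda>(v, a, b). v(i := a, j := b))
    ((\<Pi>\<^sub>E l\<in>{..<K} - {i, j}. {..<M l}) \<times> {..<M i} \<times> {..<M j}) (messages K M)"
proof (rule bij_betw_byWitness[where f'="\<lambda>w. (restrict w ({..<K} - {i, j}), w i, w j)"])
  let ?A = "(\<Pi>\<^sub>E l\<in>{..<K} - {i, j}. {..<M l}) \<times> {..<M i} \<times> {..<M j}"
  let ?f = "\<lambda>(v, a, b). v(i := a, j := b) :: nat \<Rightarrow> nat"
  let ?g = "\<lambda>w :: nat \<Rightarrow> nat. (restrict w ({..<K} - {i, j}), w i, w j)"
  show "\<forall>x\<in>?A. ?g (?f x) = x"
  proof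
    fix x assume x: "x \<in> ?A"
    obtain v a b where vab: "x = (v, a, b)" by (cases x)
    have "restrict (v(i := a, j := b)) ({..<K} - {i, j}) = restrict v ({..<K} - {i, j})"
      by (rule restrict_ext) auto
    also have "\<dots> = v" using x vab by (intro PiE_restrict) auto
    finally show "?g (?f x) = x" using ij vab by simp
  qed
  show "\<forall>w\<in>messages K M. ?f (?g w) = w"
  proof
    fix w assume w: "w \<in> messages K M"
    have "((restrict w ({..<K} - {i, j}))(i := w i, j := w j)) l = w l" for l
      using PiE_arb[OF w[unfolded messages_def], of l] by (cases "l < K") auto
    then show "?f (?g w) = w" by auto
  qed
  show "?f ` ?A \<subseteq> messages K M"
  proof
    fix w assume "w \<in> ?f ` ?A"
    then obtain v a b where v: "v \<in> (\<Pi>\<^sub>E l\<in>{..<K} - {i, j}. {..<M l})" "a < M i" "b < M j"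
      and w: "w = v(i := a, j := b)" by auto
    have "w l \<in> {..<M l}" if "l \<in> {..<K}" for l
      using PiE_mem[OF v(1), of l] that v w by (cases "l = j"; cases "l = i") auto
    moreover have "w l = undefined" if "l \<notin> {..<K}" for l
      using PiE_arb[OF v(1), of l] that ij w by auto
    ultimately show "w \<in> messages K M" unfolding messages_def by (rule PiE_I)
  qed
  show "?g ` messages K M \<subseteq> ?A"
  proof
    fix x assume "x \<in> ?g ` messages K M"
    then obtain w where w: "w \<in> messages K M" and x: "x = ?g w" by blast
    have "w l \<in> {..<M l}" if "l < K" for l
      using PiE_mem[OF w[unfolded messages_def], of l] that by simp
    then show "x \<in> ?A" unfolding x using ij by (auto intro!: restrict_PiE_iff[THEN iffD2])
  qed
qed

lemma sum_two_users:
  fixes F :: "nat \<Rightarrow> 'a::comm_monoid_add"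
  assumes "i < K" "j < K" "i \<noteq> j"
  shows "(\<Sum>l<K. F l) = F i + F j + (\<Sum>l\<in>{..<K} - {i, j}. F l)"
proof -
  have "(\<Sum>l<K. F l) = F i + (\<Sum>l\<in>{..<K} - {i}. F l)"
    using assms by (intro sum.remove) auto
  also have "(\<Sum>l\<in>{..<K} - {i}. F l) = F j + (\<Sum>l\<in>{..<K} - {i} - {j}. F l)"
    using assms by (intro sum.remove) auto
  also have "{..<K} - {i} - {j} = {..<K} - {i, j}" by auto
  finally show ?thesis by (simp add: add.assoc)
qed

text \<open>Once the other messages are frozen, their signals are known constants and move into the
  decoders, which leaves two users and the volume bound. A receiver has to decode in every state, so
  state \<open>0\<close> alone already gives the estimate.\<close>

lemma pair_rate_le:
  assumes ij: "i < K" "j < K" "i \<noteq> j" and J: "J i \<ge> 1" "J j \<ge> 1"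
    and h: "H (i, 0, j) \<noteq> 0" "H (j, 0, j) \<noteq> 0"
  shows "\<exists>C. \<forall>P\<ge>1. \<forall>R. achievable K J H P R \<longrightarrow> R i + R j \<le> C + 1/2 * log 2 P"
proof -
  \<comment> \<open>Rescaling by \<open>\<rho>\<close> turns the gain from \<open>j\<close> to
    receiver \<open>i\<close> into the gain from \<open>j\<close> to receiver \<open>j\<close>. The
    following \<open>\<delta>\<close> depends only on the channel, so it costs a constant in
    rate.\<close>
  define \<rho> where "\<rho> = H (j, 0, j) / H (i, 0, j)"
  define \<delta> where "\<delta> = 1 / (2 * (1 + \<bar>\<rho>\<bar>))"
  have r: "\<rho> \<noteq> 0" using h by (simp add: \<rho>_def)
  have d: "0 < \<delta>" "\<delta> < 1" "\<bar>\<rho>\<bar> * \<delta> < 1" by (auto simp: \<delta>_def field_simps)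
  \<comment> \<open>The \<open>16\<close> is the \<open>8\<close> of Markov's inequality times the
    \<open>2\<close> of \<open>(x + y)\<^sup>2 \<le> 2 * x\<^sup>2 + 2 * y\<^sup>2\<close>.\<close>
  define b where "b = 16 * (1 + (H (i, 0, i))\<^sup>2 + (H (i, 0, j))\<^sup>2)"
  have b: "b \<ge> 1"
  proof -
    have "1 \<le> 16 * (1 + x + y)" if "x \<ge> 0" "y \<ge> 0" for x y :: real using that by simp
    then show ?thesis unfolding b_def by simp
  qed
  define D where "D = exp 5 / \<delta> * sqrt (2 * pi * b)"
  have D: "D > 0" using d b by (simp add: D_def)
  have "R i + R j \<le> (2 + log 2 D) + 1/2 * log 2 P" if P: "P \<ge> 1" and ach: "achievable K J H P R" for P R
  proof -
    \<comment> \<open>Errors of \<open>1/32\<close> at the two receivers add up to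
      \<open>1/16\<close>, so that at most a quarter of the pairs exceed \<open>1/4\<close>.\<close>
    obtain n M enc dec where n: "n > 0"
      and M: "\<forall>j<K. 2 powr (real n * R j) \<le> real (M j)"
      and pw: "\<forall>j<K. avg_power n M enc j \<le> P"
      and dec: "\<forall>j<K. \<forall>k<J j. dec j k \<in> (\<Pi>\<^sub>M t\<in>{..<n}. borel) \<rightarrow>\<^sub>M count_space UNIV \<and>
           error_prob K H n M enc dec j k \<le> 1/32"
    proof -
      from ach have "\<forall>\<epsilon>>0. \<forall>N. \<exists>n>N. \<exists>M enc dec.
        (\<forall>j<K. 2 powr (real n * R j) \<le> real (M j)) \<and>
        (\<forall>j<K. avg_power n M enc j \<le> P) \<and>
        (\<forall>j<K. \<forall>k<J j.
           dec j k \<in> (\<Pi>\<^sub>M t\<in>{..<n}. borel) \<rightarrow>\<^sub>M count_space UNIV \<and>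
           error_prob K H n M enc dec j k \<le> \<epsilon>)"
        unfolding achievable_def by blast
      from this[rule_format, of "1/32" 0] show ?thesis using that by auto
    qed
    have Mpos: "M l > 0" if "l < K" for l
      using M that by (metis gr0I linorder_not_less of_nat_0 powr_gt_zero zero_neq_numeral)
    define e where "e l w = measure (awgn n) {z \<in> space (awgn n). dec l 0 (received K H n enc l 0 w z) \<noteq> w l}" for l w
    define V where "V = (\<Pi>\<^sub>E l\<in>{..<K} - {i, j}. {..<M l})"
    have finV: "finite V" unfolding V_def by (intro finite_PiE) auto
    have Vne: "V \<noteq> {}" unfolding V_def using Mpos by (auto simp: PiE_eq_empty_iff)
    have bij: "bij_betw (\<lambda>(v, a, b). v(i := a, j := b)) (V \<times> {..<M i} \<times> {..<M j}) (messages K M)"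
      unfolding V_def by (rule bij_betw_messages_split[OF ij])
    have cm: "card (messages K M) = card V * (M i * M j)"
      using bij_betw_same_card[OF bij] by (simp add: card_cartesian_product)
    have cpos: "card V > 0" using finV Vne by (simp add: card_gt_0_iff)
    have esum: "(\<Sum>w\<in>messages K M. e l w) \<le> real (card (messages K M)) / 32" if "l = i \<or> l = j" for l
    proof -
      have "(\<Sum>w\<in>messages K M. e l w) / real (card (messages K M)) \<le> 1/32"
        using dec ij J that unfolding error_prob_def e_def by fastforce
      moreover have "real (card (messages K M)) > 0" using cm cpos Mpos ij by simp
      ultimately show ?thesis by (simp add: field_simps)
    qed
    have "(\<Sum>v\<in>V. \<Sum>x\<in>{..<M i}\<times>{..<M j}. e i (v(i := fst x, j := snd x)) + e j (v(i := fst x, j := snd x)))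
       = (\<Sum>w\<in>messages K M. e i w + e j w)"
      unfolding sum.cartesian_product
      by (subst sum.reindex_bij_betw[OF bij, symmetric]) (simp add: split_beta)
    also have "\<dots> \<le> real (card V) * (real (M i * M j) / 16)"
      using esum[of i] esum[of j] by (simp add: sum.distrib cm)
    finally obtain v where v: "v \<in> V"
      and ve: "(\<Sum>x\<in>{..<M i}\<times>{..<M j}. e i (v(i := fst x, j := snd x)) + e j (v(i := fst x, j := snd x))) \<le> real (M i * M j) / 16"
      using ex_le_average[OF finV Vne] by blast
    define E where "E x = e i (v(i := fst x, j := snd x)) + e j (v(i := fst x, j := snd x))" for x
    define p where "p l a = (\<Sum>t<n. (enc l a t)\<^sup>2)" for l a
    have psum: "(\<Sum>a<M l. p l a) \<le> (real n * P) * real (M l)" if l: "l < K" for l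
    proof -
      have "(\<Sum>a<M l. p l a) / real n / real (M l) \<le> P"
        using pw l unfolding avg_power_def p_def by (simp add: sum_divide_distrib)
      then show ?thesis using n Mpos[OF l] by (simp add: field_simps)
    qed
    define G where "G = {(a, b') \<in> {..<M i}\<times>{..<M j}. E (a, b') \<le> 1/4 \<and> p i a \<le> 8 * (real n * P) \<and> p j b' \<le> 8 * (real n * P)}"
    have half: "real (M i * M j) / 2 \<le> real (card G)"
      unfolding G_def
      by (rule card_decodable_ge_half)
         (use n P ve psum ij in \<open>auto simp: E_def e_def p_def intro!: sum_nonneg add_nonneg_nonneg\<close>)
    define X1 where "X1 a t = H (i, 0, i) * enc i a t" for a t
    define X2 where "X2 a t = H (i, 0, j) * enc j a t" for a t
    define o1 where "o1 t = (\<Sum>l\<in>{..<K} - {i, j}. H (i, 0, l) * enc l (v l) t)" for t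
    define o2 where "o2 t = (\<Sum>l\<in>{..<K} - {i, j}. H (j, 0, l) * enc l (v l) t)" for t
    define f where "f y = dec i 0 (\<lambda>t\<in>{..<n}. y t + o1 t)" for y
    define g where "g a y = dec j 0 (\<lambda>t\<in>{..<n}. y t + (H (j, 0, i) * enc i a t + o2 t))" for a y
    have [measurable]: "dec i 0 \<in> (\<Pi>\<^sub>M t\<in>{..<n}. borel) \<rightarrow>\<^sub>M count_space UNIV"
      "dec j 0 \<in> (\<Pi>\<^sub>M t\<in>{..<n}. borel) \<rightarrow>\<^sub>M count_space UNIV"
      using dec ij J by auto
    have fm: "f \<in> (\<Pi>\<^sub>M t\<in>{..<n}. borel) \<rightarrow>\<^sub>M count_space UNIV" unfolding f_def by measurable
    have gm: "g a \<in> (\<Pi>\<^sub>M t\<in>{..<n}. borel) \<rightarrow>\<^sub>M count_space UNIV" for a unfolding g_def by measurable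
    have rec_i: "f (\<lambda>t\<in>{..<n}. X1 a t + X2 a' t + z t) = dec i 0 (received K H n enc i 0 (v(i := a, j := a')) z)" for a a' z
      unfolding f_def received_def using ij
      by (intro arg_cong[where f="dec i 0"] restrict_ext)
         (auto simp: sum_two_users[OF ij] X1_def X2_def o1_def intro!: sum.cong)
    have rec_j: "g a (\<lambda>t\<in>{..<n}. \<rho> * X2 a' t + z t) = dec j 0 (received K H n enc j 0 (v(i := a, j := a')) z)" for a a' z
      unfolding g_def received_def using ij h
      by (intro arg_cong[where f="dec j 0"] restrict_ext)
         (auto simp: sum_two_users[OF ij] X2_def o2_def \<rho>_def intro!: sum.cong)
    have "real (card G) \<le> 2 * (exp 5 / \<delta> * sqrt (2 * pi * (b * P))) ^ n"
    proof (rule card_decodable_pairs_le[OF fm gm _ d(1,2) r d(3)])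
      show "finite G" by (rule finite_subset[of _ "{..<M i}\<times>{..<M j}"]) (auto simp: G_def)
      show "1 \<le> b * P" using b P mult_mono[of 1 b 1 P] by simp
      fix a a' assume aG: "(a, a') \<in> G"
      then show "measure (awgn n) {z \<in> space (awgn n). f (\<lambda>t\<in>{..<n}. X1 a t + X2 a' t + z t) \<noteq> a}
        + measure (awgn n) {z \<in> space (awgn n). g a (\<lambda>t\<in>{..<n}. \<rho> * X2 a' t + z t) \<noteq> a'} \<le> 1/4"
        unfolding rec_i rec_j using ij by (auto simp: G_def E_def e_def)
      have "(\<Sum>t<n. (X1 a t + X2 a' t)\<^sup>2) \<le> (\<Sum>t<n. 2 * (X1 a t)\<^sup>2 + 2 * (X2 a' t)\<^sup>2)"
      proof (rule sum_mono)
        fix t show "(X1 a t + X2 a' t)\<^sup>2 \<le> 2 * (X1 a t)\<^sup>2 + 2 * (X2 a' t)\<^sup>2"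
          using sum_squares_bound[of "X1 a t" "X2 a' t"] by (simp add: power2_sum)
      qed
      also have "\<dots> = 2 * (H (i, 0, i))\<^sup>2 * p i a + 2 * (H (i, 0, j))\<^sup>2 * p j a'"
        by (simp add: sum.distrib sum_distrib_left X1_def X2_def p_def power_mult_distrib mult.assoc)
      also have "\<dots> \<le> 2 * (H (i, 0, i))\<^sup>2 * (8 * (real n * P)) + 2 * (H (i, 0, j))\<^sup>2 * (8 * (real n * P))"
        using aG by (intro add_mono mult_left_mono) (auto simp: G_def)
      also have "\<dots> \<le> real n * (b * P)"
        using n P by (simp add: b_def algebra_simps)
      finally show "(\<Sum>t<n. (X1 a t + X2 a' t)\<^sup>2) \<le> real n * (b * P)" .
    qed
    also have "exp 5 / \<delta> * sqrt (2 * pi * (b * P)) = D * sqrt P"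
      by (simp add: D_def real_sqrt_mult)
    finally have MM: "real (M i) * real (M j) \<le> 4 * (D * sqrt P) ^ n" using half by simp
    have "2 powr (real n * (R i + R j)) = 2 powr (real n * R i) * 2 powr (real n * R j)"
      by (simp add: powr_add distrib_left)
    also have "\<dots> \<le> real (M i) * real (M j)" using M ij by (intro mult_mono) auto
    also note MM
    finally have "log 2 (2 powr (real n * (R i + R j))) \<le> log 2 (4 * (D * sqrt P) ^ n)"
      using D P by (subst log_le_cancel_iff) auto
    then have "real n * (R i + R j) \<le> log 2 4 + real n * (log 2 D + log 2 (sqrt P))"
      using D P by (simp add: log_mult log_nat_power)
    also have "log 2 4 = (2::real)" using log_pow_cancel[of 2 2] by simp
    also have "log 2 (sqrt P) = 1/2 * log 2 P"
      using P by (simp add: powr_half_sqrt[symmetric] log_powr)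
    \<comment> \<open>The constant \<open>2 = log 2 4\<close> is at most \<open>2 * n\<close>, so
      after division by \<open>n\<close> the bound is uniform in the block length.\<close>
    also have "2 + real n * (log 2 D + 1/2 * log 2 P) \<le> real n * (2 + log 2 D + 1/2 * log 2 P)"
      using n by (simp add: distrib_left)
    finally show ?thesis using n by (simp add: mult_le_cancel_left_pos)
  qed
  then show ?thesis by blast
qed

lemma sum_rotate:
  fixes R :: "nat \<Rightarrow> 'a::comm_monoid_add"
  shows "(\<Sum>i<K. R (Suc i mod K)) = (\<Sum>i<K. R i)"
proof (cases K)
  case (Suc m)
  have "(\<Sum>i<Suc m. R (Suc i mod Suc m)) = (\<Sum>i<m. R (Suc i mod Suc m)) + R 0"
    by simp
  also have "(\<Sum>i<m. R (Suc i mod Suc m)) = (\<Sum>i<m. R (Suc i))"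
    by (rule sum.cong) auto
  also have "\<dots> + R 0 = (\<Sum>i<Suc m. R i)"
    by (subst sum.lessThan_Suc_shift) (simp add: add.commute)
  finally show ?thesis using Suc by simp
qed simp

lemma sum_capacity_upper_bound:
  assumes K: "K \<ge> 2" and J: "\<And>j. j < K \<Longrightarrow> J j \<ge> 1"
    and h: "\<And>i j. i < K \<Longrightarrow> j < K \<Longrightarrow> H (i, 0, j) \<noteq> 0"
  shows "\<exists>C. \<forall>P\<ge>1. sum_capacity K J H P \<le> ereal (C + real K / 2 * (1/2 * log 2 P))"
proof -
  have "\<exists>C. \<forall>P\<ge>1. \<forall>R. achievable K J H P R \<longrightarrow> R i + R (Suc i mod K) \<le> C + 1/2 * log 2 P" if "i < K" for i
  proof (rule pair_rate_le)
    show "i \<noteq> Suc i mod K" using K that by (cases "Suc i = K") auto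
  qed (use K J h that in auto)
  then obtain C where C: "\<And>i P R. i < K \<Longrightarrow> P \<ge> 1 \<Longrightarrow> achievable K J H P R \<Longrightarrow>
      R i + R (Suc i mod K) \<le> C i + 1/2 * log 2 P" by metis
  have "sum_capacity K J H P \<le> ereal ((\<Sum>i<K. C i) / 2 + real K / 2 * (1/2 * log 2 P))" if P: "P \<ge> 1" for P
    unfolding sum_capacity_def
  proof (rule SUP_least)
    fix R assume "R \<in> {R. achievable K J H P R}"
    then have "(\<Sum>i<K. R i + R (Suc i mod K)) \<le> (\<Sum>i<K. C i + 1/2 * log 2 P)"
      using C[OF _ P] by (intro sum_mono) auto
    then have "2 * (\<Sum>i<K. R i) \<le> (\<Sum>i<K. C i) + real K * (1/2 * log 2 P)"
      by (simp add: sum.distrib sum_rotate)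
    then show "ereal (\<Sum>i<K. R i) \<le> ereal ((\<Sum>i<K. C i) / 2 + real K / 2 * (1/2 * log 2 P))" by simp
  qed
  then show ?thesis by blast
qed

section \<open>Outer codes and hard decisions\<close>

text \<open>A word of the ball agrees with \<open>c\<close> outside some set of at most
  \<open>r\<close> positions. Counting all \<open>2 ^ n\<close> subsets is crude, but costs only one
  bit per symbol, a constant next to \<open>log 2 P\<close>.\<close>

lemma card_hamming_ball_le:
  assumes A: "finite A" "A \<noteq> {}"
  shows "card {x \<in> (\<Pi>\<^sub>E t\<in>{..<n}. A). card {t. t < n \<and> x t \<noteq> c t} \<le> r} \<le> 2 ^ n * card A ^ r"
proof -
  let ?X = "\<Pi>\<^sub>E t\<in>{..<n}. A"
  let ?F = "\<lambda>T. {x \<in> ?X. \<forall>t\<in>{..<n} - T. x t = c t}"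
  let ?TT = "{T. T \<subseteq> {..<n} \<and> card T \<le> r}"
  have q: "card A \<ge> 1" using A by (simp add: Suc_le_eq card_gt_0_iff)
  have finX: "finite ?X" using A by (intro finite_PiE) auto
  have F: "card (?F T) \<le> card A ^ r" if "T \<in> ?TT" for T
  proof -
    have T: "T \<subseteq> {..<n}" "card T \<le> r" "finite T" using that finite_subset by auto
    have "inj_on (\<lambda>x. restrict x T) (?F T)"
    proof (rule inj_onI)
      fix x y assume xy: "x \<in> ?F T" "y \<in> ?F T" "restrict x T = restrict y T"
      show "x = y"
      proof
        fix t show "x t = y t"
          using xy by (cases "t \<in> T"; cases "t < n") (auto simp: PiE_iff extensional_def dest: fun_cong[of _ _ t])
      qed
    qed
    moreover have "(\<lambda>x. restrict x T) ` ?F T \<subseteq> (\<Pi>\<^sub>E t\<in>T. A)" using T by (auto simp: PiE_iff)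
    moreover have "finite (\<Pi>\<^sub>E t\<in>T. A)" using A T by (intro finite_PiE) auto
    ultimately have "card (?F T) \<le> card (\<Pi>\<^sub>E t\<in>T. A)" by (rule card_inj_on_le)
    also have "\<dots> = card A ^ card T" using T by (simp add: card_PiE)
    also have "\<dots> \<le> card A ^ r" using T q by (intro power_increasing) auto
    finally show ?thesis .
  qed
  have "{x \<in> ?X. card {t. t < n \<and> x t \<noteq> c t} \<le> r} \<subseteq> (\<Union>T\<in>?TT. ?F T)"
  proof
    fix x assume x: "x \<in> {x \<in> ?X. card {t. t < n \<and> x t \<noteq> c t} \<le> r}"
    then have "{t. t < n \<and> x t \<noteq> c t} \<in> ?TT" by auto
    moreover have "x \<in> ?F {t. t < n \<and> x t \<noteq> c t}" using x by auto
    ultimately show "x \<in> (\<Union>T\<in>?TT. ?F T)" by blast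
  qed
  then have "card {x \<in> ?X. card {t. t < n \<and> x t \<noteq> c t} \<le> r} \<le> card (\<Union>T\<in>?TT. ?F T)"
    using finX by (intro card_mono) auto
  also have "\<dots> \<le> (\<Sum>T\<in>?TT. card (?F T))" by (rule card_UN_le) auto
  also have "\<dots> \<le> card ?TT * card A ^ r" using F by (intro sum_bounded_above[where K="card A ^ r", simplified]) auto
  also have "\<dots> \<le> card (Pow {..<n}) * card A ^ r" by (intro mult_right_mono card_mono) auto
  finally show ?thesis by (simp add: card_Pow)
qed

text \<open>The balls of radius \<open>r\<close> around a code that cannot be extended cover all
  words, so a bound on the size of a ball forces the code to be large.\<close>

lemma gilbert_varshamov:
  fixes A :: "'a set"
  assumes A: "finite A" "A \<noteq> {}"
  shows "\<exists>M. \<exists>cw :: nat \<Rightarrow> nat \<Rightarrow> 'a. (\<forall>w<M. cw w \<in> (\<Pi>\<^sub>E t\<in>{..<n}. A)) \<and>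
    (\<forall>w<M. \<forall>v<M. w \<noteq> v \<longrightarrow> r < card {t. t < n \<and> cw w t \<noteq> cw v t}) \<and>
    card A ^ n \<le> M * (2 ^ n * card A ^ r)"
proof -
  let ?X = "\<Pi>\<^sub>E t\<in>{..<n}. A"
  define CC where "CC = {C. C \<subseteq> ?X \<and> (\<forall>x\<in>C. \<forall>y\<in>C. x \<noteq> y \<longrightarrow> r < card {t. t < n \<and> x t \<noteq> y t})}"
  have finX: "finite ?X" using A by (intro finite_PiE) auto
  have finCC: "finite CC" by (rule finite_subset[of _ "Pow ?X"]) (use finX in \<open>auto simp: CC_def\<close>)
  have "{} \<in> CC" by (simp add: CC_def)
  then obtain C where C: "C \<in> CC" and maxC: "\<And>C'. C' \<in> CC \<Longrightarrow> C \<subseteq> C' \<Longrightarrow> C = C'"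
    using finite_has_maximal[OF finCC] by blast
  have CX: "C \<subseteq> ?X" and finC: "finite C" using C finX finite_subset by (auto simp: CC_def)
  have "?X \<subseteq> (\<Union>c\<in>C. {x \<in> ?X. card {t. t < n \<and> x t \<noteq> c t} \<le> r})"
  proof
    fix x assume x: "x \<in> ?X"
    show "x \<in> (\<Union>c\<in>C. {x \<in> ?X. card {t. t < n \<and> x t \<noteq> c t} \<le> r})"
    proof (rule ccontr)
      assume *: "\<not> ?thesis"
      then have far: "r < card {t. t < n \<and> x t \<noteq> c t}" if "c \<in> C" for c using x that by auto
      have comm: "{t. t < n \<and> c t \<noteq> x t} = {t. t < n \<and> x t \<noteq> c t}" for c by auto
      have "insert x C \<in> CC" using C x far by (auto simp: CC_def comm)
      from maxC[OF this] have "x \<in> C" by auto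
      from far[OF this] show False by simp
    qed
  qed
  then have "card ?X \<le> card (\<Union>c\<in>C. {x \<in> ?X. card {t. t < n \<and> x t \<noteq> c t} \<le> r})"
    using finX finC by (intro card_mono) auto
  also have "\<dots> \<le> (\<Sum>c\<in>C. card {x \<in> ?X. card {t. t < n \<and> x t \<noteq> c t} \<le> r})" by (rule card_UN_le[OF finC])
  also have "\<dots> \<le> card C * (2 ^ n * card A ^ r)"
    using card_hamming_ball_le[OF A] by (intro sum_bounded_above[where K="2 ^ n * card A ^ r", simplified]) auto
  finally have size: "card A ^ n \<le> card C * (2 ^ n * card A ^ r)" by (simp add: card_PiE)
  obtain cw where cw: "bij_betw cw {0..<card C} C" using ex_bij_betw_nat_finite[OF finC] by blast
  show ?thesis
  proof (intro exI conjI allI impI)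
    fix w assume "w < card C"
    then have "cw w \<in> C" using bij_betwE[OF cw] by auto
    then show "cw w \<in> ?X" using CX by blast
    fix v assume "v < card C" "w \<noteq> v"
    then have "cw v \<in> C" "cw w \<noteq> cw v"
      using bij_betwE[OF cw] bij_betw_imp_inj_on[OF cw] \<open>w < card C\<close> by (auto dest: inj_onD)
    then show "r < card {t. t < n \<and> cw w t \<noteq> cw v t}"
      using \<open>cw w \<in> C\<close> C unfolding CC_def by blast
  qed (rule size)
qed

section \<open>Large noise samples and symbolwise decoding\<close>

lemma gauss_chebyshev:
  assumes a: "a > 0"
  shows "emeasure gauss {x. a \<le> \<bar>x\<bar>} \<le> ennreal (1 / a\<^sup>2)"
proof -
  have "emeasure gauss {x. a \<le> \<bar>x\<bar>} = (\<integral>\<^sup>+x. indicator {x. a \<le> \<bar>x\<bar>} x \<partial>gauss)"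
    by (rule nn_integral_indicator[symmetric]) simp
  also have "\<dots> \<le> (\<integral>\<^sup>+x. ennreal (1 / a\<^sup>2) * ennreal (x\<^sup>2) \<partial>gauss)"
  proof (rule nn_integral_mono)
    fix x
    have "1 \<le> 1 / a\<^sup>2 * x\<^sup>2" if "a \<le> \<bar>x\<bar>"
      using a that power_mono[of a "\<bar>x\<bar>" 2] by (simp add: field_simps)
    then show "indicator {x. a \<le> \<bar>x\<bar>} x \<le> ennreal (1 / a\<^sup>2) * ennreal (x\<^sup>2)"
      by (auto simp: indicator_def ennreal_mult'[symmetric] ennreal_1[symmetric] simp del: ennreal_1 intro!: ennreal_leI)
  qed
  also have "\<dots> = ennreal (1 / a\<^sup>2)"
    by (subst nn_integral_cmult) (auto simp: gauss_second_moment)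
  finally show ?thesis .
qed

text \<open>Union bound over at most \<open>2 ^ n\<close> sets \<open>T\<close> of large samples. By
  Chebyshev's inequality each set has probability at most
  \<open>(1 / 4 ^ k) ^ card T \<le> 1 / 4 ^ n\<close>, which explains the threshold
  \<open>2 ^ k\<close>.\<close>

lemma awgn_many_large_samples:
  assumes a: "a \<ge> 2 ^ k" and k: "k > 0"
  shows "measure (awgn n) {z \<in> space (awgn n). n \<le> k * card {t. t < n \<and> a \<le> \<bar>z t\<bar>}} \<le> (1/2) ^ n"
proof -
  interpret prob_space "awgn n" by (rule prob_space_awgn)
  interpret g: product_prob_space "\<lambda>_. gauss" "{..<n}" by (rule product_prob_space_gauss)
  define TT where "TT = {T. T \<subseteq> {..<n} \<and> n \<le> k * card T}"
  define F where "F T = {z \<in> space (awgn n). \<forall>t\<in>T. a \<le> \<bar>z t\<bar>}" for T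
  have a0: "a > 0" using a by (meson less_le_trans zero_less_numeral zero_less_power)
  have fTT: "finite TT" by (rule finite_subset[of _ "Pow {..<n}"]) (auto simp: TT_def)
  have ev: "F T \<in> sets (awgn n)" if "T \<in> TT" for T
  proof -
    have "finite T" "\<And>t. t \<in> T \<Longrightarrow> t \<in> {..<n}" using that finite_subset by (auto simp: TT_def)
    then show ?thesis unfolding F_def by measurable
  qed
  have F: "measure (awgn n) (F T) \<le> (1/4) ^ n" if T: "T \<in> TT" for T
  proof -
    have Tn: "T \<subseteq> {..<n}" "n \<le> k * card T" using T by (auto simp: TT_def)
    have "F T = (\<Pi>\<^sub>E t\<in>{..<n}. if t \<in> T then {x. a \<le> \<bar>x\<bar>} else UNIV)"
      unfolding F_def space_awgn using Tn by (auto simp: PiE_iff extensional_def split: if_splits)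
    then have "emeasure (awgn n) (F T) = (\<Prod>t<n. emeasure gauss (if t \<in> T then {x. a \<le> \<bar>x\<bar>} else UNIV))"
      unfolding awgn_def by (simp add: g.emeasure_PiM)
    also have "\<dots> = (\<Prod>t<n. if t \<in> T then emeasure gauss {x. a \<le> \<bar>x\<bar>} else 1)"
      using prob_space.emeasure_space_1[OF prob_space_gauss] by (intro prod.cong) auto
    also have "\<dots> = (\<Prod>t\<in>T. emeasure gauss {x. a \<le> \<bar>x\<bar>})"
      using Tn by (subst prod.inter_restrict[symmetric]) (auto simp: Int_absorb1)
    also have "\<dots> \<le> (\<Prod>t\<in>T. ennreal (1 / a\<^sup>2))"
      by (intro prod_mono_ennreal gauss_chebyshev a0)
    also have "\<dots> = ennreal ((1 / a\<^sup>2) ^ card T)" by (simp add: ennreal_power)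
    also have "\<dots> \<le> ennreal ((1/4) ^ n)"
    proof (rule ennreal_leI)
      have "(4::real) ^ k = (2 ^ k)\<^sup>2" by (simp add: power_mult[symmetric] mult.commute[of k] power_mult)
      also have "\<dots> \<le> a\<^sup>2" using a by (intro power_mono) auto
      finally have "1 / a\<^sup>2 \<le> (1/4) ^ k" using a0 by (simp add: power_one_over frac_le)
      then have "(1 / a\<^sup>2) ^ card T \<le> ((1/4) ^ k) ^ card T" by (intro power_mono) auto
      also have "\<dots> = (1/4) ^ (k * card T)" by (simp add: power_mult)
      also have "\<dots> \<le> (1/4) ^ n" using Tn by (intro power_decreasing) auto
      finally show "(1 / a\<^sup>2) ^ card T \<le> (1/4) ^ n" .
    qed
    finally show ?thesis by (simp add: emeasure_eq_measure)
  qed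
  have "{z \<in> space (awgn n). n \<le> k * card {t. t < n \<and> a \<le> \<bar>z t\<bar>}} \<subseteq> (\<Union>T\<in>TT. F T)"
    by (auto simp: TT_def F_def intro!: exI[of _ "{t. t < n \<and> a \<le> \<bar>_ t\<bar>}"])
  then have "measure (awgn n) {z \<in> space (awgn n). n \<le> k * card {t. t < n \<and> a \<le> \<bar>z t\<bar>}} \<le> measure (awgn n) (\<Union>T\<in>TT. F T)"
    using ev fTT by (intro finite_measure_mono) auto
  also have "\<dots> \<le> (\<Sum>T\<in>TT. measure (awgn n) (F T))"
    using ev fTT by (intro finite_measure_subadditive_finite) auto
  also have "\<dots> \<le> real (card TT) * (1/4) ^ n" using F by (intro sum_bounded_above) auto
  also have "\<dots> \<le> 2 ^ n * (1/4) ^ n"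
  proof -
    have "card TT \<le> card (Pow {..<n})" by (intro card_mono) (auto simp: TT_def)
    then have "card TT \<le> 2 ^ n" by (simp add: card_Pow)
    then have "real (card TT) \<le> 2 ^ n" by (metis numeral_power_le_of_nat_cancel_iff of_nat_le_iff of_nat_numeral of_nat_power)
    then show ?thesis by (intro mult_right_mono) auto
  qed
  also have "\<dots> = (1/2) ^ n" by (simp add: power_mult_distrib[symmetric])
  finally show ?thesis .
qed

text \<open>
  The receiver tests, symbol by symbol, which codewords of its own transmitter are compatible with
  the received value for some choice of interfering symbols, and picks the first codeword that fails
  this test in fewer than \<open>n / k\<close> positions. At most that many noise samples are large.
\<close>

lemma achievable_if_separated:
  fixes A :: "'a set" and x :: "'a \<Rightarrow> real"
  assumes A: "finite A" "A \<noteq> {}" and k: "k > 0" and d: "d \<ge> 2 ^ k"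
    and P: "\<And>a. a \<in> A \<Longrightarrow> (x a)\<^sup>2 \<le> P"
    and sep: "\<And>j l u v. j < K \<Longrightarrow> l < J j \<Longrightarrow> u \<in> (\<Pi>\<^sub>E i\<in>{..<K}. A) \<Longrightarrow> v \<in> (\<Pi>\<^sub>E i\<in>{..<K}. A) \<Longrightarrow> u j \<noteq> v j \<Longrightarrow>
      2 * d \<le> \<bar>(\<Sum>i<K. H (j, l, i) * x (u i)) - (\<Sum>i<K. H (j, l, i) * x (v i))\<bar>"
    and R: "\<And>j. j < K \<Longrightarrow> 0 \<le> R j" "\<And>j. j < K \<Longrightarrow> R j \<le> (1 - 2 / real k) * log 2 (real (card A)) - 1"
  shows "achievable K J H P R"
  unfolding achievable_def
proof (intro conjI allI impI)
  fix \<epsilon> :: real and N :: nat assume \<epsilon>: "\<epsilon> > 0"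
  have q: "card A \<ge> 1" using A by (simp add: Suc_le_eq card_gt_0_iff)
  obtain n0 where n0: "(1/2 :: real) ^ n0 < \<epsilon>" using real_arch_pow_inv[OF \<epsilon>, of "1/2"] by auto
  define n where "n = max (Suc N) n0"
  have n: "n > N" "n > 0" by (auto simp: n_def)
  have "n0 \<le> n" by (simp add: n_def)
  then have half: "(1/2 :: real) ^ n \<le> \<epsilon>"
    using power_decreasing[of n0 n "1/2 :: real"] n0 by linarith
  \<comment> \<open>Large noise and a wrongly accepted codeword each account for fewer than
    \<open>n / k\<close> positions, so the wrong and the true codeword would differ in fewer than
    \<open>2 * n / k\<close>.\<close>
  define r where "r = 2 * n div k"
  obtain M and cw :: "nat \<Rightarrow> nat \<Rightarrow> 'a" where cwA: "\<And>w. w < M \<Longrightarrow> cw w \<in> (\<Pi>\<^sub>E t\<in>{..<n}. A)"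
    and dist: "\<And>w v. w < M \<Longrightarrow> v < M \<Longrightarrow> w \<noteq> v \<Longrightarrow> r < card {t. t < n \<and> cw w t \<noteq> cw v t}"
    and size: "card A ^ n \<le> M * (2 ^ n * card A ^ r)"
    using gilbert_varshamov[OF A, of n r] by blast
  have "M > 0" using size q by (cases M) auto
  define enc where "enc i w t = x (cw w t)" for i :: nat and w t
  \<comment> \<open>Values within \<open>d\<close> of a noiseless output whose own symbol is
    \<open>a\<close>. The separation \<open>2 * d\<close> makes these open sets disjoint for
    distinct \<open>a\<close>; the interfering symbols need not be identified.\<close>
  define U where "U j l a = (\<Union>u\<in>{u \<in> (\<Pi>\<^sub>E i\<in>{..<K}. A). u j = a}. ball (\<Sum>i<K. H (j, l, i) * x (u i)) d)" for j l a
  have Um[measurable]: "U j l a \<in> sets borel" for j l a unfolding U_def by (intro borel_open open_UN) auto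
  define miss where "miss j l w y = card {t \<in> {..<n}. y t \<notin> U j l (cw w t)}" for j l w y
  \<comment> \<open>The disjunct \<open>M \<le> w\<close> guarantees that a least element exists. If
    no codeword passes, the answer is \<open>M\<close>, which is not a message and hence an
    error.\<close>
  define dec where "dec j l y = (LEAST w. M \<le> w \<or> k * miss j l w y < n)" for j l y
  have Udisj: "a = b" if "y \<in> U j l a" "y \<in> U j l b" "j < K" "l < J j" for j l a b y
  proof (rule ccontr)
    assume ne: "a \<noteq> b"
    from that obtain u v where u: "u \<in> (\<Pi>\<^sub>E i\<in>{..<K}. A)" "u j = a" "dist (\<Sum>i<K. H (j, l, i) * x (u i)) y < d"
      and v: "v \<in> (\<Pi>\<^sub>E i\<in>{..<K}. A)" "v j = b" "dist (\<Sum>i<K. H (j, l, i) * x (v i)) y < d"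
      by (auto simp: U_def)
    have "2 * d \<le> \<bar>(\<Sum>i<K. H (j, l, i) * x (u i)) - (\<Sum>i<K. H (j, l, i) * x (v i))\<bar>"
      using sep[OF that(3,4) u(1) v(1)] u v ne by auto
    then show False using u(3) v(3) by (auto simp: dist_real_def)
  qed
  have decm: "dec j l \<in> (\<Pi>\<^sub>M t\<in>{..<n}. borel) \<rightarrow>\<^sub>M count_space UNIV" for j l
  proof -
    have "(\<lambda>y. miss j l w y) \<in> (\<Pi>\<^sub>M t\<in>{..<n}. borel) \<rightarrow>\<^sub>M count_space UNIV" for w
      unfolding miss_def
    proof (rule measurable_card)
      fix t
      show "{y \<in> space (\<Pi>\<^sub>M t\<in>{..<n}. borel). t \<in> {t \<in> {..<n}. y t \<notin> U j l (cw w t)}} \<in> sets (\<Pi>\<^sub>M t\<in>{..<n}. borel)"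
        by (cases "t < n") auto
    qed
    note [measurable] = this
    show ?thesis unfolding dec_def by measurable
  qed
  have correct: "dec j l (received K H n enc j l w z) = w j"
    if jl: "j < K" "l < J j" and w: "w \<in> messages K (\<lambda>_. M)" and z: "k * card {t. t < n \<and> d \<le> \<bar>z t\<bar>} < n" for j l w z
  proof -
    define y where "y = received K H n enc j l w z"
    let ?bad = "{t. t < n \<and> d \<le> \<bar>z t\<bar>}"
    have wM: "w i < M" if "i < K" for i using w that by (auto simp: messages_def)
    have inU: "y t \<in> U j l (cw (w j) t)" if t: "t < n" "t \<notin> ?bad" for t
    proof -
      let ?u = "\<lambda>i\<in>{..<K}. cw (w i) t"
      have "?u \<in> (\<Pi>\<^sub>E i\<in>{..<K}. A)" using cwA wM t by (auto simp: PiE_iff)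
      moreover have "?u j = cw (w j) t" using jl by simp
      moreover have "dist (\<Sum>i<K. H (j, l, i) * x (?u i)) (y t) < d"
        using t by (simp add: y_def received_def enc_def dist_real_def)
      ultimately show ?thesis unfolding U_def by (intro UN_I[of ?u]) auto
    qed
    have "miss j l (w j) y \<le> card ?bad"
      unfolding miss_def using inU by (intro card_mono) auto
    then have ok: "k * miss j l (w j) y < n" using z by (meson le_less_trans mult_le_mono2)
    have uniq: "v = w j" if v: "v < M" "k * miss j l v y < n" for v
    proof (rule ccontr)
      assume "v \<noteq> w j"
      then have "r < card {t. t < n \<and> cw v t \<noteq> cw (w j) t}" using dist[of v "w j"] v wM jl by auto
      \<comment> \<open>Where the codewords differ and the noise is small, the output lies in the
        set of the true symbol, hence not in that of \<open>v\<close>.\<close>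
      also have "\<dots> \<le> card ({t \<in> {..<n}. y t \<notin> U j l (cw v t)} \<union> ?bad)"
        using inU Udisj jl by (intro card_mono) auto
      also have "\<dots> \<le> miss j l v y + card ?bad" unfolding miss_def by (rule card_Un_le)
      finally have "Suc r \<le> miss j l v y + card ?bad" by simp
      then have "k * Suc r \<le> k * miss j l v y + k * card ?bad" by (metis distrib_left mult_le_mono2)
      also have "\<dots> < 2 * n" using v z by simp
      finally show False unfolding r_def using k
        by (metis div_less_iff_less_mult lessI mult.commute not_less_iff_gr_or_eq order_less_trans)
    qed
    have "dec j l y = w j"
      unfolding dec_def
    proof (rule Least_equality)
      show "M \<le> w j \<or> k * miss j l (w j) y < n" using ok by simp
      show "w j \<le> v" if "M \<le> v \<or> k * miss j l v y < n" for v
        using that uniq[of v] wM[OF jl(1)] by (cases "v < M") auto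
    qed
    then show ?thesis by (simp add: y_def)
  qed
  have "error_prob K H n (\<lambda>_. M) enc dec j l \<le> \<epsilon>" if jl: "j < K" "l < J j" for j l
  proof -
    interpret prob_space "awgn n" by (rule prob_space_awgn)
    let ?B = "{z \<in> space (awgn n). n \<le> k * card {t. t < n \<and> d \<le> \<bar>z t\<bar>}}"
    have Bm: "?B \<in> sets (awgn n)"
    proof -
      have "(\<lambda>z. card {t. t < n \<and> d \<le> \<bar>z t\<bar>}) \<in> awgn n \<rightarrow>\<^sub>M count_space UNIV"
      proof (rule measurable_card)
        fix t
        show "{z \<in> space (awgn n). t \<in> {t. t < n \<and> d \<le> \<bar>z t\<bar>}} \<in> sets (awgn n)"
          by (cases "t < n") auto
      qed
      note [measurable] = this
      show ?thesis by measurable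
    qed
    have "(\<Sum>w\<in>messages K (\<lambda>_. M). measure (awgn n) {z \<in> space (awgn n). dec j l (received K H n enc j l w z) \<noteq> w j})
      \<le> (\<Sum>w\<in>messages K (\<lambda>_. M). \<epsilon>)"
    proof (rule sum_mono)
      fix w assume w: "w \<in> messages K (\<lambda>_. M)"
      have "measure (awgn n) {z \<in> space (awgn n). dec j l (received K H n enc j l w z) \<noteq> w j} \<le> measure (awgn n) ?B"
        using correct[OF jl w] by (intro finite_measure_mono Bm) (auto simp: not_le[symmetric])
      also have "\<dots> \<le> (1/2) ^ n" by (rule awgn_many_large_samples[OF d k])
      finally show "measure (awgn n) {z \<in> space (awgn n). dec j l (received K H n enc j l w z) \<noteq> w j} \<le> \<epsilon>"
        using half by simp
    qed
    moreover have "card (messages K (\<lambda>_. M)) > 0" using \<open>M > 0\<close> by (simp add: messages_def card_PiE)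
    ultimately show ?thesis by (simp add: error_prob_def field_simps)
  qed
  moreover have "avg_power n (\<lambda>_. M) enc j \<le> P" if "j < K" for j
  proof -
    have "(\<Sum>w<M. (\<Sum>t<n. (enc j w t)\<^sup>2) / real n) \<le> (\<Sum>w<M. P)"
    proof (rule sum_mono)
      fix w assume "w \<in> {..<M}"
      then have "(\<Sum>t<n. (enc j w t)\<^sup>2) \<le> (\<Sum>t<n. P)"
        unfolding enc_def using cwA by (intro sum_mono P) (auto simp: PiE_iff)
      then show "(\<Sum>t<n. (enc j w t)\<^sup>2) / real n \<le> P" using n by (simp add: field_simps)
    qed
    then show ?thesis using \<open>M > 0\<close> by (simp add: avg_power_def field_simps)
  qed
  \<comment> \<open>Dividing the size bound by \<open>2 ^ n\<close> loses the one bit, and dividing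
    by \<open>card A ^ r\<close> with \<open>r \<le> 2 * n / k\<close> loses the fraction
    \<open>2 / k\<close>.\<close>
  moreover have "2 powr (real n * R j) \<le> real M" if j: "j < K" for j
  proof -
    define L where "L = log 2 (real (card A))"
    have L: "L \<ge> 0" "real (card A) = 2 powr L" using q by (auto simp: L_def)
    have pw: "real (card A) ^ m = 2 powr (real m * L)" for m
      by (simp add: L(2) powr_powr mult.commute powr_realpow[symmetric])
    have "real r \<le> 2 * real n / real k"
      unfolding r_def using of_nat_div_le_of_nat[of "2 * n" k, where ?'a = real] by simp
    then have rL: "real r * L \<le> 2 * real n / real k * L" using L by (intro mult_right_mono) auto
    have "real n * R j \<le> real n * ((1 - 2 / real k) * L - 1)"
      using R(2)[OF j] by (intro mult_left_mono) (auto simp: L_def)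
    also have "\<dots> = real n * L - real n - 2 * real n / real k * L" by (simp add: algebra_simps)
    also have "\<dots> \<le> real n * L - real n - real r * L" using rL by simp
    finally have "2 powr (real n * R j) * (2 powr real n * 2 powr (real r * L)) \<le> 2 powr (real n * L)"
      by (simp add: powr_add[symmetric])
    also have "\<dots> = real (card A ^ n)" by (simp add: pw)
    also have "\<dots> \<le> real (M * (2 ^ n * card A ^ r))" using size of_nat_le_iff by blast
    also have "\<dots> = real M * (2 powr real n * 2 powr (real r * L))" by (simp add: pw powr_realpow)
    finally show ?thesis by simp
  qed
  ultimately show "\<exists>n>N. \<exists>M enc dec.
        (\<forall>j<K. 2 powr (real n * R j) \<le> real (M j)) \<and>
        (\<forall>j<K. avg_power n M enc j \<le> P) \<and>
        (\<forall>j<K. \<forall>k<J j.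
           dec j k \<in> (\<Pi>\<^sub>M t\<in>{..<n}. borel) \<rightarrow>\<^sub>M count_space UNIV \<and>
           error_prob K H n M enc dec j k \<le> \<epsilon>)"
    using decm n(1) by (intro exI[of _ n] conjI exI[of _ "\<lambda>_. M"] exI[of _ enc] exI[of _ dec]) auto
qed (use R in auto)

section \<open>Diophantine exponents of almost all channels\<close>

text \<open>Over the complex numbers \<open>p\<close> splits into linear factors. If the product of
  the distances from \<open>t\<close> to the roots is below \<open>\<eta> ^ degree p\<close>, some
  root is within \<open>\<eta>\<close>, and \<open>t\<close> lies in an interval of length
  \<open>2 * \<eta>\<close> around its real part.\<close>

lemma poly_sublevel_measure:
  fixes p :: "real poly"
  assumes p: "p \<noteq> 0" and \<eta>: "\<eta> > 0"
  shows "emeasure lborel {t. \<bar>poly p t\<bar> < \<bar>lead_coeff p\<bar> * \<eta> ^ degree p} \<le> ennreal (2 * real (degree p) * \<eta>)"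
proof -
  define q where "q = map_poly complex_of_real p"
  have q: "q \<noteq> 0" "degree q = degree p" "lead_coeff q = of_real (lead_coeff p)"
    using p by (auto simp: q_def map_poly_eq_0_iff degree_map_poly coeff_map_poly)
  obtain A where A: "size A = degree q" "q = smult (lead_coeff q) (\<Prod>x\<in>#A. [:-x, 1:])"
    using alg_closed_imp_factorization[OF q(1)] by blast
  have sub: "{t. \<bar>poly p t\<bar> < \<bar>lead_coeff p\<bar> * \<eta> ^ degree p} \<subseteq> (\<Union>x\<in>set_mset A. {Re x - \<eta>..Re x + \<eta>})"
  proof
    fix t assume "t \<in> {t. \<bar>poly p t\<bar> < \<bar>lead_coeff p\<bar> * \<eta> ^ degree p}"
    then have t: "\<bar>poly p t\<bar> < \<bar>lead_coeff p\<bar> * \<eta> ^ degree p" by simp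
    have "complex_of_real (poly p t) = poly q (of_real t)"
      by (simp add: q_def poly_altdef degree_map_poly coeff_map_poly)
    also have "\<dots> = lead_coeff q * (\<Prod>x\<in>#A. of_real t - x)"
      by (subst A(2)) (simp add: poly_prod_mset image_mset.compositionality o_def)
    finally have "\<bar>poly p t\<bar> = \<bar>lead_coeff p\<bar> * cmod (\<Prod>x\<in>#A. of_real t - x)"
      by (metis norm_mult norm_of_real q(3))
    moreover have "cmod (\<Prod>x\<in>#A. of_real t - x) = (\<Prod>x\<in>#A. cmod (of_real t - x))"
      by (induction A) (auto simp: norm_mult)
    ultimately have lt: "(\<Prod>x\<in>#A. cmod (of_real t - x)) < \<eta> ^ size A"
      using t p A(1) q(2) by simp
    have "\<exists>x\<in>#B. cmod (of_real t - x) < \<eta>" if "(\<Prod>x\<in>#B. cmod (of_real t - x)) < \<eta> ^ size B" for B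
      using that
    proof (induction B)
      case (add x B)
      show ?case
      proof (cases "cmod (of_real t - x) < \<eta>")
        case False
        have "(\<Prod>x\<in>#B. cmod (of_real t - x)) < \<eta> ^ size B"
        proof (rule ccontr)
          assume "\<not> ?thesis"
          then have "\<eta> * \<eta> ^ size B \<le> cmod (of_real t - x) * (\<Prod>x\<in>#B. cmod (of_real t - x))"
            using False \<eta> by (intro mult_mono) auto
          then show False using add.prems by simp
        qed
        then show ?thesis using add.IH by auto
      qed auto
    qed simp
    from this[OF lt] obtain x where x: "x \<in># A" "cmod (of_real t - x) < \<eta>" by blast
    have "\<bar>t - Re x\<bar> \<le> cmod (of_real t - x)" using abs_Re_le_cmod[of "of_real t - x"] by simp
    then show "t \<in> (\<Union>x\<in>set_mset A. {Re x - \<eta>..Re x + \<eta>})" using x by force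
  qed
  have "emeasure lborel {t. \<bar>poly p t\<bar> < \<bar>lead_coeff p\<bar> * \<eta> ^ degree p} \<le> emeasure lborel (\<Union>x\<in>set_mset A. {Re x - \<eta>..Re x + \<eta>})"
    by (rule emeasure_mono[OF sub]) auto
  also have "\<dots> \<le> (\<Sum>x\<in>set_mset A. emeasure lborel {Re x - \<eta>..Re x + \<eta>})"
    by (rule emeasure_subadditive_finite) auto
  also have "\<dots> = (\<Sum>x\<in>set_mset A. ennreal (2 * \<eta>))" using \<eta> by simp
  also have "\<dots> = ennreal (real (card (set_mset A)) * (2 * \<eta>))"
    using \<eta> by (simp add: ennreal_mult' ennreal_of_nat_eq_real_of_nat)
  also have "\<dots> \<le> ennreal (2 * real (degree p) * \<eta>)"
  proof -
    have "card (set_mset A) \<le> size A" by (induction A) (auto simp: card_insert_if)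
    then have "card (set_mset A) \<le> degree p" using A q by simp
    then show ?thesis using \<eta> by (intro ennreal_leI) auto
  qed
  finally show ?thesis .
qed

section \<open>Integer forms in monomials of bounded degree\<close>

definition exps :: "'i set \<Rightarrow> nat \<Rightarrow> ('i \<Rightarrow> nat) set" where
  "exps I D = (\<Pi>\<^sub>E i\<in>I. {..<D})"

definition mono_val :: "'i set \<Rightarrow> ('i \<Rightarrow> real) \<Rightarrow> ('i \<Rightarrow> nat) \<Rightarrow> real" where
  "mono_val I x e = (\<Prod>i\<in>I. x i ^ e i)"

definition int_tuples :: "'e set \<Rightarrow> nat \<Rightarrow> ('e \<Rightarrow> int) set" where
  "int_tuples E Q = {a \<in> (\<Pi>\<^sub>E e\<in>E. {- int Q..int Q}). \<exists>e\<in>E. a e \<noteq> 0}"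

text \<open>A finite Diophantine exponent \<open>\<kappa>\<close>, with constant
  \<open>1 / m\<close>. Both are natural numbers, so that the predicate uses countable quantifiers
  and is measurable.\<close>

definition dioph :: "'i set \<Rightarrow> nat \<Rightarrow> ('i \<Rightarrow> real) \<Rightarrow> bool" where
  "dioph I D x \<longleftrightarrow> (\<exists>\<kappa> m :: nat. \<forall>Q\<ge>1. \<forall>a\<in>int_tuples (exps I D) Q.
     1 \<le> real m * real Q ^ \<kappa> * \<bar>\<Sum>e\<in>exps I D. of_int (a e) * mono_val I x e\<bar>)"

lemma finite_exps: "finite I \<Longrightarrow> finite (exps I D)"
  unfolding exps_def by (intro finite_PiE) auto

lemma finite_int_tuples: "finite E \<Longrightarrow> finite (int_tuples E Q)"
  unfolding int_tuples_def by (rule finite_subset[of _ "\<Pi>\<^sub>E e\<in>E. {- int Q..int Q}"]) (auto intro: finite_PiE)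

lemma int_tuples_mono: "Q \<le> Q' \<Longrightarrow> int_tuples E Q \<subseteq> int_tuples E Q'"
  using PiE_mono[of E "\<lambda>_. {- int Q..int Q}" "\<lambda>_. {- int Q'..int Q'}"] unfolding int_tuples_def by auto

lemma int_tuplesD:
  assumes "a \<in> int_tuples E Q"
  shows "e \<in> E \<Longrightarrow> \<bar>a e\<bar> \<le> int Q" "e \<notin> E \<Longrightarrow> a e = undefined" "\<exists>e\<in>E. a e \<noteq> 0"
proof -
  have a: "a \<in> (\<Pi>\<^sub>E e\<in>E. {- int Q..int Q})" and "\<exists>e\<in>E. a e \<noteq> 0"
    using assms by (auto simp: int_tuples_def)
  then show "\<exists>e\<in>E. a e \<noteq> 0" by simp
  show "\<bar>a e\<bar> \<le> int Q" if "e \<in> E" using PiE_mem[OF a that] by auto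
  show "a e = undefined" if "e \<notin> E" using PiE_arb[OF a that] .
qed

lemma int_tuplesI:
  assumes "\<And>e. e \<in> E \<Longrightarrow> \<bar>a e\<bar> \<le> int Q" "\<And>e. e \<notin> E \<Longrightarrow> a e = undefined" "e0 \<in> E" "a e0 \<noteq> 0"
  shows "a \<in> int_tuples E Q"
proof -
  have "a e \<in> {- int Q..int Q}" if "e \<in> E" for e using assms(1)[OF that] by auto
  then have "a \<in> (\<Pi>\<^sub>E e\<in>E. {- int Q..int Q})" using assms(2) by (rule PiE_I)
  then show ?thesis using assms(3,4) by (auto simp: int_tuples_def)
qed

lemma card_int_tuples_le: "finite E \<Longrightarrow> Q \<ge> 1 \<Longrightarrow> card (int_tuples E Q) \<le> (3 * Q) ^ card E"
proof -
  assume E: "finite E" and Q: "Q \<ge> 1"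
  have "card (int_tuples E Q) \<le> card (\<Pi>\<^sub>E e\<in>E. {- int Q..int Q})"
    unfolding int_tuples_def using E by (intro card_mono finite_PiE) auto
  also have "\<dots> = (2 * Q + 1) ^ card E" using E by (simp add: card_PiE nat_add_distrib nat_mult_distrib)
  also have "\<dots> \<le> (3 * Q) ^ card E" using Q by (intro power_mono) auto
  finally show ?thesis .
qed

lemma exps_insert:
  assumes "i \<notin> I"
  shows "bij_betw (\<lambda>(k, e). e(i := k)) ({..<D} \<times> exps I D) (exps (insert i I) D)"
  unfolding exps_def bij_betw_def
proof
  show "inj_on (\<lambda>(k, e). e(i := k)) ({..<D} \<times> (\<Pi>\<^sub>E i\<in>I. {..<D}))"
    using inj_combinator[OF assms, of "\<lambda>_. {..<D}"] by simp
  show "(\<lambda>(k, e). e(i := k)) ` ({..<D} \<times> (\<Pi>\<^sub>E i\<in>I. {..<D})) = (\<Pi>\<^sub>E i\<in>insert i I. {..<D})"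
    by (simp add: PiE_insert_eq)
qed

text \<open>Makes the form a polynomial in the new variable whose coefficients are forms of the same
  type in the old ones, as needed for induction on the variables.\<close>

lemma sum_exps_insert:
  assumes I: "finite I" "i \<notin> I"
  shows "(\<Sum>e\<in>exps (insert i I) D. f e * mono_val (insert i I) (x(i := t)) e)
    = (\<Sum>k<D. (\<Sum>e\<in>exps I D. f (e(i := k)) * mono_val I x e) * t ^ k)"
proof -
  have "(\<Sum>e\<in>exps (insert i I) D. f e * mono_val (insert i I) (x(i := t)) e)
    = (\<Sum>(k, e)\<in>{..<D} \<times> exps I D. f (e(i := k)) * mono_val (insert i I) (x(i := t)) (e(i := k)))"
    by (subst sum.reindex_bij_betw[OF exps_insert[OF I(2)], symmetric]) (simp add: split_beta)
  also have "\<dots> = (\<Sum>k<D. \<Sum>e\<in>exps I D. f (e(i := k)) * mono_val (insert i I) (x(i := t)) (e(i := k)))"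
    by (simp add: sum.cartesian_product)
  also have "\<dots> = (\<Sum>k<D. (\<Sum>e\<in>exps I D. f (e(i := k)) * mono_val I x e) * t ^ k)"
  proof -
    have "mono_val (insert i I) (x(i := t)) (e(i := k)) = mono_val I x e * t ^ k" for e k
    proof -
      have "(\<Prod>j\<in>I. (x(i := t)) j ^ (e(i := k)) j) = (\<Prod>j\<in>I. x j ^ e j)"
        using I by (intro prod.cong) auto
      then show ?thesis using I by (simp add: mono_val_def)
    qed
    then show ?thesis by (simp add: sum_distrib_right mult.assoc)
  qed
  finally show ?thesis .
qed

text \<open>
  The leading coefficient in the new variable is a nonzero integer polynomial in the old ones, so it
  is already bounded below.
\<close>

lemma dioph_insert_AE:
  assumes I: "finite I" "i \<notin> I" and x: "dioph I D x"
  shows "AE t in lborel. dioph (insert i I) D (x(i := t))"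
proof -
  obtain \<kappa> m where km: "\<And>Q a. Q \<ge> 1 \<Longrightarrow> a \<in> int_tuples (exps I D) Q \<Longrightarrow>
     1 \<le> real m * real Q ^ \<kappa> * \<bar>\<Sum>e\<in>exps I D. of_int (a e) * mono_val I x e\<bar>"
    using x unfolding dioph_def by blast
  define E where "E = exps (insert i I) D"
  have finE: "finite E" unfolding E_def by (rule finite_exps) (use I in auto)
  define c where "c a k = (\<Sum>e\<in>exps I D. real_of_int (a (e(i := k))) * mono_val I x e)" for a :: "('a \<Rightarrow> nat) \<Rightarrow> int" and k
  define p where "p a = (\<Sum>k<D. monom (c a k) k)" for a
  have p_eval: "(\<Sum>e\<in>E. of_int (a e) * mono_val (insert i I) (x(i := t)) e) = poly (p a) t" for a t
    unfolding E_def p_def c_def by (subst sum_exps_insert[OF I]) (simp add: poly_sum poly_monom)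
  have p_coeff: "coeff (p a) k = (if k < D then c a k else 0)" for a k
    unfolding p_def by (auto simp: coeff_sum sum.delta)
  have pdeg: "degree (p a) < D \<or> p a = 0" for a
    by (metis p_coeff leading_coeff_0_iff)
  have lead: "p a \<noteq> 0 \<and> 1 \<le> real m * real Q ^ \<kappa> * \<bar>lead_coeff (p a)\<bar>" if a: "a \<in> int_tuples E Q" and Q: "Q \<ge> 1" for a Q
  proof -
    have c0: "1 \<le> real m * real Q ^ \<kappa> * \<bar>c a k\<bar>" if "k < D" "\<exists>e\<in>exps I D. a (e(i := k)) \<noteq> 0" for k
    proof -
      have "restrict (\<lambda>e. a (e(i := k))) (exps I D) \<in> int_tuples (exps I D) Q"
        using that a bij_betwE[OF exps_insert[OF I(2), of D]] by (auto simp: int_tuples_def E_def PiE_iff)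
      from km[OF Q this] show ?thesis unfolding c_def by (simp cong: sum.cong)
    qed
    obtain e0 where "e0 \<in> E" "a e0 \<noteq> 0" using a by (auto simp: int_tuples_def)
    then obtain k e where ke: "k < D" "e \<in> exps I D" "a (e(i := k)) \<noteq> 0"
      using bij_betw_imp_surj_on[OF exps_insert[OF I(2), of D]] unfolding E_def by force
    then have "\<exists>e\<in>exps I D. a (e(i := k)) \<noteq> 0" by blast
    from c0[OF ke(1) this] have "c a k \<noteq> 0" by auto
    then have p0: "p a \<noteq> 0" using p_coeff[of a k] ke by auto
    have d: "degree (p a) < D" using pdeg p0 by blast
    have lc: "lead_coeff (p a) = c a (degree (p a))" using p_coeff d by simp
    then have "c a (degree (p a)) \<noteq> 0" using p0 by (metis leading_coeff_0_iff)
    then have "\<exists>e\<in>exps I D. a (e(i := degree (p a))) \<noteq> 0"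
      unfolding c_def by (metis (no_types, lifting) mult_zero_left of_int_0 sum.neutral)
    from c0[OF d this] p0 lc show ?thesis by simp
  qed
  define M where "M = card E"
  \<comment> \<open>There are at most \<open>(3 * Q) ^ M\<close> tuples, each excluding a set of
    measure at most \<open>2 * D * \<eta> Q\<close>; the exponent \<open>M + 2\<close> leaves the
    summable \<open>1 / Q ^ 2\<close>.\<close>
  define \<eta> where "\<eta> Q = 1 / real Q ^ (M + 2)" for Q
  define B where "B Q = (if Q = 0 then {} else (\<Union>a\<in>int_tuples E Q. {t. \<bar>poly (p a) t\<bar> < \<bar>lead_coeff (p a)\<bar> * \<eta> Q ^ degree (p a)}))" for Q
  have B_meas[measurable]: "B Q \<in> sets lborel" for Q
  proof -
    have "{t. \<bar>poly (p a) t\<bar> < \<bar>lead_coeff (p a)\<bar> * \<eta> Q ^ degree (p a)} \<in> sets borel" for a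
      by (intro borel_open open_Collect_less continuous_intros)
    then show ?thesis unfolding B_def using finite_int_tuples[OF finE] by auto
  qed
  have B_le: "emeasure lborel (B Q) \<le> ennreal (2 * real D * 3 ^ M * (1 / real Q ^ 2))" for Q
  proof (cases "Q = 0")
    case False
    then have Q: "Q \<ge> 1" by simp
    have \<eta>Q: "\<eta> Q > 0" using Q by (simp add: \<eta>_def)
    have "emeasure lborel (B Q) \<le> (\<Sum>a\<in>int_tuples E Q. emeasure lborel {t. \<bar>poly (p a) t\<bar> < \<bar>lead_coeff (p a)\<bar> * \<eta> Q ^ degree (p a)})"
      unfolding B_def using False finite_int_tuples[OF finE]
      by (auto intro!: emeasure_subadditive_finite borel_open open_Collect_less continuous_intros)
    also have "\<dots> \<le> (\<Sum>a\<in>int_tuples E Q. ennreal (2 * real D * \<eta> Q))"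
    proof (rule sum_mono)
      fix a assume a: "a \<in> int_tuples E Q"
      have "emeasure lborel {t. \<bar>poly (p a) t\<bar> < \<bar>lead_coeff (p a)\<bar> * \<eta> Q ^ degree (p a)} \<le> ennreal (2 * real (degree (p a)) * \<eta> Q)"
        using lead[OF a Q] \<eta>Q by (intro poly_sublevel_measure) auto
      also have "\<dots> \<le> ennreal (2 * real D * \<eta> Q)"
        using pdeg[of a] lead[OF a Q] \<eta>Q by (intro ennreal_leI mult_right_mono) auto
      finally show "emeasure lborel {t. \<bar>poly (p a) t\<bar> < \<bar>lead_coeff (p a)\<bar> * \<eta> Q ^ degree (p a)} \<le> ennreal (2 * real D * \<eta> Q)" .
    qed
    also have "\<dots> = ennreal (real (card (int_tuples E Q)) * (2 * real D * \<eta> Q))"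
      using \<eta>Q by (simp add: ennreal_mult' ennreal_of_nat_eq_real_of_nat)
    also have "\<dots> \<le> ennreal ((3 * real Q) ^ M * (2 * real D * \<eta> Q))"
    proof (intro ennreal_leI mult_right_mono)
      have "real (card (int_tuples E Q)) \<le> real ((3 * Q) ^ M)"
        unfolding M_def of_nat_le_iff by (rule card_int_tuples_le[OF finE Q])
      then show "real (card (int_tuples E Q)) \<le> (3 * real Q) ^ M" by simp
    qed (use \<eta>Q in auto)
    also have "(3 * real Q) ^ M * (2 * real D * \<eta> Q) = 2 * real D * 3 ^ M * (1 / real Q ^ 2)"
      using Q by (simp add: \<eta>_def power_mult_distrib power_add field_simps power2_eq_square)
    finally show ?thesis .
  qed (simp add: B_def)
  have "AE t in lborel. eventually (\<lambda>Q. t \<in> space lborel - B Q) sequentially"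
  proof (rule borel_cantelli_AE1[OF B_meas])
    show fin: "emeasure lborel (B Q) < \<infinity>" for Q
      using B_le[of Q] by (simp add: le_less_trans)
    show "summable (\<lambda>Q. measure lborel (B Q))"
    proof (rule summable_comparison_test)
      show "summable (\<lambda>Q. 2 * real D * 3 ^ M * (1 / real Q ^ 2))"
        using inverse_power_summable[of 2, where 'a = real] by (intro summable_mult) (simp add: field_simps)
      have "measure lborel (B Q) \<le> 2 * real D * 3 ^ M * (1 / real Q ^ 2)" for Q
        unfolding measure_def using B_le[of Q] by (intro enn2real_leI) auto
      then show "\<exists>N. \<forall>Q\<ge>N. norm (measure lborel (B Q)) \<le> 2 * real D * 3 ^ M * (1 / real Q ^ 2)"
        by auto
    qed
  qed
  then show ?thesis
  proof eventually_elim
    case (elim t)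
    then obtain Q0 where Q0: "\<And>Q. Q \<ge> Q0 \<Longrightarrow> t \<notin> B Q" by (auto simp: eventually_sequentially)
    define Q1 where "Q1 = max Q0 1"
    \<comment> \<open>On top of the old exponent, the threshold loses
      \<open>\<eta> Q ^ degree (p a)\<close>, at worst \<open>1 / Q ^ ((M + 2) * D)\<close>.\<close>
    define \<kappa>' where "\<kappa>' = \<kappa> + (M + 2) * D"
    have low: "1 \<le> real m * real Q ^ \<kappa>' * \<bar>poly (p a) t\<bar>" if Q: "Q \<ge> Q1" and a: "a \<in> int_tuples E Q" for Q a
    proof -
      have Q': "Q \<ge> 1" "t \<notin> B Q" using Q Q0 by (auto simp: Q1_def)
      have ge: "\<bar>lead_coeff (p a)\<bar> * \<eta> Q ^ degree (p a) \<le> \<bar>poly (p a) t\<bar>"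
        using Q' a by (force simp: B_def)
      have \<eta>1: "1 / real Q ^ ((M + 2) * D) \<le> \<eta> Q ^ degree (p a)"
      proof -
        have "degree (p a) \<le> D" using pdeg[of a] by auto
        then have "real Q ^ ((M + 2) * degree (p a)) \<le> real Q ^ ((M + 2) * D)"
          using Q' by (intro power_increasing mult_le_mono2) auto
        then have "1 / real Q ^ ((M + 2) * D) \<le> 1 / real Q ^ ((M + 2) * degree (p a))"
          using Q' by (intro divide_left_mono) auto
        then show ?thesis unfolding \<eta>_def power_divide power_mult power_one .
      qed
      have "1 \<le> real m * real Q ^ \<kappa> * \<bar>lead_coeff (p a)\<bar>" using lead[OF a Q'(1)] by simp
      also have "\<dots> = real m * real Q ^ \<kappa>' * (\<bar>lead_coeff (p a)\<bar> * (1 / real Q ^ ((M + 2) * D)))"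
        using Q' by (simp add: \<kappa>'_def power_add)
      also have "\<dots> \<le> real m * real Q ^ \<kappa>' * (\<bar>lead_coeff (p a)\<bar> * \<eta> Q ^ degree (p a))"
        using \<eta>1 by (intro mult_left_mono) auto
      also have "\<dots> \<le> real m * real Q ^ \<kappa>' * \<bar>poly (p a) t\<bar>" using ge by (intro mult_left_mono) auto
      finally show ?thesis .
    qed
    show ?case
      unfolding dioph_def E_def[symmetric]
    \<comment> \<open>Borel-Cantelli is silent about the finitely many \<open>Q < Q1\<close>. A
      tuple for such \<open>Q\<close> is also one for \<open>max Q1 Q \<le> Q1 * Q\<close>, which
      costs only the factor \<open>Q1 ^ \<kappa>'\<close> in the constant.\<close>
    proof (rule exI[of _ \<kappa>'], rule exI[of _ "m * Q1 ^ \<kappa>'"], intro allI impI ballI)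
      fix Q a assume Q: "1 \<le> Q" and a: "a \<in> int_tuples E Q"
      define Q2 where "Q2 = max Q1 Q"
      have "a \<in> int_tuples E Q2" using a int_tuples_mono[of Q Q2 E] by (auto simp: Q2_def)
      then have "1 \<le> real m * real Q2 ^ \<kappa>' * \<bar>poly (p a) t\<bar>" by (intro low) (auto simp: Q2_def)
      also have "\<dots> \<le> real m * (real Q1 * real Q) ^ \<kappa>' * \<bar>poly (p a) t\<bar>"
      proof (intro mult_right_mono mult_left_mono power_mono)
        have "1 \<le> Q1" by (simp add: Q1_def)
        then have "Q2 \<le> Q1 * Q"
          using Q mult_le_mono[of 1 Q1 Q Q] mult_le_mono[of Q1 Q1 1 Q] by (simp add: Q2_def)
        then show "real Q2 \<le> real Q1 * real Q" by (metis of_nat_le_iff of_nat_mult)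
      qed auto
      finally have "1 \<le> real m * (real Q1 * real Q) ^ \<kappa>' * \<bar>poly (p a) t\<bar>" .
      then show "1 \<le> real (m * Q1 ^ \<kappa>') * real Q ^ \<kappa>' * \<bar>\<Sum>e\<in>E. real_of_int (a e) * mono_val (insert i I) (x(i := t)) e\<bar>"
        by (simp add: p_eval power_mult_distrib mult.assoc)
    qed
  qed
qed

text \<open>Fubini's theorem, one gain at a time: for almost every choice of the old gains, almost
  every value of the new one works.\<close>

lemma dioph_AE:
  assumes "finite I"
  shows "AE x in (\<Pi>\<^sub>M i\<in>I. lborel). dioph I D x"
  using assms
proof (induction I)
  case empty
  show ?case
  proof (rule AE_I2)
    fix x :: "'a \<Rightarrow> real"
    \<comment> \<open>Without variables the only monomial is \<open>1\<close>, so the form is a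
      nonzero integer.\<close>
    show "dioph {} D x"
      unfolding dioph_def
      by (intro exI[of _ 0] exI[of _ 1]) (auto simp: exps_def mono_val_def int_tuples_def)
  qed
next
  case (insert i I)
  interpret l: product_sigma_finite "\<lambda>_::'a. lborel :: real measure" ..
  have meas[measurable]: "Measurable.pred (\<Pi>\<^sub>M i\<in>J. lborel) (dioph J D)" if J: "finite J" for J :: "'a set"
  proof -
    have [measurable]: "(\<lambda>x. mono_val J x e) \<in> borel_measurable (\<Pi>\<^sub>M i\<in>J. lborel)" for e
      unfolding mono_val_def by measurable
    have [measurable]: "finite (int_tuples (exps J D) Q)" for Q
      by (intro finite_int_tuples finite_exps J)
    show ?thesis unfolding dioph_def by measurable
  qed
  let ?f = "\<lambda>x. indicator {x. \<not> dioph (insert i I) D x} x :: ennreal"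
  have [measurable]: "?f \<in> borel_measurable (\<Pi>\<^sub>M i\<in>insert i I. lborel)"
    using meas[of "insert i I"] insert.hyps by simp
  have "(\<integral>\<^sup>+x. ?f x \<partial>(\<Pi>\<^sub>M i\<in>insert i I. lborel)) = (\<integral>\<^sup>+x. (\<integral>\<^sup>+t. ?f (x(i := t)) \<partial>lborel) \<partial>(\<Pi>\<^sub>M i\<in>I. lborel))"
    by (rule l.product_nn_integral_insert) (use insert.hyps in auto)
  also have "\<dots> = (\<integral>\<^sup>+x. 0 \<partial>(\<Pi>\<^sub>M i\<in>I. lborel :: real measure))"
  proof (rule nn_integral_cong_AE)
    show "AE x in (\<Pi>\<^sub>M i\<in>I. lborel). (\<integral>\<^sup>+t. ?f (x(i := t)) \<partial>lborel) = 0"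
      using insert.IH
    proof eventually_elim
      case (elim x)
      have "(\<integral>\<^sup>+t. ?f (x(i := t)) \<partial>lborel) = (\<integral>\<^sup>+t. 0 \<partial>(lborel :: real measure))"
        by (rule nn_integral_cong_AE) (use dioph_insert_AE[OF insert.hyps elim] in \<open>auto simp: indicator_def\<close>)
      then show ?case by simp
    qed
  qed
  finally have "(\<integral>\<^sup>+x. ?f x \<partial>(\<Pi>\<^sub>M i\<in>insert i I. lborel)) = 0" by simp
  then have "AE x in (\<Pi>\<^sub>M i\<in>insert i I. lborel). ?f x = 0"
    by (subst (asm) nn_integral_0_iff_AE) auto
  then show ?case by eventually_elim (auto simp: indicator_def split: if_splits)
qed

section \<open>Separation by generic weights\<close>

lemma card_int_le_diameter:
  fixes S :: "int set"
  assumes S: "finite S" and L: "L \<ge> 0" "\<And>x y. x \<in> S \<Longrightarrow> y \<in> S \<Longrightarrow> real_of_int (x - y) \<le> L"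
  shows "real (card S) \<le> L + 1"
proof (cases "S = {}")
  case False
  have "S \<subseteq> {Min S..Max S}" using S by auto
  then have "card S \<le> card {Min S..Max S}" by (intro card_mono) auto
  also have "real (card {Min S..Max S}) = real_of_int (Max S - Min S) + 1"
    using S False by (simp add: of_nat_nat)
  finally show ?thesis using L(2)[OF Max_in[OF S False] Min_in[OF S False]] by simp
qed (use L in simp)

text \<open>With all entries but \<open>w i\<close> fixed, \<open>w i * r i\<close> is confined to
  an interval of length \<open>2 * \<delta>\<close>, which leaves at most
  \<open>2 * \<delta> / \<rho> + 1\<close> integers.\<close>

lemma card_linear_form_small:
  fixes X :: "int set" and r :: "'i \<Rightarrow> real"
  assumes I: "finite I" "i \<in> I" and X: "finite X" and r: "\<rho> > 0" "\<bar>r i\<bar> \<ge> \<rho>" and d: "\<delta> \<ge> 0"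
  shows "real (card {w \<in> (\<Pi>\<^sub>E j\<in>I. X). \<bar>\<Sum>j\<in>I. real_of_int (w j) * r j\<bar> < \<delta>})
    \<le> real (card X) ^ (card I - 1) * (2 * \<delta> / \<rho> + 1)"
proof -
  let ?I = "I - {i}"
  let ?W = "\<Pi>\<^sub>E j\<in>?I. X"
  define S where "S v = {x \<in> X. \<bar>real_of_int x * r i + (\<Sum>j\<in>?I. real_of_int (v j) * r j)\<bar> < \<delta>}" for v
  have finS: "finite (S v)" for v using X by (simp add: S_def)
  have finW: "finite ?W" using I X by (intro finite_PiE) auto
  have S: "real (card (S v)) \<le> 2 * \<delta> / \<rho> + 1" for v
  proof (rule card_int_le_diameter[OF finS])
    show "2 * \<delta> / \<rho> \<ge> 0" using d r by simp
    fix x y assume "x \<in> S v" "y \<in> S v"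
    then have "\<bar>(real_of_int x - real_of_int y) * r i\<bar> \<le> 2 * \<delta>"
      unfolding S_def by (auto simp: algebra_simps)
    then have "\<bar>real_of_int x - real_of_int y\<bar> * \<bar>r i\<bar> \<le> 2 * \<delta>" by (simp add: abs_mult)
    moreover have "\<bar>real_of_int x - real_of_int y\<bar> * \<rho> \<le> \<bar>real_of_int x - real_of_int y\<bar> * \<bar>r i\<bar>"
      using r by (intro mult_left_mono) auto
    ultimately have "\<bar>real_of_int x - real_of_int y\<bar> \<le> 2 * \<delta> / \<rho>" using r by (simp add: field_simps)
    then show "real_of_int (x - y) \<le> 2 * \<delta> / \<rho>" by simp
  qed
  have "{w \<in> (\<Pi>\<^sub>E j\<in>I. X). \<bar>\<Sum>j\<in>I. real_of_int (w j) * r j\<bar> < \<delta>} \<subseteq> (\<lambda>(v, x). v(i := x)) ` (SIGMA v:?W. S v)"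
  proof
    fix w assume "w \<in> {w \<in> (\<Pi>\<^sub>E j\<in>I. X). \<bar>\<Sum>j\<in>I. real_of_int (w j) * r j\<bar> < \<delta>}"
    then have w: "w \<in> (\<Pi>\<^sub>E j\<in>I. X)" "\<bar>\<Sum>j\<in>I. real_of_int (w j) * r j\<bar> < \<delta>" by auto
    have "restrict w ?I \<in> ?W" using w by auto
    moreover have "w i \<in> S (restrict w ?I)"
      using w I sum.remove[OF I, of "\<lambda>j. real_of_int (w j) * r j"] by (auto simp: S_def)
    moreover have "w = (restrict w ?I)(i := w i)"
    proof
      fix j show "w j = ((restrict w ?I)(i := w i)) j"
        using PiE_arb[OF w(1), of j] by (cases "j \<in> I") auto
    qed
    ultimately show "w \<in> (\<lambda>(v, x). v(i := x)) ` (SIGMA v:?W. S v)"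
      by (intro image_eqI[of _ _ "(restrict w ?I, w i)"]) auto
  qed
  then have "card {w \<in> (\<Pi>\<^sub>E j\<in>I. X). \<bar>\<Sum>j\<in>I. real_of_int (w j) * r j\<bar> < \<delta>} \<le> card (SIGMA v:?W. S v)"
    using finW finS by (intro surj_card_le) auto
  also have "\<dots> = (\<Sum>v\<in>?W. card (S v))" using finW finS by simp
  finally have "real (card {w \<in> (\<Pi>\<^sub>E j\<in>I. X). \<bar>\<Sum>j\<in>I. real_of_int (w j) * r j\<bar> < \<delta>}) \<le> (\<Sum>v\<in>?W. real (card (S v)))"
    by (simp only: of_nat_sum[symmetric] of_nat_le_iff)
  also have "\<dots> \<le> real (card ?W) * (2 * \<delta> / \<rho> + 1)" using S by (intro sum_bounded_above) auto
  also have "real (card ?W) = real (card X) ^ (card I - 1)" using I by (simp add: card_PiE)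
  finally show ?thesis .
qed

text \<open>\<open>c\<close> is read as an integer matrix, and its row \<open>s\<close> is applied
  to the vector \<open>y\<close>. Sent and received signals combine such rows with the weights
  \<open>\<omega> s\<close>.\<close>

definition row_val :: "'v set \<Rightarrow> ('v \<Rightarrow> real) \<Rightarrow> (nat \<times> 'v \<Rightarrow> int) \<Rightarrow> nat \<Rightarrow> real" where
  "row_val V y c s = (\<Sum>e\<in>V. real_of_int (c (s, e)) * y e)"

text \<open>Since \<open>y e0 = 1\<close>, the other entries of a small row determine
  \<open>c (s, e0)\<close> up to three values, so every row saves a factor of order
  \<open>Q\<close>.\<close>

lemma card_small_rows_le:
  assumes V: "finite V" "e0 \<in> V" "y e0 = 1" and Q: "Q \<ge> 1"
  shows "real (card {c \<in> int_tuples ({..<T} \<times> V) Q. \<forall>s<T. \<bar>row_val V y c s\<bar> < 1}) \<le> (3 * (3 * real Q) ^ (card V - 1)) ^ T"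
proof -
  define B where "B = {b \<in> (\<Pi>\<^sub>E e\<in>V. {- int Q..int Q}). \<bar>\<Sum>e\<in>V. real_of_int (b e) * y e\<bar> < 1}"
  have finB: "finite B" 
    by (rule finite_subset[of _ "\<Pi>\<^sub>E e\<in>V. {- int Q..int Q}"]) (use V in \<open>auto simp: B_def intro: finite_PiE\<close>)
  have "real (card B) \<le> real (card {- int Q..int Q}) ^ (card V - 1) * (2 * 1 / 1 + 1)"
    unfolding B_def using V by (intro card_linear_form_small) auto
  also have "\<dots> \<le> (3 * real Q) ^ (card V - 1) * 3"
    using Q by (intro mult_mono power_mono) auto
  finally have B: "real (card B) \<le> 3 * (3 * real Q) ^ (card V - 1)" by simp
  let ?C = "{c \<in> int_tuples ({..<T} \<times> V) Q. \<forall>s<T. \<bar>row_val V y c s\<bar> < 1}"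
  let ?f = "\<lambda>c. \<lambda>s\<in>{..<T}. \<lambda>e\<in>V. c (s, e)"
  have "inj_on ?f ?C"
  proof (rule inj_onI)
    fix c c' assume c: "c \<in> ?C" "c' \<in> ?C" "?f c = ?f c'"
    have "c x = c' x" for x
    proof (cases "x \<in> {..<T} \<times> V")
      case True
      then obtain s e where "x = (s, e)" "s < T" "e \<in> V" by auto
      then show ?thesis using fun_cong[OF fun_cong[OF c(3), of s], of e] by simp
    next
      case False
      then show ?thesis using int_tuplesD(2)[of c "{..<T} \<times> V" Q x] int_tuplesD(2)[of c' "{..<T} \<times> V" Q x] c(1,2) by simp
    qed
    then show "c = c'" by auto
  qed
  moreover have "?f ` ?C \<subseteq> (\<Pi>\<^sub>E s\<in>{..<T}. B)"
  proof
    fix g assume "g \<in> ?f ` ?C"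
    then obtain c where c: "c \<in> ?C" and g: "g = ?f c" by blast
    have "(\<lambda>e\<in>V. c (s, e)) \<in> B" if "s < T" for s
    proof -
      have "c (s, e) \<in> {- int Q..int Q}" if "e \<in> V" for e
        using int_tuplesD(1)[of c "{..<T} \<times> V" Q "(s, e)"] c that \<open>s < T\<close> by auto
      then have "(\<lambda>e\<in>V. c (s, e)) \<in> (\<Pi>\<^sub>E e\<in>V. {- int Q..int Q})" by (intro restrict_PiE_iff[THEN iffD2] ballI)
      moreover have "\<bar>row_val V y c s\<bar> < 1" using c that by blast
      ultimately show ?thesis unfolding B_def by (simp add: row_val_def cong: sum.cong)
    qed
    then show "g \<in> (\<Pi>\<^sub>E s\<in>{..<T}. B)" unfolding g by auto
  qed
  moreover have "finite (\<Pi>\<^sub>E s\<in>{..<T}. B)" using finB by (intro finite_PiE) auto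
  ultimately have "card ?C \<le> card (\<Pi>\<^sub>E s\<in>{..<T}. B)" by (rule card_inj_on_le)
  also have "\<dots> = card B ^ T" by (simp add: card_PiE)
  finally have "real (card ?C) \<le> real (card B ^ T)" by (simp only: of_nat_le_iff)
  also have "\<dots> \<le> (3 * (3 * real Q) ^ (card V - 1)) ^ T" unfolding of_nat_power using B by (intro power_mono) auto
  finally show ?thesis .
qed

text \<open>
  A linear form in \<open>\<omega>\<close> with a coefficient of size at least \<open>1\<close> is small for few \<open>\<omega>\<close>. The tuples without
  such a coefficient could be worse by a factor \<open>Q ^ \<kappa>\<close>, but each of the \<open>T\<close> rows then loses one degree
  of freedom, so that \<open>\<kappa> \<le> T\<close> suffices. This replaces the Khintchine--Groshev type theorems on manifolds
  that are otherwise used for real interference alignment.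
\<close>

lemma card_bad_weights_le:
  assumes V: "finite V" "e0 \<in> V" "y e0 = 1" and Q: "Q \<ge> 1" and T: "\<kappa> \<le> T" "T \<ge> 1" and d: "\<delta> \<ge> 0"
    and low: "\<And>a. a \<in> int_tuples V Q \<Longrightarrow> 1 \<le> real m * real Q ^ \<kappa> * \<bar>\<Sum>e\<in>V. real_of_int (a e) * y e\<bar>"
  shows "real (card {\<omega> \<in> (\<Pi>\<^sub>E s\<in>{..<T}. {0..<int G}). \<exists>c\<in>int_tuples ({..<T} \<times> V) Q.
      \<bar>\<Sum>s<T. real_of_int (\<omega> s) * row_val V y c s\<bar> < \<delta>})
    \<le> 3 ^ T * (3 * real Q) ^ (card V * T) * real G ^ (T - 1) * (2 * \<delta> * (1 + real m) + 2)"
proof -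
  define C where "C = int_tuples ({..<T} \<times> V) Q"
  define C2 where "C2 = {c \<in> C. \<forall>s<T. \<bar>row_val V y c s\<bar> < 1}"
  define W where "W c = {\<omega> \<in> (\<Pi>\<^sub>E s\<in>{..<T}. {0..<int G}). \<bar>\<Sum>s<T. real_of_int (\<omega> s) * row_val V y c s\<bar> < \<delta>}" for c
  have finC: "finite C" unfolding C_def using V by (intro finite_int_tuples) auto
  have cV: "card V \<ge> 1" using V by (auto simp: Suc_le_eq card_gt_0_iff)
  have W1: "real (card (W c)) \<le> real G ^ (T - 1) * (2 * \<delta> + 1)" if c: "c \<in> C - C2" for c
  proof -
    obtain s where s: "s < T" "\<bar>row_val V y c s\<bar> \<ge> 1" using c by (auto simp: C2_def not_less)
    have "real (card (W c)) \<le> real (card {0..<int G}) ^ (card {..<T} - 1) * (2 * \<delta> / 1 + 1)"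
      unfolding W_def using s d by (intro card_linear_form_small[where i=s]) auto
    then show ?thesis by simp
  qed
  have W2: "real (card (W c)) \<le> real G ^ (T - 1) * (2 * \<delta> * real m * real Q ^ \<kappa> + 1)" if c: "c \<in> C2" for c
  proof -
    obtain s e where s: "s < T" "e \<in> V" "c (s, e) \<noteq> 0" using c by (auto simp: C2_def C_def int_tuples_def)
    have "(\<lambda>e\<in>V. c (s, e)) \<in> int_tuples V Q"
      using c s int_tuplesD(1)[of c "{..<T} \<times> V" Q "(s, _)"] unfolding C2_def C_def
      by (intro int_tuplesI[of _ _ _ e]) auto
    from low[OF this] have l: "1 \<le> real m * real Q ^ \<kappa> * \<bar>row_val V y c s\<bar>"
      by (simp add: row_val_def cong: sum.cong)
    have mQ: "real m * real Q ^ \<kappa> > 0"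
    proof (rule ccontr)
      assume "\<not> ?thesis"
      moreover have "real m * real Q ^ \<kappa> \<ge> 0" by simp
      ultimately have "real m * real Q ^ \<kappa> = 0" by linarith
      with l show False by (simp only: mult_zero_left)
    qed
    have "real (card (W c)) \<le> real (card {0..<int G}) ^ (card {..<T} - 1) * (2 * \<delta> / (1 / (real m * real Q ^ \<kappa>)) + 1)"
      unfolding W_def using s d l mQ
      by (intro card_linear_form_small[where i=s]) (auto simp: divide_le_eq mult.commute)
    then show ?thesis by (simp add: mult.assoc)
  qed
  have c1: "real (card (C - C2)) \<le> (3 * real Q) ^ (card V * T)"
  proof -
    have "card (C - C2) \<le> card C" using finC by (intro card_mono) auto
    also have "\<dots> \<le> (3 * Q) ^ card ({..<T} \<times> V)" unfolding C_def using V Q by (intro card_int_tuples_le) auto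
    finally have "real (card (C - C2)) \<le> real ((3 * Q) ^ card ({..<T} \<times> V))" by (simp only: of_nat_le_iff)
    then show ?thesis by (simp add: card_cartesian_product mult.commute)
  qed
  have c2: "real (card C2) \<le> (3 * (3 * real Q) ^ (card V - 1)) ^ T"
    unfolding C2_def C_def by (rule card_small_rows_le[of V e0 y, OF V Q])
  have "{\<omega> \<in> (\<Pi>\<^sub>E s\<in>{..<T}. {0..<int G}). \<exists>c\<in>C. \<bar>\<Sum>s<T. real_of_int (\<omega> s) * row_val V y c s\<bar> < \<delta>}
      = (\<Union>c\<in>C - C2. W c) \<union> (\<Union>c\<in>C2. W c)" by (auto simp: W_def C2_def)
  then have "card {\<omega> \<in> (\<Pi>\<^sub>E s\<in>{..<T}. {0..<int G}). \<exists>c\<in>C. \<bar>\<Sum>s<T. real_of_int (\<omega> s) * row_val V y c s\<bar> < \<delta>}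
      \<le> card (\<Union>c\<in>C - C2. W c) + card (\<Union>c\<in>C2. W c)" by (simp add: card_Un_le)
  also have "\<dots> \<le> (\<Sum>c\<in>C - C2. card (W c)) + (\<Sum>c\<in>C2. card (W c))"
    using finC by (intro add_mono card_UN_le) (auto simp: C2_def)
  finally have "real (card {\<omega> \<in> (\<Pi>\<^sub>E s\<in>{..<T}. {0..<int G}). \<exists>c\<in>C. \<bar>\<Sum>s<T. real_of_int (\<omega> s) * row_val V y c s\<bar> < \<delta>})
      \<le> (\<Sum>c\<in>C - C2. real (card (W c))) + (\<Sum>c\<in>C2. real (card (W c)))"
    by (simp only: of_nat_sum[symmetric] of_nat_add[symmetric] of_nat_le_iff)
  also have "\<dots> \<le> real (card (C - C2)) * (real G ^ (T - 1) * (2 * \<delta> + 1)) + real (card C2) * (real G ^ (T - 1) * (2 * \<delta> * real m * real Q ^ \<kappa> + 1))"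
    using W1 W2 by (intro add_mono sum_bounded_above) auto
  also have "\<dots> \<le> 3 ^ T * (3 * real Q) ^ (card V * T) * (real G ^ (T - 1) * (2 * \<delta> + 1))
    + 3 ^ T * (3 * real Q) ^ (card V * T) * (real G ^ (T - 1) * (2 * \<delta> * real m + 1))"
  proof (rule add_mono)
    have "real (card (C - C2)) \<le> 1 * (3 * real Q) ^ (card V * T)" using c1 by simp
    also have "\<dots> \<le> 3 ^ T * (3 * real Q) ^ (card V * T)" by (intro mult_right_mono) auto
    finally show "real (card (C - C2)) * (real G ^ (T - 1) * (2 * \<delta> + 1)) \<le> 3 ^ T * (3 * real Q) ^ (card V * T) * (real G ^ (T - 1) * (2 * \<delta> + 1))"
      using d by (intro mult_right_mono) auto
    have "real (card C2) * (2 * \<delta> * real m * real Q ^ \<kappa> + 1) \<le> (3 * (3 * real Q) ^ (card V - 1)) ^ T * ((3 * real Q) ^ T * (2 * \<delta> * real m + 1))"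
    proof (intro mult_mono c2)
      have "real Q ^ \<kappa> \<le> (3 * real Q) ^ \<kappa>" by (intro power_mono) auto
      also have "\<dots> \<le> (3 * real Q) ^ T" using Q T by (intro power_increasing) auto
      finally have "2 * \<delta> * real m * real Q ^ \<kappa> \<le> 2 * \<delta> * real m * (3 * real Q) ^ T"
        using d by (intro mult_left_mono) auto
      moreover have "1 \<le> (3 * real Q) ^ T" using Q by (intro one_le_power) auto
      ultimately show "2 * \<delta> * real m * real Q ^ \<kappa> + 1 \<le> (3 * real Q) ^ T * (2 * \<delta> * real m + 1)"
        by (simp add: algebra_simps)
    qed (use d in auto)
    also have "\<dots> = 3 ^ T * ((3 * real Q) ^ (card V - 1) * (3 * real Q)) ^ T * (2 * \<delta> * real m + 1)"
      by (simp add: power_mult_distrib mult_ac)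
    also have "(3 * real Q) ^ (card V - 1) * (3 * real Q) = (3 * real Q) ^ card V"
      using cV by (metis One_nat_def Suc_pred less_eq_Suc_le power_Suc2)
    finally have "real (card C2) * (2 * \<delta> * real m * real Q ^ \<kappa> + 1) * real G ^ (T - 1)
      \<le> 3 ^ T * ((3 * real Q) ^ card V) ^ T * (2 * \<delta> * real m + 1) * real G ^ (T - 1)"
      by (intro mult_right_mono) auto
    then have "real (card C2) * (2 * \<delta> * real m * real Q ^ \<kappa> + 1) * real G ^ (T - 1)
      \<le> 3 ^ T * (3 * real Q) ^ (card V * T) * (2 * \<delta> * real m + 1) * real G ^ (T - 1)"
      by (simp only: power_mult)
    then show "real (card C2) * (real G ^ (T - 1) * (2 * \<delta> * real m * real Q ^ \<kappa> + 1)) \<le> 3 ^ T * (3 * real Q) ^ (card V * T) * (real G ^ (T - 1) * (2 * \<delta> * real m + 1))"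
      by (simp only: mult_ac)
  qed
  also have "\<dots> = 3 ^ T * (3 * real Q) ^ (card V * T) * real G ^ (T - 1) * (2 * \<delta> * (1 + real m) + 2)"
    by (simp add: algebra_simps)
  finally show ?thesis unfolding C_def .
qed

text \<open>The weight vectors that fail for some receiver and state in \<open>F\<close> do not
  exhaust the \<open>G ^ T\<close> available ones once \<open>G\<close> is a large multiple of
  \<open>Q ^ (n * T)\<close>. The bound is stated relative to \<open>G\<close> because the
  transmitters must divide by the size of the weights.\<close>

lemma separating_weights:
  fixes V :: "'r \<Rightarrow> 'v set"
  assumes F: "finite F" and T: "\<kappa> \<le> T" "T \<ge> 1"
    and V: "\<And>f. f \<in> F \<Longrightarrow> finite (V f)" "\<And>f. f \<in> F \<Longrightarrow> e0 f \<in> V f" "\<And>f. f \<in> F \<Longrightarrow> y f (e0 f) = 1"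
      "\<And>f. f \<in> F \<Longrightarrow> card (V f) = n"
    and low: "\<And>f Q a. f \<in> F \<Longrightarrow> Q \<ge> 1 \<Longrightarrow> a \<in> int_tuples (V f) Q \<Longrightarrow>
      1 \<le> real m * real Q ^ \<kappa> * \<bar>\<Sum>e\<in>V f. real_of_int (a e) * y f e\<bar>"
  shows "\<exists>\<epsilon>>0. \<forall>Q\<ge>1. \<exists>G\<ge>1. \<exists>\<omega> :: nat \<Rightarrow> int. (\<forall>s<T. 0 \<le> \<omega> s \<and> \<omega> s < int G) \<and>
    (\<forall>f\<in>F. \<forall>c\<in>int_tuples ({..<T} \<times> V f) Q.
      \<epsilon> * real G / real Q ^ (n * T) \<le> \<bar>\<Sum>s<T. real_of_int (\<omega> s) * row_val (V f) (y f) c s\<bar>)"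
proof -
  \<comment> \<open>\<open>Z\<close> makes \<open>G\<close> exceed the
    \<open>4 * card F * 3 ^ T * (3 * Q) ^ (n * T)\<close> of the union bound;
    \<open>\<epsilon>\<close> makes \<open>\<delta> * (1 + m) = 1\<close>, which turns the last
    factor of \<open>card_bad_weights_le\<close> into \<open>4\<close>.\<close>
  define Z where "Z = 8 * (real (card F) + 1) * 3 ^ T * 3 ^ (n * T)"
  define \<epsilon> where "\<epsilon> = 1 / (Z * (1 + real m))"
  have Z: "Z > 0" unfolding Z_def by (intro mult_pos_pos) auto
  have \<epsilon>: "\<epsilon> > 0" using Z by (simp add: \<epsilon>_def)
  show ?thesis
  proof (intro exI[of _ \<epsilon>] conjI allI impI \<epsilon>)
    fix Q :: nat assume Q: "Q \<ge> 1"
    define G where "G = 8 * (card F + 1) * 3 ^ T * (3 * Q) ^ (n * T)"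
    have Gr: "real G = Z * real Q ^ (n * T)" by (simp add: G_def Z_def power_mult_distrib algebra_simps)
    have G1: "G \<ge> 1" using Q by (simp add: G_def Suc_le_eq)
    define \<delta> where "\<delta> = \<epsilon> * real G / real Q ^ (n * T)"
    have \<delta>: "\<delta> \<ge> 0" using \<epsilon> by (simp add: \<delta>_def)
    define bad where "bad f = {\<omega> \<in> (\<Pi>\<^sub>E s\<in>{..<T}. {0..<int G}). \<exists>c\<in>int_tuples ({..<T} \<times> V f) Q.
      \<bar>\<Sum>s<T. real_of_int (\<omega> s) * row_val (V f) (y f) c s\<bar> < \<delta>}" for f
    have bad: "real (card (bad f)) \<le> 3 ^ T * (3 * real Q) ^ (n * T) * real G ^ (T - 1) * 4" if f: "f \<in> F" for f
    proof -
      have "Z * (1 + real m) \<noteq> 0" using Z by (simp add: add_nonneg_eq_0_iff)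
      then have "\<epsilon> * (Z * (1 + real m)) = 1" unfolding \<epsilon>_def by simp
      moreover have "\<delta> = \<epsilon> * Z" using Q by (simp add: \<delta>_def Gr)
      ultimately have "\<delta> * (1 + real m) = 1" by (simp add: mult.assoc)
      then have four: "2 * \<delta> * (1 + real m) + 2 = 4" by (simp add: mult.assoc)
      show ?thesis
        using card_bad_weights_le[of "V f" "e0 f" "y f", OF V(1-3)[OF f] Q T \<delta> low[OF f Q], of G] unfolding bad_def V(4)[OF f] four .
    qed
    have "real (card (\<Union>f\<in>F. bad f)) \<le> (\<Sum>f\<in>F. real (card (bad f)))"
      unfolding of_nat_sum[symmetric] of_nat_le_iff by (rule card_UN_le[OF F])
    also have "\<dots> \<le> real (card F) * (3 ^ T * (3 * real Q) ^ (n * T) * real G ^ (T - 1) * 4)"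
      using bad by (intro sum_bounded_above) auto
    also have "\<dots> < real G * real G ^ (T - 1)"
    proof -
      have "real (card F) * (3 ^ T * (3 * real Q) ^ (n * T)) * 4 < real G"
      proof -
        have "real (card F) * 4 < 8 * (real (card F) + 1)" by simp
        then have "real (card F) * 4 * (3 ^ T * (3 * real Q) ^ (n * T)) < 8 * (real (card F) + 1) * (3 ^ T * (3 * real Q) ^ (n * T))"
          using Q by (intro mult_strict_right_mono) auto
        then show ?thesis by (simp add: G_def mult_ac add.commute)
      qed
      then have "real (card F) * (3 ^ T * (3 * real Q) ^ (n * T)) * 4 * real G ^ (T - 1) < real G * real G ^ (T - 1)"
        using G1 by (intro mult_strict_right_mono) auto
      then show ?thesis by (simp add: mult_ac)
    qed
    also have "\<dots> = real (card (\<Pi>\<^sub>E s\<in>{..<T}. {0..<int G}))"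
      using T by (cases T) (simp_all add: card_PiE)
    finally have "card (\<Union>f\<in>F. bad f) < card (\<Pi>\<^sub>E s\<in>{..<T}. {0..<int G})" by simp
    moreover have "(\<Union>f\<in>F. bad f) \<subseteq> (\<Pi>\<^sub>E s\<in>{..<T}. {0..<int G})" by (auto simp: bad_def)
    moreover have "finite (\<Pi>\<^sub>E s\<in>{..<T}. {0..<int G})" by (intro finite_PiE) auto
    ultimately have "\<not> (\<Pi>\<^sub>E s\<in>{..<T}. {0..<int G}) \<subseteq> (\<Union>f\<in>F. bad f)"
      by (metis card_mono finite_subset not_le)
    then obtain \<omega> where \<omega>: "\<omega> \<in> (\<Pi>\<^sub>E s\<in>{..<T}. {0..<int G})" "\<And>f. f \<in> F \<Longrightarrow> \<omega> \<notin> bad f"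
      by blast
    show "\<exists>G\<ge>1. \<exists>\<omega> :: nat \<Rightarrow> int. (\<forall>s<T. 0 \<le> \<omega> s \<and> \<omega> s < int G) \<and>
      (\<forall>f\<in>F. \<forall>c\<in>int_tuples ({..<T} \<times> V f) Q.
        \<epsilon> * real G / real Q ^ (n * T) \<le> \<bar>\<Sum>s<T. real_of_int (\<omega> s) * row_val (V f) (y f) c s\<bar>)"
    proof (intro exI[of _ G] exI[of _ \<omega>] conjI G1 allI impI ballI)
      fix s assume "s < T"
      then have "\<omega> s \<in> {0..<int G}" using PiE_mem[OF \<omega>(1), of s] by simp
      then show "0 \<le> \<omega> s" "\<omega> s < int G" by auto
    next
      fix f c assume "f \<in> F" "c \<in> int_tuples ({..<T} \<times> V f) Q"
      then show "\<epsilon> * real G / real Q ^ (n * T) \<le> \<bar>\<Sum>s<T. real_of_int (\<omega> s) * row_val (V f) (y f) c s\<bar>"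
        using \<omega> unfolding bad_def \<delta>_def by (force simp: not_less)
    qed
  qed
qed

section \<open>Interference alignment\<close>

lemma finite_channel_coords: "finite (channel_coords K J)"
proof (rule finite_subset)
  show "channel_coords K J \<subseteq> {..<K} \<times> (\<Union>j<K. {..<J j}) \<times> {..<K}"
    by (auto simp: channel_coords_def)
qed auto

definition cross_coords :: "nat \<Rightarrow> (nat \<Rightarrow> nat) \<Rightarrow> (nat \<times> nat \<times> nat) set" where
  "cross_coords K J = {(j, l, i) \<in> channel_coords K J. i \<noteq> j}"

text \<open>Direct gains keep the exponent zero instead of leaving the domain, so that these are
  elements of \<open>exps (channel_coords K J) D\<close> and the Diophantine bound applies.\<close>

definition cross_exps :: "nat \<Rightarrow> (nat \<Rightarrow> nat) \<Rightarrow> nat \<Rightarrow> (nat \<times> nat \<times> nat \<Rightarrow> nat) set" where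
  "cross_exps K J N = (\<Pi>\<^sub>E c\<in>channel_coords K J. if c \<in> cross_coords K J then {..<N} else {0})"

lemma finite_cross_exps: "finite (cross_exps K J N)"
  unfolding cross_exps_def using finite_channel_coords by (intro finite_PiE) auto

lemma card_cross_exps: "card (cross_exps K J N) = N ^ card (cross_coords K J)"
proof -
  have "card (cross_exps K J N) = (\<Prod>c\<in>channel_coords K J. if c \<in> cross_coords K J then N else 1)"
    unfolding cross_exps_def by (subst card_PiE[OF finite_channel_coords]) (auto intro!: prod.cong)
  also have "\<dots> = (\<Prod>c\<in>channel_coords K J \<inter> cross_coords K J. N)"
    by (rule prod.inter_restrict[symmetric]) (rule finite_channel_coords)
  also have "channel_coords K J \<inter> cross_coords K J = cross_coords K J" by (auto simp: cross_coords_def)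
  finally show ?thesis by simp
qed

text \<open>On exponents, multiplication of a monomial by the gain \<open>c\<close>.\<close>

definition shift_exp :: "'c \<Rightarrow> ('c \<Rightarrow> nat) \<Rightarrow> 'c \<Rightarrow> nat" where
  "shift_exp c e = e(c := Suc (e c))"

lemma mono_val_shift:
  assumes "finite I" "c \<in> I"
  shows "mono_val I x (shift_exp c e) = x c * mono_val I x e"
proof -
  have "(\<Prod>i\<in>I - {c}. x i ^ shift_exp c e i) = (\<Prod>i\<in>I - {c}. x i ^ e i)"
    by (intro prod.cong) (auto simp: shift_exp_def)
  then show ?thesis
    using assms by (simp add: mono_val_def prod.remove[where x=c] shift_exp_def)
qed

text \<open>
  Exponents that occur at receiver \<open>j\<close> in state \<open>l\<close>: the desired signal carries exactly one factor
  \<open>H (j, l, j)\<close>, while all interference is aligned in \<open>cross_exps K J (Suc N)\<close>.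
\<close>

definition rx_exps :: "nat \<Rightarrow> (nat \<Rightarrow> nat) \<Rightarrow> nat \<Rightarrow> nat \<times> nat \<Rightarrow> (nat \<times> nat \<times> nat \<Rightarrow> nat) set" where
  "rx_exps K J N = (\<lambda>(j, l). shift_exp (j, l, j) ` cross_exps K J N \<union> cross_exps K J (Suc N))"

lemma cross_exps_direct:
  assumes "e \<in> cross_exps K J N" "j < K" "l < J j"
  shows "e (j, l, j) = 0"
  using PiE_mem[OF assms(1)[unfolded cross_exps_def], of "(j, l, j)"] assms(2,3)
  by (simp add: channel_coords_def cross_coords_def)

lemma shift_direct_inj:
  assumes "j < K" "l < J j"
  shows "inj_on (shift_exp (j, l, j)) (cross_exps K J N)"
proof (rule inj_onI)
  fix e e' assume e: "e \<in> cross_exps K J N" "e' \<in> cross_exps K J N" "shift_exp (j, l, j) e = shift_exp (j, l, j) e'"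
  show "e = e'"
  proof
    fix c show "e c = e' c" using fun_cong[OF e(3), of c] by (auto simp: shift_exp_def split: if_splits)
  qed
qed

text \<open>Desired and interfering exponents are told apart by the direct gain, which has power one
  in the former and zero in the latter.\<close>

lemma card_rx_exps:
  assumes "j < K" "l < J j"
  shows "card (rx_exps K J N (j, l)) = N ^ card (cross_coords K J) + Suc N ^ card (cross_coords K J)"
proof -
  have "shift_exp (j, l, j) ` cross_exps K J N \<inter> cross_exps K J (Suc N) = {}"
  proof -
    have False if "f \<in> cross_exps K J (Suc N)" "f = shift_exp (j, l, j) e" for e f
      using cross_exps_direct[of f K J "Suc N" j l] that assms by (simp add: shift_exp_def)
    then show ?thesis by blast
  qed
  then show ?thesis
    unfolding rx_exps_def using finite_cross_exps
    by (simp add: card_Un_disjoint card_image[OF shift_direct_inj[of j K l J N, OF assms]] card_cross_exps)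
qed

lemma cross_exps_subset_exps:
  assumes "N \<le> D" "D \<ge> 1"
  shows "cross_exps K J N \<subseteq> exps (channel_coords K J) D"
  unfolding cross_exps_def exps_def using assms by (intro PiE_mono) auto

text \<open>The alignment: a cross gain, of whichever receiver and state, raises one exponent by
  one. All transmitters use the same directions, so their images share one set.\<close>

lemma shift_cross_exps:
  assumes "e \<in> cross_exps K J N" "j < K" "l < J j" "i < K" "i \<noteq> j"
  shows "shift_exp (j, l, i) e \<in> cross_exps K J (Suc N)"
proof -
  have c: "(j, l, i) \<in> cross_coords K J" "(j, l, i) \<in> channel_coords K J"
    using assms by (auto simp: cross_coords_def channel_coords_def)
  have e: "e \<in> (\<Pi>\<^sub>E c\<in>channel_coords K J. if c \<in> cross_coords K J then {..<N} else {0})"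
    using assms(1) by (simp add: cross_exps_def)
  show ?thesis
    unfolding cross_exps_def
  proof (rule PiE_I)
    fix b assume "b \<in> channel_coords K J"
    then show "shift_exp (j, l, i) e b \<in> (if b \<in> cross_coords K J then {..<Suc N} else {0})"
      using PiE_mem[OF e, of b] c by (auto simp: shift_exp_def split: if_splits)
  next
    fix b assume "b \<notin> channel_coords K J"
    then show "shift_exp (j, l, i) e b = undefined" using PiE_arb[OF e, of b] c by (auto simp: shift_exp_def)
  qed
qed

lemma shift_rx_exps:
  assumes "e \<in> cross_exps K J N" "j < K" "l < J j" "i < K"
  shows "shift_exp (j, l, i) e \<in> rx_exps K J N (j, l)"
  using assms shift_cross_exps[of e K J N j l i] by (cases "i = j") (auto simp: rx_exps_def)

lemma rx_exps_subset_exps: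
  assumes "N \<ge> 1" "j < K" "l < J j"
  shows "rx_exps K J N (j, l) \<subseteq> exps (channel_coords K J) (Suc N)"
proof -
  have d: "(j, l, j) \<in> channel_coords K J" using assms by (simp add: channel_coords_def)
  have "shift_exp (j, l, j) e \<in> exps (channel_coords K J) (Suc N)" if e: "e \<in> cross_exps K J N" for e
  proof -
    have e': "e \<in> (\<Pi>\<^sub>E c\<in>channel_coords K J. {..<Suc N})"
      using e cross_exps_subset_exps[of N "Suc N" K J] by (auto simp: exps_def)
    show ?thesis
      unfolding exps_def
    proof (rule PiE_I)
      fix b assume "b \<in> channel_coords K J"
      then show "shift_exp (j, l, j) e b \<in> {..<Suc N}"
        using PiE_mem[OF e', of b] cross_exps_direct[of e K J N j l, OF e assms(2,3)] assms(1) by (auto simp: shift_exp_def)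
    next
      fix b assume "b \<notin> channel_coords K J"
      then show "shift_exp (j, l, j) e b = undefined" using PiE_arb[OF e', of b] d by (auto simp: shift_exp_def)
    qed
  qed
  moreover have "cross_exps K J (Suc N) \<subseteq> exps (channel_coords K J) (Suc N)"
    by (rule cross_exps_subset_exps) auto
  ultimately show ?thesis by (auto simp: rx_exps_def)
qed

text \<open>A form in fewer monomials is padded with zero coefficients.\<close>

lemma dioph_subset:
  assumes I: "finite I" and V: "V \<subseteq> exps I D" and a: "a \<in> int_tuples V Q"
    and low: "\<And>a. a \<in> int_tuples (exps I D) Q \<Longrightarrow> 1 \<le> B * \<bar>\<Sum>e\<in>exps I D. real_of_int (a e) * mono_val I x e\<bar>"
  shows "1 \<le> B * \<bar>\<Sum>e\<in>V. real_of_int (a e) * mono_val I x e\<bar>"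
proof -
  define a' where "a' e = (if e \<in> V then a e else if e \<in> exps I D then 0 else undefined)" for e
  obtain e where e: "e \<in> V" "a e \<noteq> 0" using int_tuplesD(3)[OF a] by blast
  have "a' \<in> int_tuples (exps I D) Q"
    using V e int_tuplesD(1)[OF a] by (intro int_tuplesI[of _ _ _ e]) (auto simp: a'_def)
  from low[OF this] have "1 \<le> B * \<bar>\<Sum>e\<in>exps I D. real_of_int (a' e) * mono_val I x e\<bar>" .
  also have "(\<Sum>e\<in>exps I D. real_of_int (a' e) * mono_val I x e) = (\<Sum>e\<in>V. real_of_int (a' e) * mono_val I x e)"
    using V finite_exps[OF I, of D] by (intro sum.mono_neutral_right) (auto simp: a'_def)
  also have "\<dots> = (\<Sum>e\<in>V. real_of_int (a e) * mono_val I x e)"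
    by (intro sum.cong) (auto simp: a'_def)
  finally show ?thesis .
qed

text \<open>
  The coefficient vector of a difference of received signals. The bound \<open>K * card E * Q\<close> on its entries
  is crude but independent of \<open>P\<close>.
\<close>

lemma received_difference:
  fixes K N :: nat and J :: "nat \<Rightarrow> nat" and H :: "nat \<times> nat \<times> nat \<Rightarrow> real" and u v :: "nat \<Rightarrow> nat \<times> (nat \<times> nat \<times> nat \<Rightarrow> nat) \<Rightarrow> int"
  defines "E \<equiv> cross_exps K J N" and "I \<equiv> channel_coords K J"
  assumes jl: "j < K" "l < J j" and Q: "Q \<ge> 1"
    and u: "\<And>i. i < K \<Longrightarrow> u i \<in> (\<Pi>\<^sub>E p\<in>{..<T} \<times> E. {0..<int Q})"
    and v: "\<And>i. i < K \<Longrightarrow> v i \<in> (\<Pi>\<^sub>E p\<in>{..<T} \<times> E. {0..<int Q})"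
    and ne: "u j \<noteq> v j"
  shows "\<exists>c\<in>int_tuples ({..<T} \<times> rx_exps K J N (j, l)) (K * card E * Q).
    \<forall>s<T. (\<Sum>i<K. H (j, l, i) * row_val E (mono_val I H) (u i) s) - (\<Sum>i<K. H (j, l, i) * row_val E (mono_val I H) (v i) s)
      = row_val (rx_exps K J N (j, l)) (mono_val I H) c s"
proof -
  let ?V = "rx_exps K J N (j, l)"
  define \<Delta> where "\<Delta> i p = u i p - v i p" for i p
  \<comment> \<open>Symbols of several users may reach the same received monomial \<open>f\<close>;
    their differences add up there.\<close>
  define c0 where "c0 s f = (\<Sum>i<K. \<Sum>e\<in>E. if shift_exp (j, l, i) e = f then \<Delta> i (s, e) else 0)" for s f
  define c where "c = (\<lambda>(s, f)\<in>{..<T} \<times> ?V. c0 s f)"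
  have finE: "finite E" unfolding E_def by (rule finite_cross_exps)
  have finV: "finite ?V" unfolding rx_exps_def using finite_cross_exps by auto
  have \<Delta>: "\<bar>\<Delta> i (s, e)\<bar> \<le> int Q" if "i < K" "s < T" "e \<in> E" for i s e
    using PiE_mem[OF u[OF that(1)], of "(s, e)"] PiE_mem[OF v[OF that(1)], of "(s, e)"] that by (auto simp: \<Delta>_def)
  have eq: "(\<Sum>i<K. H (j, l, i) * row_val E (mono_val I H) (u i) s) - (\<Sum>i<K. H (j, l, i) * row_val E (mono_val I H) (v i) s)
      = row_val ?V (mono_val I H) c s" if s: "s < T" for s
  proof -
    have "row_val ?V (mono_val I H) c s = (\<Sum>f\<in>?V. real_of_int (c0 s f) * mono_val I H f)"
      using s by (simp add: row_val_def c_def cong: sum.cong)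
    also have "\<dots> = (\<Sum>f\<in>?V. \<Sum>i<K. \<Sum>e\<in>E. if shift_exp (j, l, i) e = f then real_of_int (\<Delta> i (s, e)) * mono_val I H f else 0)"
      unfolding c0_def by (auto simp: sum_distrib_right intro!: sum.cong)
    also have "\<dots> = (\<Sum>i<K. \<Sum>f\<in>?V. \<Sum>e\<in>E. if shift_exp (j, l, i) e = f then real_of_int (\<Delta> i (s, e)) * mono_val I H f else 0)"
      by (rule sum.swap)
    also have "\<dots> = (\<Sum>i<K. \<Sum>e\<in>E. \<Sum>f\<in>?V. if shift_exp (j, l, i) e = f then real_of_int (\<Delta> i (s, e)) * mono_val I H f else 0)"
      by (intro sum.cong refl sum.swap)
    also have "\<dots> = (\<Sum>i<K. \<Sum>e\<in>E. real_of_int (\<Delta> i (s, e)) * mono_val I H (shift_exp (j, l, i) e))"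
    proof (intro sum.cong refl)
      fix i e assume "i \<in> {..<K}" "e \<in> E"
      then have "shift_exp (j, l, i) e \<in> ?V" using jl by (intro shift_rx_exps) (auto simp: E_def)
      then show "(\<Sum>f\<in>?V. if shift_exp (j, l, i) e = f then real_of_int (\<Delta> i (s, e)) * mono_val I H f else 0)
        = real_of_int (\<Delta> i (s, e)) * mono_val I H (shift_exp (j, l, i) e)"
        using finV by simp
    qed
    also have "\<dots> = (\<Sum>i<K. H (j, l, i) * row_val E (mono_val I H) (u i) s - H (j, l, i) * row_val E (mono_val I H) (v i) s)"
    proof (intro sum.cong refl)
      fix i assume "i \<in> {..<K}"
      then have "(j, l, i) \<in> I" using jl by (simp add: I_def channel_coords_def)
      then have "mono_val I H (shift_exp (j, l, i) e) = H (j, l, i) * mono_val I H e" for e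
        by (intro mono_val_shift) (simp_all add: I_def finite_channel_coords)
      then show "(\<Sum>e\<in>E. real_of_int (\<Delta> i (s, e)) * mono_val I H (shift_exp (j, l, i) e))
        = H (j, l, i) * row_val E (mono_val I H) (u i) s - H (j, l, i) * row_val E (mono_val I H) (v i) s"
        by (simp add: row_val_def \<Delta>_def sum_distrib_left sum_subtractf[symmetric] algebra_simps)
    qed
    finally show ?thesis by (simp add: sum_subtractf)
  qed
  have "\<exists>p. u j p \<noteq> v j p" using ne by auto
  then obtain s e where se: "u j (s, e) \<noteq> v j (s, e)" by auto
  have "(s, e) \<in> {..<T} \<times> E" using se PiE_arb[OF u[OF jl(1)], of "(s, e)"] PiE_arb[OF v[OF jl(1)], of "(s, e)"] by metis
  then have sT: "s < T" "e \<in> E" by auto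
  define f where "f = shift_exp (j, l, j) e"
  have fV: "f \<in> ?V" unfolding f_def using sT jl by (intro shift_rx_exps) (auto simp: E_def)
  \<comment> \<open>Nothing can cancel at an exponent containing the direct gain: interference has
    power zero of that gain, and distinct own exponents stay distinct.\<close>
  have "c0 s f = (\<Sum>i<K. \<Sum>e'\<in>E. if i = j \<and> e' = e then \<Delta> j (s, e) else 0)"
    unfolding c0_def
  proof (intro sum.cong refl)
    fix i e' assume i: "i \<in> {..<K}" and e': "e' \<in> E"
    have "shift_exp (j, l, i) e' = f \<longleftrightarrow> i = j \<and> e' = e"
    proof
      assume eq: "shift_exp (j, l, i) e' = f"
      have "f (j, l, j) = 1" "e' (j, l, j) = 0"
        using sT e' jl cross_exps_direct[of _ K J N j l] by (auto simp: f_def shift_exp_def E_def)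
      then have "i = j" using fun_cong[OF eq, of "(j, l, j)"] by (auto simp: shift_exp_def split: if_splits)
      moreover have "e' = e"
        using inj_onD[OF shift_direct_inj[of j K l J N, OF jl], of e' e] eq sT e' \<open>i = j\<close> by (auto simp: f_def E_def)
      ultimately show "i = j \<and> e' = e" ..
    qed (simp add: f_def)
    then show "(if shift_exp (j, l, i) e' = f then \<Delta> i (s, e') else 0) = (if i = j \<and> e' = e then \<Delta> j (s, e) else 0)" by auto
  qed
  also have "\<dots> = (\<Sum>i<K. if i = j then \<Delta> j (s, e) else 0)"
    using sT finE by (intro sum.cong) auto
  also have "\<dots> = \<Delta> j (s, e)" using jl by simp
  finally have c_ne: "c (s, f) \<noteq> 0" using se fV sT by (simp add: c_def \<Delta>_def)
  have "c \<in> int_tuples ({..<T} \<times> ?V) (K * card E * Q)"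
  proof (rule int_tuplesI[where ?e0.0="(s, f)"])
    fix p assume "p \<in> {..<T} \<times> ?V"
    then obtain s' f' where p: "p = (s', f')" "s' < T" "f' \<in> ?V" by auto
    have "\<bar>c0 s' f'\<bar> \<le> (\<Sum>i<K. \<Sum>e\<in>E. \<bar>if shift_exp (j, l, i) e = f' then \<Delta> i (s', e) else 0\<bar>)"
      unfolding c0_def by (intro order.trans[OF sum_abs] sum_mono sum_abs)
    also have "\<dots> \<le> (\<Sum>i<K. \<Sum>e\<in>E. int Q)" using \<Delta> p by (intro sum_mono) auto
    also have "\<dots> = int (K * card E * Q)" by simp
    finally show "\<bar>c p\<bar> \<le> int (K * card E * Q)" using p by (simp add: c_def)
  qed (use c_ne fV sT in \<open>auto simp: c_def\<close>)
  then show ?thesis using eq by blast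
qed

section \<open>Degrees of freedom\<close>

text \<open>Each user sends \<open>T * L\<close> integers below \<open>Q\<close>. The amplitude
  \<open>sqrt P\<close> must accommodate weights of size \<open>G\<close> as well as these integers,
  so a separation of order \<open>G / Q ^ (n * T)\<close> becomes
  \<open>sqrt P / Q ^ (n * T + 1)\<close>. The order of quantifiers matters: \<open>\<kappa>\<close>
  precedes \<open>T\<close>, and \<open>C\<close> may depend on \<open>T\<close> but not on
  \<open>Q\<close>, \<open>P\<close> or \<open>k\<close>.\<close>

lemma aligned_code_achievable:
  fixes K N :: nat and J :: "nat \<Rightarrow> nat" and H :: "nat \<times> nat \<times> nat \<Rightarrow> real"
  defines "L \<equiv> N ^ card (cross_coords K J)" and "n \<equiv> N ^ card (cross_coords K J) + Suc N ^ card (cross_coords K J)"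
  assumes K: "K \<ge> 1" and N: "N \<ge> 1" and H: "dioph (channel_coords K J) (Suc N) H"
  shows "\<exists>\<kappa>. \<forall>T\<ge>\<kappa>. T \<ge> 1 \<longrightarrow> (\<exists>C>0. \<forall>Q\<ge>1. \<forall>P>0. \<forall>k>0. \<forall>R.
    2 * 2 ^ k \<le> C * sqrt P / real Q ^ (n * T + 1) \<longrightarrow>
    (\<forall>j<K. 0 \<le> R j \<and> R j \<le> (1 - 2 / real k) * log 2 (real Q ^ (T * L)) - 1) \<longrightarrow>
    achievable K J H P R)"
proof -
  define I where "I = channel_coords K J"
  define E where "E = cross_exps K J N"
  define F where "F = {(j, l). j < K \<and> l < J j}"
  define y where "y = mono_val I H"
  have finI: "finite I" unfolding I_def by (rule finite_channel_coords)
  have finE: "finite E" unfolding E_def by (rule finite_cross_exps)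
  have finF: "finite F"
    by (rule finite_subset[of _ "{..<K} \<times> (\<Union>j<K. {..<J j})"]) (auto simp: F_def)
  have cardE: "card E = L" unfolding E_def L_def by (rule card_cross_exps)
  have L: "L \<ge> 1" unfolding L_def using N by simp
  obtain \<kappa> m where km: "\<And>Q a. Q \<ge> 1 \<Longrightarrow> a \<in> int_tuples (exps I (Suc N)) Q \<Longrightarrow>
     1 \<le> real m * real Q ^ \<kappa> * \<bar>\<Sum>e\<in>exps I (Suc N). real_of_int (a e) * y e\<bar>"
    using H unfolding dioph_def I_def y_def by blast
  define z where "z = (\<lambda>c\<in>I. 0 :: nat)"
  have z: "z \<in> cross_exps K J (Suc N)" unfolding z_def cross_exps_def I_def by auto
  have yz: "y z = 1" unfolding y_def z_def mono_val_def by (intro prod.neutral) auto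
  have "\<exists>C>0. \<forall>Q\<ge>1. \<forall>P>0. \<forall>k>0. \<forall>R.
    2 * 2 ^ k \<le> C * sqrt P / real Q ^ (n * T + 1) \<longrightarrow>
    (\<forall>j<K. 0 \<le> R j \<and> R j \<le> (1 - 2 / real k) * log 2 (real Q ^ (T * L)) - 1) \<longrightarrow>
    achievable K J H P R" if T: "\<kappa> \<le> T" "T \<ge> 1" for T
  proof -
    have "\<exists>\<epsilon>>0. \<forall>Q\<ge>1. \<exists>G\<ge>1. \<exists>\<omega> :: nat \<Rightarrow> int. (\<forall>s<T. 0 \<le> \<omega> s \<and> \<omega> s < int G) \<and>
      (\<forall>f\<in>F. \<forall>c\<in>int_tuples ({..<T} \<times> rx_exps K J N f) Q.
      \<epsilon> * real G / real Q ^ (n * T) \<le> \<bar>\<Sum>s<T. real_of_int (\<omega> s) * row_val (rx_exps K J N f) y c s\<bar>)"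
    proof (rule separating_weights[OF finF T, where ?e0.0="\<lambda>_. z" and y="\<lambda>_. y" and m=m])
      fix f assume f: "f \<in> F"
      then obtain j l where jl: "f = (j, l)" "j < K" "l < J j" by (auto simp: F_def)
      show "finite (rx_exps K J N f)" unfolding jl rx_exps_def using finite_cross_exps by auto
      show "z \<in> rx_exps K J N f" unfolding jl rx_exps_def using z by auto
      show "y z = 1" by (rule yz)
      show "card (rx_exps K J N f) = n" unfolding jl n_def by (rule card_rx_exps) (use jl in auto)
      fix Q :: nat and a assume Q: "1 \<le> Q" and a: "a \<in> int_tuples (rx_exps K J N f) Q"
      show "1 \<le> real m * real Q ^ \<kappa> * \<bar>\<Sum>e\<in>rx_exps K J N f. real_of_int (a e) * y e\<bar>"
        unfolding y_def
      proof (rule dioph_subset[OF finI _ a])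
        show "rx_exps K J N f \<subseteq> exps I (Suc N)"
          unfolding jl(1) I_def by (rule rx_exps_subset_exps[OF N]) (use jl in auto)
      qed (use km[OF Q] in \<open>simp add: y_def\<close>)
    qed
    then obtain \<epsilon> where \<epsilon>: "\<epsilon> > 0" and weights: "\<And>Q. Q \<ge> 1 \<Longrightarrow> \<exists>G\<ge>1. \<exists>\<omega> :: nat \<Rightarrow> int. (\<forall>s<T. 0 \<le> \<omega> s \<and> \<omega> s < int G) \<and>
      (\<forall>f\<in>F. \<forall>c\<in>int_tuples ({..<T} \<times> rx_exps K J N f) Q.
      \<epsilon> * real G / real Q ^ (n * T) \<le> \<bar>\<Sum>s<T. real_of_int (\<omega> s) * row_val (rx_exps K J N f) y c s\<bar>)"
      by blast
    define S where "S = (\<Sum>e\<in>E. \<bar>y e\<bar>) + 1"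
    have S: "S > 0" unfolding S_def by (intro add_nonneg_pos sum_nonneg) auto
    define C where "C = \<epsilon> / (real T * S * real (K * L) ^ (n * T))"
    have C: "C > 0" unfolding C_def using \<epsilon> T S K L by (intro divide_pos_pos mult_pos_pos zero_less_power) auto
    have "achievable K J H P R"
      if Q: "Q \<ge> 1" and P: "P > 0" and k: "k > 0" and sep: "2 * 2 ^ k \<le> C * sqrt P / real Q ^ (n * T + 1)"
        and R: "\<forall>j<K. 0 \<le> R j \<and> R j \<le> (1 - 2 / real k) * log 2 (real Q ^ (T * L)) - 1" for Q P k R
    proof -
      \<comment> \<open>The weights must separate differences of received signals, whose
        coefficients can reach \<open>K * L * Q\<close>; the factor \<open>K * L\<close> is absorbed
        in \<open>C\<close>.\<close>
      have Q': "K * L * Q \<ge> 1" using K L Q by simp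
      obtain G :: nat and \<omega> :: "nat \<Rightarrow> int" where G: "G \<ge> 1" and \<omega>: "\<And>s. s < T \<Longrightarrow> 0 \<le> \<omega> s \<and> \<omega> s < int G"
        and far: "\<And>f c. f \<in> F \<Longrightarrow> c \<in> int_tuples ({..<T} \<times> rx_exps K J N f) (K * L * Q) \<Longrightarrow>
          \<epsilon> * real G / real (K * L * Q) ^ (n * T) \<le> \<bar>\<Sum>s<T. real_of_int (\<omega> s) * row_val (rx_exps K J N f) y c s\<bar>"
        using weights[OF Q'] by blast
      \<comment> \<open>Bounds every symbol by \<open>sqrt P\<close>, so the power constraint holds
        at each time and not only on average.\<close>
      define a where "a = sqrt P / (real T * S * real G * real Q)"
      have a: "a > 0" unfolding a_def using P T S G Q by (intro divide_pos_pos mult_pos_pos) auto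
      define x where "x b = a * (\<Sum>s<T. real_of_int (\<omega> s) * row_val E y b s)" for b
      define A where "A = (\<Pi>\<^sub>E p\<in>{..<T} \<times> E. {0..<int Q})"
      have cardA: "real (card A) = real Q ^ (T * L)"
        unfolding A_def using finE by (simp add: card_PiE cardE)
      show ?thesis
      proof (rule achievable_if_separated[where A=A and x=x and k=k and d="2 ^ k"])
        show "finite A" unfolding A_def using finE by (intro finite_PiE) auto
        show "A \<noteq> {}" unfolding A_def using Q by (auto simp: PiE_eq_empty_iff)
        show "(2::real) ^ k \<le> 2 ^ k" by simp
        fix b assume b: "b \<in> A"
        have "\<bar>\<Sum>s<T. real_of_int (\<omega> s) * row_val E y b s\<bar> \<le> (\<Sum>s<T. real G * (real Q * S))"
        proof (intro order.trans[OF sum_abs] sum_mono)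
          fix s assume s: "s \<in> {..<T}"
          have "\<bar>row_val E y b s\<bar> \<le> (\<Sum>e\<in>E. \<bar>real_of_int (b (s, e)) * y e\<bar>)"
            unfolding row_val_def by (rule sum_abs)
          also have "\<dots> \<le> (\<Sum>e\<in>E. real Q * \<bar>y e\<bar>)"
          proof (rule sum_mono)
            fix e assume "e \<in> E"
            then have "b (s, e) \<in> {0..<int Q}" using PiE_mem[OF b[unfolded A_def], of "(s, e)"] s by auto
            then have "\<bar>real_of_int (b (s, e))\<bar> \<le> real Q" by auto
            then show "\<bar>real_of_int (b (s, e)) * y e\<bar> \<le> real Q * \<bar>y e\<bar>"
              unfolding abs_mult by (intro mult_right_mono) auto
          qed
          also have "\<dots> \<le> real Q * S" by (simp add: S_def sum_distrib_left[symmetric] distrib_left)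
          finally have "\<bar>row_val E y b s\<bar> \<le> real Q * S" .
          moreover have "\<bar>real_of_int (\<omega> s)\<bar> \<le> real G" using \<omega>[of s] s by auto
          ultimately show "\<bar>real_of_int (\<omega> s) * row_val E y b s\<bar> \<le> real G * (real Q * S)"
            unfolding abs_mult by (intro mult_mono) auto
        qed
        then have "\<bar>x b\<bar> \<le> a * (\<Sum>s<T. real G * (real Q * S))"
          unfolding x_def abs_mult using a by (simp add: mult_left_mono)
        also have "\<dots> = sqrt P" unfolding a_def using T S G Q by (simp add: field_simps)
        finally have "\<bar>x b\<bar> \<le> sqrt P" .
        then have "\<bar>x b\<bar>\<^sup>2 \<le> (sqrt P)\<^sup>2" by (intro power_mono) auto
        then show "(x b)\<^sup>2 \<le> P" using P by simp
      next
        fix j l u v assume jl: "j < K" "l < J j" and u: "u \<in> (\<Pi>\<^sub>E i\<in>{..<K}. A)" and v: "v \<in> (\<Pi>\<^sub>E i\<in>{..<K}. A)" and ne: "u j \<noteq> v j"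
        have uA: "u i \<in> (\<Pi>\<^sub>E p\<in>{..<T} \<times> E. {0..<int Q})" "v i \<in> (\<Pi>\<^sub>E p\<in>{..<T} \<times> E. {0..<int Q})" if "i < K" for i
          using PiE_mem[OF u, of i] PiE_mem[OF v, of i] that by (simp_all add: A_def)
        obtain c where c: "c \<in> int_tuples ({..<T} \<times> rx_exps K J N (j, l)) (K * L * Q)"
          and ceq: "\<And>s. s < T \<Longrightarrow> (\<Sum>i<K. H (j, l, i) * row_val E y (u i) s) - (\<Sum>i<K. H (j, l, i) * row_val E y (v i) s)
            = row_val (rx_exps K J N (j, l)) y c s"
          using received_difference[of j K l J Q u T N v H, OF jl Q uA[unfolded E_def] ne]
          unfolding E_def[symmetric] cardE I_def[symmetric] y_def[symmetric] by blast
        have xs: "(\<Sum>i<K. H (j, l, i) * x (w i)) = a * (\<Sum>s<T. real_of_int (\<omega> s) * (\<Sum>i<K. H (j, l, i) * row_val E y (w i) s))" for w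
        proof -
          have "(\<Sum>i<K. H (j, l, i) * x (w i)) = (\<Sum>i<K. \<Sum>s<T. a * (real_of_int (\<omega> s) * (H (j, l, i) * row_val E y (w i) s)))"
            by (simp add: x_def sum_distrib_left mult_ac)
          also have "\<dots> = (\<Sum>s<T. \<Sum>i<K. a * (real_of_int (\<omega> s) * (H (j, l, i) * row_val E y (w i) s)))"
            by (rule sum.swap)
          finally show ?thesis by (simp add: sum_distrib_left)
        qed
        have "(\<Sum>i<K. H (j, l, i) * x (u i)) - (\<Sum>i<K. H (j, l, i) * x (v i))
          = a * (\<Sum>s<T. real_of_int (\<omega> s) * ((\<Sum>i<K. H (j, l, i) * row_val E y (u i) s) - (\<Sum>i<K. H (j, l, i) * row_val E y (v i) s)))"
          unfolding xs by (simp only: right_diff_distrib sum_subtractf)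
        also have "\<dots> = a * (\<Sum>s<T. real_of_int (\<omega> s) * row_val (rx_exps K J N (j, l)) y c s)"
          using ceq by simp
        finally have diff: "\<bar>(\<Sum>i<K. H (j, l, i) * x (u i)) - (\<Sum>i<K. H (j, l, i) * x (v i))\<bar>
          = a * \<bar>\<Sum>s<T. real_of_int (\<omega> s) * row_val (rx_exps K J N (j, l)) y c s\<bar>"
          using a by (simp add: abs_mult)
        have "2 * 2 ^ k \<le> C * sqrt P / real Q ^ (n * T + 1)" by (rule sep)
        also have "\<dots> = a * (\<epsilon> * real G / real (K * L * Q) ^ (n * T))"
        proof -
          have "real (K * L * Q) ^ (n * T) = real (K * L) ^ (n * T) * real Q ^ (n * T)"
            by (simp add: power_mult_distrib)
          then show ?thesis unfolding C_def a_def using G by (simp add: mult_ac del: of_nat_mult)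
        qed
        also have "\<dots> \<le> a * \<bar>\<Sum>s<T. real_of_int (\<omega> s) * row_val (rx_exps K J N (j, l)) y c s\<bar>"
          using far[OF _ c] jl a by (intro mult_left_mono) (auto simp: F_def)
        finally show "2 * 2 ^ k \<le> \<bar>(\<Sum>i<K. H (j, l, i) * x (u i)) - (\<Sum>i<K. H (j, l, i) * x (v i))\<bar>"
          unfolding diff .
      qed (use k R in \<open>auto simp: cardA\<close>)
    qed
    then show ?thesis using C by blast
  qed
  then show ?thesis by blast
qed

text \<open>The share of the desired signal among the received directions tends to one half, because
  \<open>(1 + 1 / N) ^ m\<close> tends to one for fixed \<open>m\<close>.\<close>

lemma exists_alignment_depth:
  assumes \<theta>: "0 < \<theta>" "\<theta> < 1/2"
  shows "\<exists>N\<ge>1. \<theta> * real (N ^ m + Suc N ^ m) < real (N ^ m)"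
proof -
  have "(\<lambda>N. (1 + 1 / real N) ^ m) \<longlonglongrightarrow> (1 + 0) ^ m"
    by (intro tendsto_intros lim_1_over_n)
  moreover have "1 < (1 - \<theta>) / \<theta>" using \<theta> by (simp add: field_simps)
  ultimately have "eventually (\<lambda>N. (1 + 1 / real N) ^ m < (1 - \<theta>) / \<theta>) sequentially"
    by (intro order_tendstoD(2)) auto
  then have "eventually (\<lambda>N. (1 + 1 / real N) ^ m < (1 - \<theta>) / \<theta> \<and> N \<ge> 1) sequentially"
    using eventually_ge_at_top[of 1] by eventually_elim simp
  then obtain N where N: "(1 + 1 / real N) ^ m < (1 - \<theta>) / \<theta>" "N \<ge> 1"
    by (auto simp: eventually_sequentially)
  have "real (Suc N) ^ m = (1 + 1 / real N) ^ m * real N ^ m"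
    using N(2) by (simp add: power_mult_distrib[symmetric] field_simps)
  also have "\<dots> < (1 - \<theta>) / \<theta> * real N ^ m"
    using N by (intro mult_strict_right_mono) auto
  finally have "\<theta> * real (Suc N) ^ m < (1 - \<theta>) * real N ^ m"
    using \<theta> by (simp add: field_simps)
  then show ?thesis using N(2) by (intro exI[of _ N]) (simp add: algebra_simps)
qed

text \<open>The number \<open>T\<close> of weights also serves as the outer code parameter
  \<open>k\<close>, so the rate is about \<open>(T - 2) * L * log 2 Q\<close>, with \<open>Q\<close>
  about \<open>P powr (1 / (2 * (n * T + 2)))\<close>. As \<open>T\<close> grows, the resulting
  share \<open>\<beta>\<close> of \<open>1/2 log P\<close> tends to \<open>L / n\<close>, which
  exceeds \<open>\<theta>\<close>.\<close>

lemma eventually_achievable: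
  assumes K: "K \<ge> 1" and H: "\<And>N. dioph (channel_coords K J) (Suc N) H" and \<theta>: "0 < \<theta>" "\<theta> < 1/2"
  shows "eventually (\<lambda>P. achievable K J H P (\<lambda>_. \<theta> * (1/2 * log 2 P))) at_top"
proof -
  let ?m = "card (cross_coords K J)"
  obtain N where N: "N \<ge> 1" "\<theta> * real (N ^ ?m + Suc N ^ ?m) < real (N ^ ?m)"
    using exists_alignment_depth[OF \<theta>] by blast
  define L where "L = N ^ ?m"
  define n where "n = N ^ ?m + Suc N ^ ?m"
  have gap: "real L - \<theta> * real n > 0" using N(2) by (simp add: L_def n_def)
  obtain \<kappa> where \<kappa>: "\<And>T. T \<ge> \<kappa> \<Longrightarrow> T \<ge> 1 \<Longrightarrow> \<exists>C>0. \<forall>Q\<ge>1. \<forall>P>0. \<forall>k>0. \<forall>R.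
    2 * 2 ^ k \<le> C * sqrt P / real Q ^ (n * T + 1) \<longrightarrow>
    (\<forall>j<K. 0 \<le> R j \<and> R j \<le> (1 - 2 / real k) * log 2 (real Q ^ (T * L)) - 1) \<longrightarrow>
    achievable K J H P R"
    using aligned_code_achievable[OF K N(1) H, folded L_def n_def] by blast
  \<comment> \<open>Solves \<open>\<theta> * (n * T + 2) < (T - 2) * L\<close> for
    \<open>T\<close>.\<close>
  obtain T0 :: nat where T0: "(2 * \<theta> + 2 * real L) / (real L - \<theta> * real n) < real T0"
    using reals_Archimedean2 by blast
  define T where "T = max T0 (max \<kappa> 2)"
  have T: "T \<ge> \<kappa>" "T \<ge> 2" "T \<ge> 1" by (auto simp: T_def)
  have "(2 * \<theta> + 2 * real L) / (real L - \<theta> * real n) < real T" using T0 by (simp add: T_def)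
  then have T_gap: "2 * \<theta> + 2 * real L < real T * (real L - \<theta> * real n)"
    using gap by (simp add: field_simps)
  \<comment> \<open>One more than the exponent \<open>n * T + 1\<close> of the separation: with
    \<open>sqrt P = p ^ M\<close> and \<open>Q \<le> p\<close>, a spare factor \<open>p\<close>
    remains that eventually exceeds \<open>2 * 2 ^ T / C\<close>.\<close>
  define M where "M = n * T + 2"
  define \<beta> where "\<beta> = (real T - 2) * real L / real M"
  have M: "real M > 0" unfolding of_nat_0_less_iff by (simp add: M_def)
  have \<beta>: "\<theta> < \<beta>"
  proof -
    have "\<theta> * real M < (real T - 2) * real L" using T_gap by (simp add: M_def algebra_simps)
    then show ?thesis using M by (simp add: \<beta>_def field_simps)
  qed
  obtain C where C: "C > 0" and ach: "\<forall>Q\<ge>1. \<forall>P>0. \<forall>k>0. \<forall>R.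
    2 * 2 ^ k \<le> C * sqrt P / real Q ^ (n * T + 1) \<longrightarrow>
    (\<forall>j<K. 0 \<le> R j \<and> R j \<le> (1 - 2 / real k) * log 2 (real Q ^ (T * L)) - 1) \<longrightarrow>
    achievable K J H P R"
    using \<kappa>[OF T(1,3)] by (elim exE conjE)
  define \<gamma> where "\<gamma> = 1 / (2 * real M)"
  have \<gamma>: "\<gamma> > 0" using M by (simp add: \<gamma>_def)
  \<comment> \<open>The loss from rounding \<open>p\<close> down, at most one bit in
    \<open>log 2 Q\<close> as \<open>Q \<ge> p / 2\<close>, plus the one bit of the outer
    code.\<close>
  define b where "b = (real T - 2) * real L + 1"
  have b: "b > 0" using T by (simp add: b_def add_nonneg_pos)
  \<comment> \<open>The three thresholds ensure, in turn, a nonnegative logarithm, the separation,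
    and that \<open>(\<beta> - \<theta>) * \<tau>\<close> covers \<open>b\<close>.\<close>
  define P0 where "P0 = max 1 (max ((2 * 2 ^ T / C) powr (1 / \<gamma>)) (2 powr (2 * b / (\<beta> - \<theta>))))"
  have "achievable K J H P (\<lambda>_. \<theta> * (1/2 * log 2 P))" if P: "P \<ge> P0" for P
  proof -
    have P1: "P \<ge> 1" "P \<ge> (2 * 2 ^ T / C) powr (1 / \<gamma>)" "P \<ge> 2 powr (2 * b / (\<beta> - \<theta>))"
      using P by (auto simp: P0_def)
    define p where "p = P powr \<gamma>"
    have p1: "p \<ge> 1" unfolding p_def using P1(1) \<gamma> by (intro ge_one_powr_ge_zero) auto
    have pC: "2 * 2 ^ T \<le> C * p"
    proof -
      have "2 * 2 ^ T / C = ((2 * 2 ^ T / C) powr (1 / \<gamma>)) powr \<gamma>"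
        using \<gamma> C by (simp add: powr_powr)
      also have "\<dots> \<le> p" unfolding p_def using P1(2) \<gamma> by (intro powr_mono2) auto
      finally show ?thesis using C by (simp add: field_simps)
    qed
    have sq: "sqrt P = p ^ M"
    proof -
      have "p ^ M = p powr real M" using p1 by (simp add: powr_realpow)
      also have "\<dots> = P powr (1/2)" using M by (simp add: p_def powr_powr \<gamma>_def)
      finally show ?thesis using P1(1) by (simp add: powr_half_sqrt)
    qed
    define Q where "Q = nat \<lfloor>p\<rfloor>"
    have fl: "1 \<le> \<lfloor>p\<rfloor>" "real Q = real_of_int \<lfloor>p\<rfloor>" using p1 by (auto simp: Q_def)
    have Q: "Q \<ge> 1" "real Q \<le> p" "p / 2 \<le> real Q"
      using fl real_of_int_floor_add_one_gt[of p] of_int_floor_le[of p] by linarith+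
    define \<tau> where "\<tau> = 1/2 * log 2 P"
    have \<tau>: "b \<le> (\<beta> - \<theta>) * \<tau>"
    proof -
      have "2 * b / (\<beta> - \<theta>) \<le> log 2 P"
        using P1 by (simp add: le_log_iff)
      then show ?thesis using \<beta> by (simp add: \<tau>_def field_simps)
    qed
    have \<tau>0: "\<tau> \<ge> 0" using P1(1) by (simp add: \<tau>_def)
    have logp: "log 2 p = \<tau> / real M"
      using P1(1) by (simp add: p_def log_powr \<gamma>_def \<tau>_def)
    have logQ: "\<tau> / real M - 1 \<le> log 2 (real Q)"
    proof -
      have "log 2 (p / 2) \<le> log 2 (real Q)" using Q p1 by (subst log_le_cancel_iff) auto
      moreover have "log 2 (p / 2) = log 2 p - 1" using p1 by (simp add: log_divide)
      ultimately show ?thesis using logp by simp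
    qed
    show ?thesis
    proof (rule ach[THEN spec, THEN mp, OF Q(1), THEN spec, THEN mp, THEN spec, THEN mp, THEN spec, THEN mp, THEN mp])
      show "P > 0" "T > 0" using P1 T by auto
      have "2 * 2 ^ T \<le> C * p" by (rule pC)
      also have "\<dots> = C * sqrt P / p ^ (n * T + 1)"
        using p1 by (simp add: sq M_def)
      also have "\<dots> \<le> C * sqrt P / real Q ^ (n * T + 1)"
        using Q C P1 p1 by (intro divide_left_mono power_mono mult_pos_pos zero_less_power) auto
      finally show "2 * 2 ^ T \<le> C * sqrt P / real Q ^ (n * T + 1)" .
      have "\<theta> * \<tau> \<le> \<beta> * \<tau> - b" using \<tau> by (simp add: algebra_simps)
      also have "\<dots> = (real T - 2) * real L * (\<tau> / real M - 1) - 1"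
      proof -
        have "x / y * \<tau> - (x + 1) = x * (\<tau> / y - 1) - 1" for x y :: real by (simp add: algebra_simps)
        then show ?thesis unfolding \<beta>_def b_def .
      qed
      also have "\<dots> \<le> (real T - 2) * real L * log 2 (real Q) - 1"
        using logQ T by (intro diff_right_mono mult_left_mono) auto
      also have "(real T - 2) * real L * log 2 (real Q) = (1 - 2 / real T) * log 2 (real Q ^ (T * L))"
        using Q(1) T by (simp add: log_nat_power field_simps)
      finally show "\<forall>j<K. 0 \<le> \<theta> * (1/2 * log 2 P) \<and> \<theta> * (1/2 * log 2 P) \<le> (1 - 2 / real T) * log 2 (real Q ^ (T * L)) - 1"
        using \<theta> \<tau>0 by (simp add: \<tau>_def)
    qed
  qed
  then show ?thesis unfolding eventually_at_top_linorder by blast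
qed

text \<open>Exponents below two already include the monomial \<open>x c\<close>, and the coefficient
  tuple that selects it bounds its size from below. The converse divides by such a gain.\<close>

lemma dioph_nonzero:
  assumes I: "finite I" "c \<in> I" and x: "dioph I (Suc (Suc 0)) x"
  shows "x c \<noteq> 0"
proof -
  obtain \<kappa> m where km: "\<And>Q a. Q \<ge> 1 \<Longrightarrow> a \<in> int_tuples (exps I (Suc (Suc 0))) Q \<Longrightarrow>
     1 \<le> real m * real Q ^ \<kappa> * \<bar>\<Sum>e\<in>exps I (Suc (Suc 0)). real_of_int (a e) * mono_val I x e\<bar>"
    using x unfolding dioph_def by blast
  define e0 where "e0 = (\<lambda>i\<in>I. if i = c then 1 else 0 :: nat)"
  have e0: "e0 \<in> exps I (Suc (Suc 0))" by (auto simp: e0_def exps_def)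
  have v: "mono_val I x e0 = x c"
  proof -
    have "mono_val I x e0 = (\<Prod>i\<in>I. if i = c then x c else 1)"
      unfolding mono_val_def e0_def by (intro prod.cong) auto
    then show ?thesis using I by simp
  qed
  let ?a = "\<lambda>e\<in>exps I (Suc (Suc 0)). if e = e0 then 1 else 0 :: int"
  have "?a \<in> int_tuples (exps I (Suc (Suc 0))) 1"
    using e0 by (intro int_tuplesI[of _ _ _ e0]) auto
  from km[OF order.refl this]
  have "1 \<le> real m * \<bar>\<Sum>e\<in>exps I (Suc (Suc 0)). if e = e0 then mono_val I x e else 0\<bar>"
    by (simp add: if_distrib[of "\<lambda>t. t * _"] if_distrib[of real_of_int] cong: sum.cong if_cong)
  then have "1 \<le> real m * \<bar>x c\<bar>" using e0 v finite_exps[OF I(1)] by simp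
  then show ?thesis by auto
qed

lemma has_dof_if_dioph:
  assumes K: "K \<ge> 2" and J: "\<And>j. j < K \<Longrightarrow> J j \<ge> 1" and H: "\<And>N. dioph (channel_coords K J) (Suc N) H"
  shows "has_dof K J H (real K / 2)"
proof -
  have h: "H (i, 0, j) \<noteq> 0" if "i < K" "j < K" for i j
    using J[OF that(1)] that by (intro dioph_nonzero[OF finite_channel_coords _ H]) (auto simp: channel_coords_def)
  have "\<exists>C. \<forall>P\<ge>1. sum_capacity K J H P \<le> ereal (C + real K / 2 * (1/2 * log 2 P))"
    by (rule sum_capacity_upper_bound) (use K J h in auto)
  then obtain C where C: "\<forall>P\<ge>1. sum_capacity K J H P \<le> ereal (C + real K / 2 * (1/2 * log 2 P))"
    by (elim exE)
  have pos: "eventually (\<lambda>P. P \<ge> 1 \<and> 1/2 * log 2 P > 0) at_top"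
    using eventually_gt_at_top[of 1] by eventually_elim auto
  show ?thesis
    unfolding has_dof_def
  proof (rule order_tendstoI)
    fix a :: ereal assume "a < ereal (real K / 2)"
    then obtain t where t: "a < ereal t" "t < real K / 2" by (metis ereal_dense2 less_ereal.simps(1))
    \<comment> \<open>The maximum with \<open>1/4\<close> keeps \<open>\<theta>\<close> positive
      when \<open>t\<close> is small or negative.\<close>
    define \<theta> where "\<theta> = max (1/4) (t / real K)"
    have \<theta>: "0 < \<theta>" "\<theta> < 1/2" "t \<le> real K * \<theta>"
      using t K by (auto simp: \<theta>_def field_simps max_def)
    have "K \<ge> 1" using K by simp
    from eventually_achievable[OF this H \<theta>(1,2)] pos
    show "eventually (\<lambda>P. a < sum_capacity K J H P / ereal (1/2 * log 2 P)) at_top"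
    proof eventually_elim
      case (elim P)
      have "ereal (\<Sum>j<K. \<theta> * (1/2 * log 2 P)) \<le> sum_capacity K J H P"
        unfolding sum_capacity_def
        by (rule SUP_upper2[of "\<lambda>_. \<theta> * (1/2 * log 2 P)"]) (use elim in auto)
      then have "ereal (real K * \<theta> * (1/2 * log 2 P)) / ereal (1/2 * log 2 P) \<le> sum_capacity K J H P / ereal (1/2 * log 2 P)"
        using elim by (intro ereal_divide_right_mono) (auto simp: mult.assoc)
      moreover have "ereal (real K * \<theta> * (1/2 * log 2 P)) / ereal (1/2 * log 2 P) = ereal (real K * \<theta>)"
        using elim by simp
      moreover have "a < ereal (real K * \<theta>)" using t(1) \<theta>(3) by (meson ereal_less_eq(3) less_le_trans)
      ultimately show ?case by simp
    qed
  next
    fix a :: ereal assume a: "ereal (real K / 2) < a"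
    have "filterlim (\<lambda>P. 1/2 * log 2 P) at_top at_top" by real_asymp
    then have "((\<lambda>P. C / (1/2 * log 2 P) + real K / 2) \<longlongrightarrow> 0 + real K / 2) at_top"
      by (intro tendsto_add tendsto_const tendsto_divide_0[OF tendsto_const] filterlim_at_top_imp_at_infinity)
    then have "((\<lambda>P. ereal (C / (1/2 * log 2 P) + real K / 2)) \<longlongrightarrow> ereal (real K / 2)) at_top"
      by (intro tendsto_ereal) simp
    from order_tendstoD(2)[OF this a] pos
    show "eventually (\<lambda>P. sum_capacity K J H P / ereal (1/2 * log 2 P) < a) at_top"
    proof eventually_elim
      case (elim P)
      have "sum_capacity K J H P / ereal (1/2 * log 2 P) \<le> ereal (C + real K / 2 * (1/2 * log 2 P)) / ereal (1/2 * log 2 P)"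
        using elim C by (intro ereal_divide_right_mono) auto
      also have "\<dots> = ereal (C / (1/2 * log 2 P) + real K / 2)"
        using elim by (simp add: add_divide_distrib)
      finally show ?case using elim by simp
    qed
  qed
qed

theorem theorem6:
  fixes K :: nat and J :: "nat \<Rightarrow> nat" and \<mu> :: "(nat \<times> nat \<times> nat \<Rightarrow> real) measure"
  assumes "K \<ge> 2"
    and "\<And>j. j < K \<Longrightarrow> J j \<ge> 1"
    and "prob_space \<mu>"
    and "sets \<mu> = sets (\<Pi>\<^sub>M c\<in>channel_coords K J. lborel)"
    and "absolutely_continuous (\<Pi>\<^sub>M c\<in>channel_coords K J. lborel) \<mu>"
  shows "AE H in \<mu>. has_dof K J H (real K / 2)"
proof -
  \<comment> \<open>Rates closer to the limit need deeper monomials, so one \<open>H\<close> must be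
    good for every \<open>N\<close>; only countably many null sets are discarded.\<close>
  have "AE H in (\<Pi>\<^sub>M c\<in>channel_coords K J. lborel). \<forall>N. dioph (channel_coords K J) (Suc N) H"
    unfolding AE_all_countable by (intro allI dioph_AE finite_channel_coords)
  then have "AE H in \<mu>. \<forall>N. dioph (channel_coords K J) (Suc N) H"
    by (rule absolutely_continuous_AE[OF assms(4,5)])
  then show ?thesis
  proof eventually_elim
    case (elim H)
    show ?case by (rule has_dof_if_dioph) (use assms(1,2) elim in auto)
  qed
qed

end
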